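(* Let $K$ be an infinite field of arbitrary characteristic, $R=K[[x_1,\ldots,x_s]]$ with maximal ideal $\mathfrak{m}=\langle x_1,\ldots,x_s\rangle$, and $M_{2,2}$ the set of $2\times 2$ matrices with entries in $R$. Let $A\in \mathfrak{m}\cdot M_{2,2}$. Then the following are equivalent: 1. $A$ is finitely $G$-determined. 2. $\dim_K M_{2,2}/\widetilde T_A(GA)<\infty$.
   Context: Let $G=\left(GL(2,R)\times GL(2,R)^{\mathrm{op}}\right)\rtimes \mathrm{Aut}(R)$, where $\mathrm{Aut}(R)$ is the group of $K$-algebra automorphisms of $R$. It acts on $M_{2,2}$ by $(U,V,\phi,A)\mapsto U\cdot\phi(A)\cdot V$, where $\phi(A)=[\phi(a_{ij})]=[a_{ij}(\phi(x_1),\ldots,\phi(x_s))]$ with $\phi(x_i)\in\mathfrak{m}$. Two matrices $A,B$ are $G$-equivalent if $B$ lies in the $G$-orbit $GA$ of $A$. A matrix $A$ is $G$ $k$-determined if every $B\in M_{2,2}$ with $B-A\in\mathfrak{m}^{k+1}\cdot M_{2,2}$ is $G$-equivalent to $A$; $A$ is finitely $G$-determined if it is $G$ $k$-determined for some positive integer $k$. The tangent image of $A$ is the $R$-submodule $\widetilde T_A(GA)=\langle E_{pq}\cdot A : p,q=1,2\rangle+\langle A\cdot E_{hl}: h,l=1,2\rangle+\mathfrak{m}\cdot\langle \partial A/\partial x_\nu : \nu=1,\ldots,s\rangle$ of $M_{2,2}$, where $E_{pq}$ is the $2\times2$ matrix with $1$ at position $(p,q)$ and $0$ elsewhere, $\partial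 A/\partial x_\nu$ is the entrywise partial derivative, and $\langle\cdot\rangle$ denotes the $R$-submodule generated. *)

theory Defs
  imports Main
begin

text \<open>A power series is represented by its coefficient function on exponent
vectors (nat => nat).  The ring R (for a given number s of variables) is the
carrier set PS s of coefficient functions vanishing outside the exponent
vectors supported in {0..<s}.\<close>

type_synonym 'a ps = "(nat \<Rightarrow> nat) \<Rightarrow> 'a"

definition expvecs :: "nat \<Rightarrow> (nat \<Rightarrow> nat) set" where
  "expvecs s = {\<alpha>. \<forall>i\<ge>s. \<alpha> i = 0}"

definition PS :: "nat \<Rightarrow> 'a::zero ps set" where
  "PS s = {f. \<forall>\<alpha>. \<alpha> \<notin> expvecs s \<longrightarrow> f \<alpha> = 0}"

definition ps_zero :: "'a::zero ps" where
  "ps_zero = (\<lambda>_. 0)"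

definition ps_const :: "'a::zero \<Rightarrow> 'a ps" where
  "ps_const c = (\<lambda>\<alpha>. if \<alpha> = (\<lambda>_. 0) then c else 0)"

definition ps_one :: "'a::{zero,one} ps" where
  "ps_one = ps_const 1"

definition ps_add :: "'a::plus ps \<Rightarrow> 'a ps \<Rightarrow> 'a ps" where
  "ps_add f g = (\<lambda>\<alpha>. f \<alpha> + g \<alpha>)"

definition ps_sub :: "'a::minus ps \<Rightarrow> 'a ps \<Rightarrow> 'a ps" where
  "ps_sub f g = (\<lambda>\<alpha>. f \<alpha> - g \<alpha>)"

definition ps_mult :: "'a::comm_semiring_1 ps \<Rightarrow> 'a ps \<Rightarrow> 'a ps" where
  "ps_mult f g = (\<lambda>\<alpha>. \<Sum>\<beta>\<in>{\<beta>. \<forall>i. \<beta> i \<le> \<alpha> i}. f \<beta> * g (\<lambda>i. \<alpha> i - \<beta> i))"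

definition ps_X :: "nat \<Rightarrow> 'a::{zero,one} ps" where
  "ps_X i = (\<lambda>\<alpha>. if \<alpha> = (\<lambda>j. if j = i then 1 else 0) then 1 else 0)"

definition ps_deriv :: "nat \<Rightarrow> 'a::comm_semiring_1 ps \<Rightarrow> 'a ps" where
  "ps_deriv \<nu> f = (\<lambda>\<alpha>. of_nat (\<alpha> \<nu> + 1) * f (\<alpha>(\<nu> := \<alpha> \<nu> + 1)))"

definition ideal_gen :: "nat \<Rightarrow> 'a::comm_semiring_1 ps set \<Rightarrow> 'a ps set" where
  "ideal_gen s G = {(\<lambda>\<alpha>. \<Sum>x\<in>F. ps_mult (r x) (g x) \<alpha>) | F r g.
      finite (F :: nat set) \<and> (\<forall>x\<in>F. r x \<in> PS s \<and> g x \<in> G)}"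

definition ideal_mult :: "nat \<Rightarrow> 'a::comm_semiring_1 ps set \<Rightarrow> 'a ps set \<Rightarrow> 'a ps set" where
  "ideal_mult s I J = ideal_gen s {ps_mult a b | a b. a \<in> I \<and> b \<in> J}"

fun ideal_pow :: "nat \<Rightarrow> 'a::comm_semiring_1 ps set \<Rightarrow> nat \<Rightarrow> 'a ps set" where
  "ideal_pow s I 0 = PS s"
| "ideal_pow s I (Suc k) = ideal_mult s I (ideal_pow s I k)"

definition mideal :: "nat \<Rightarrow> 'a::comm_semiring_1 ps set" where
  "mideal s = ideal_gen s {ps_X i | i. i < s}"

text \<open>Matrices are functions nat => nat => R, with indices 0,1; entries
outside the 2x2 range are required to be zero.\<close>

type_synonym 'a mat2 = "nat \<Rightarrow> nat \<Rightarrow> 'a ps"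

definition M22 :: "nat \<Rightarrow> 'a::zero mat2 set" where
  "M22 s = {A. (\<forall>i j. i < 2 \<and> j < 2 \<longrightarrow> A i j \<in> PS s)
              \<and> (\<forall>i j. \<not> (i < 2 \<and> j < 2) \<longrightarrow> A i j = ps_zero)}"

definition mat_add :: "'a::plus mat2 \<Rightarrow> 'a mat2 \<Rightarrow> 'a mat2" where
  "mat_add A B = (\<lambda>i j. ps_add (A i j) (B i j))"

definition mat_sub :: "'a::minus mat2 \<Rightarrow> 'a mat2 \<Rightarrow> 'a mat2" where
  "mat_sub A B = (\<lambda>i j. ps_sub (A i j) (B i j))"

definition mat_mult :: "'a::comm_semiring_1 mat2 \<Rightarrow> 'a mat2 \<Rightarrow> 'a mat2" where
  "mat_mult A B = (\<lambda>i j. if i < 2 \<and> j < 2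
      then ps_add (ps_mult (A i 0) (B 0 j)) (ps_mult (A i 1) (B 1 j)) else ps_zero)"

definition mat_scale :: "'a::comm_semiring_1 ps \<Rightarrow> 'a mat2 \<Rightarrow> 'a mat2" where
  "mat_scale r B = (\<lambda>i j. ps_mult r (B i j))"

definition mat_E :: "nat \<Rightarrow> nat \<Rightarrow> 'a::{zero,one} mat2" where
  "mat_E p q = (\<lambda>i j. if i = p \<and> j = q then ps_one else ps_zero)"

definition mat_id :: "'a::{zero,one} mat2" where
  "mat_id = (\<lambda>i j. if i < 2 \<and> j < 2 \<and> i = j then ps_one else ps_zero)"

definition mat_map :: "('a::zero ps \<Rightarrow> 'a ps) \<Rightarrow> 'a mat2 \<Rightarrow> 'a mat2" where
  "mat_map \<phi> A = (\<lambda>i j. if i < 2 \<and> j < 2 then \<phi> (A i j) else ps_zero)"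

definition mat_deriv :: "nat \<Rightarrow> 'a::comm_semiring_1 mat2 \<Rightarrow> 'a mat2" where
  "mat_deriv \<nu> A = (\<lambda>i j. ps_deriv \<nu> (A i j))"

definition ideal_mat :: "'a::zero ps set \<Rightarrow> 'a mat2 set" where
  "ideal_mat I = {A. (\<forall>i j. i < 2 \<and> j < 2 \<longrightarrow> A i j \<in> I)
              \<and> (\<forall>i j. \<not> (i < 2 \<and> j < 2) \<longrightarrow> A i j = ps_zero)}"

text \<open>All finite linear combinations sum r_x B_x with coefficients r_x in I
and B_x in S.  For I = R this is the R-submodule generated by S; for I = m
and S an R-submodule N it is m * N; for I = constants K it is the K-span.\<close>
definition lin_comb :: "'a::comm_semiring_1 ps set \<Rightarrow> 'a mat2 set \<Rightarrow> 'a mat2 set" where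
  "lin_comb I S = {(\<lambda>i j \<alpha>. \<Sum>x\<in>F. mat_scale (r x) (B x) i j \<alpha>) | F r B.
      finite (F :: nat set) \<and> (\<forall>x\<in>F. r x \<in> I \<and> B x \<in> S)}"

definition mod_sum :: "'a::plus mat2 set \<Rightarrow> 'a mat2 set \<Rightarrow> 'a mat2 set" where
  "mod_sum X Y = {mat_add x y | x y. x \<in> X \<and> y \<in> Y}"

definition GL2 :: "nat \<Rightarrow> 'a::comm_semiring_1 mat2 set" where
  "GL2 s = {U \<in> M22 s. \<exists>W\<in>M22 s. mat_mult U W = mat_id \<and> mat_mult W U = mat_id}"

definition Kalg_aut :: "nat \<Rightarrow> ('a::comm_semiring_1 ps \<Rightarrow> 'a ps) \<Rightarrow> bool" where
  "Kalg_aut s \<phi> \<longleftrightarrow> bij_betw \<phi> (PS s) (PS s)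
     \<and> (\<forall>f\<in>PS s. \<forall>g\<in>PS s. \<phi> (ps_add f g) = ps_add (\<phi> f) (\<phi> g)
                            \<and> \<phi> (ps_mult f g) = ps_mult (\<phi> f) (\<phi> g))
     \<and> (\<forall>c. \<phi> (ps_const c) = ps_const c)"

definition G_orbit :: "nat \<Rightarrow> 'a::comm_semiring_1 mat2 \<Rightarrow> 'a mat2 set" where
  "G_orbit s A = {mat_mult (mat_mult U (mat_map \<phi> A)) V | U V \<phi>.
      U \<in> GL2 s \<and> V \<in> GL2 s \<and> Kalg_aut s \<phi>}"

definition G_equiv :: "nat \<Rightarrow> 'a::comm_semiring_1 mat2 \<Rightarrow> 'a mat2 \<Rightarrow> bool" where
  "G_equiv s A B \<longleftrightarrow> B \<in> G_orbit s A"

definition G_k_determined :: "nat \<Rightarrow> nat \<Rightarrow> 'a::comm_ring_1 mat2 \<Rightarrow> bool" where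
  "G_k_determined s k A \<longleftrightarrow>
     (\<forall>B\<in>M22 s. mat_sub B A \<in> ideal_mat (ideal_pow s (mideal s) (k + 1)) \<longrightarrow> G_equiv s A B)"

definition finitely_G_determined :: "nat \<Rightarrow> 'a::comm_ring_1 mat2 \<Rightarrow> bool" where
  "finitely_G_determined s A \<longleftrightarrow> (\<exists>k>0. G_k_determined s k A)"

definition tangent_image :: "nat \<Rightarrow> 'a::comm_semiring_1 mat2 \<Rightarrow> 'a mat2 set" where
  "tangent_image s A =
     mod_sum (mod_sum (lin_comb (PS s) {mat_mult (mat_E p q) A | p q. p < 2 \<and> q < 2})
                      (lin_comb (PS s) {mat_mult A (mat_E h l) | h l. h < 2 \<and> l < 2}))
             (lin_comb (mideal s) (lin_comb (PS s) {mat_deriv \<nu> A | \<nu>. \<nu> < s}))"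

definition finite_codim :: "nat \<Rightarrow> 'a::comm_semiring_1 mat2 set \<Rightarrow> bool" where
  "finite_codim s N \<longleftrightarrow> (\<exists>F::nat set. \<exists>C. finite F \<and> (\<forall>x\<in>F. C x \<in> M22 s) \<and>
      M22 s \<subseteq> mod_sum (lin_comb {ps_const c | c. True} (C ` F)) N)"

end

theory Submission
  imports Defs "HOL-Library.Poly_Mapping" "HOL-Library.Product_Plus" "HOL-Library.Function_Algebras"
    "HOL-Computational_Algebra.Polynomial"
begin

text \<open>Both conditions are compared with the existence of n such that the tangent image contains
  \<open>\<mm>\<^sup>n M\<^sub>2\<^sub>,\<^sub>2\<close>.

  If the tangent image contains \<open>\<mm>\<^sup>c M\<^sub>2\<^sub>,\<^sub>2\<close>, a nearby B is reached from A by successive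
  approximation: the current error is the image under the tangent map of a correction of the group element,
  and the new error is quadratic in the group element and the correction.

  Conversely, let A be finitely determined. The orbit of A contains every B that agrees with A to high order,
  and finite codimension is an invariant of the orbit, so one such B of finite codimension is enough.
  In characteristic p one cannot argue with the tangent space of the orbit; instead take for B a truncation of A
  plus a form \<open>x\<^sub>1\<^sup>n M\<^sub>1 + \<dots> + x\<^sub>s\<^sup>n M\<^sub>s\<close> of higher degree n prime to the characteristic, where the constant
  matrices \<open>M\<^sub>i\<close> are generic points of a twisted cubic. The form alone has finite codimension by explicit linear
  algebra, and as its generators are the top degree parts of the generators for B, the polynomial matrices have
  finite dimension modulo the tangent image of B. A linear dependency among the \<open>x\<^sub>i\<^sup>j E\<close> modulo the tangent image
  is a power of \<open>x\<^sub>i\<close> times a unit of the power series ring, and this gives finite codimension at the origin.\<close>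

section \<open>Filtered groups\<close>

locale filtration =
  fixes F :: "nat \<Rightarrow> 'g::ab_group_add set"
  assumes zero [simp]: "0 \<in> F n"
    and add [simp]: "x \<in> F n \<Longrightarrow> y \<in> F n \<Longrightarrow> x + y \<in> F n"
    and uminus [simp]: "x \<in> F n \<Longrightarrow> - x \<in> F n"
    and Suc_subset: "F (Suc n) \<subseteq> F n"
begin

lemma diff [simp]: "x \<in> F n \<Longrightarrow> y \<in> F n \<Longrightarrow> x - y \<in> F n"
  using add[of x n "- y"] by simp

lemma sum [simp]: "(\<And>i. i \<in> I \<Longrightarrow> f i \<in> F n) \<Longrightarrow> (\<Sum>i\<in>I. f i) \<in> F n"
  by (induction I rule: infinite_finite_induct) auto

lemma antimono: "x \<in> F n \<Longrightarrow> m \<le> n \<Longrightarrow> x \<in> F m"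
  using lift_Suc_antimono_le[of F m n] Suc_subset by blast

lemma diff_of_Suc_diff:
  assumes "\<And>n. f (Suc n) - f n \<in> F n" "m \<le> n"
  shows "f n - f m \<in> F m"
  using assms(2)
proof (induction n rule: dec_induct)
  case (step n)
  have "(f (Suc n) - f n) + (f n - f m) \<in> F m"
    using antimono[OF assms(1) step.hyps(1)] step.IH by (rule add)
  then show ?case by simp
qed simp

end

locale separated_filtration = filtration F for F :: "nat \<Rightarrow> 'g::ab_group_add set" +
  assumes eq_0I: "(\<And>n. x \<in> F n) \<Longrightarrow> x = 0"
begin

lemma eqI: "(\<And>n. x - y \<in> F n) \<Longrightarrow> x = y"
  using eq_0I[of "x - y"] by simp

end

locale complete_filtration = separated_filtration F for F :: "nat \<Rightarrow> 'g::ab_group_add set" +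
  assumes complete: "(\<And>n. f n \<in> F 0) \<Longrightarrow> (\<And>n. f (Suc n) - f n \<in> F n)
    \<Longrightarrow> \<exists>x\<in>F 0. \<forall>n. x - f n \<in> F n"
begin

lemma successive_approximation:
  assumes G: "separated_filtration G"
    and start: "z\<^sub>0 \<in> F 0" "y - \<Phi> z\<^sub>0 \<in> G 0"
    and step: "\<And>n z. z \<in> F 0 \<Longrightarrow> y - \<Phi> z \<in> G n \<Longrightarrow> \<exists>w\<in>F n. y - \<Phi> (z + w) \<in> G (Suc n)"
    and continuous: "\<And>n z z'. z \<in> F 0 \<Longrightarrow> z' \<in> F 0 \<Longrightarrow> z - z' \<in> F (k + n) \<Longrightarrow> \<Phi> z - \<Phi> z' \<in> G n"
  shows "\<exists>z\<in>F 0. \<Phi> z = y"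
proof -
  interpret G: separated_filtration G by (fact G)
  have "\<exists>z. \<forall>n. (z n \<in> F 0 \<and> y - \<Phi> (z n) \<in> G n) \<and> z (Suc n) - z n \<in> F n"
  proof (rule dependent_nat_choice)
    fix z n assume z: "z \<in> F 0 \<and> y - \<Phi> z \<in> G n"
    with step obtain w where "w \<in> F n" "y - \<Phi> (z + w) \<in> G (Suc n)" by blast
    moreover from this z have "z + w \<in> F 0" using antimono[of w n 0] by simp
    ultimately show "\<exists>z'. (z' \<in> F 0 \<and> y - \<Phi> z' \<in> G (Suc n)) \<and> z' - z \<in> F n"
      by (intro exI[of _ "z + w"]) simp
  qed (use start in blast)
  then obtain z where z: "\<And>n. z n \<in> F 0" "\<And>n. z (Suc n) - z n \<in> F n"
    and residual: "\<And>n. y - \<Phi> (z n) \<in> G n"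
    by blast
  obtain x where x: "x \<in> F 0" "\<And>n. x - z n \<in> F n" using complete[OF z] by blast
  have "y - \<Phi> x \<in> G n" for n
  proof -
    have "y - \<Phi> (z (k + n)) \<in> G n" using G.antimono[OF residual] by simp
    moreover have "\<Phi> x - \<Phi> (z (k + n)) \<in> G n" using x z(1) by (intro continuous)
    ultimately have "(y - \<Phi> (z (k + n))) - (\<Phi> x - \<Phi> (z (k + n))) \<in> G n" by (rule G.diff)
    then show ?thesis by simp
  qed
  then have "y = \<Phi> x" by (rule G.eqI)
  with x(1) show ?thesis by blast
qed

lemma bij_betw_unipotent:
  assumes additive: "\<And>x y. x \<in> F 0 \<Longrightarrow> y \<in> F 0 \<Longrightarrow> \<Phi> (x + y) = \<Phi> x + \<Phi> y"
    and unipotent: "\<And>n x. x \<in> F n \<Longrightarrow> \<Phi> x - x \<in> F (Suc n)"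
  shows "bij_betw \<Phi> (F 0) (F 0)"
proof -
  have \<Phi>_in: "\<Phi> x \<in> F n" if "x \<in> F n" for x n
    using add[of "\<Phi> x - x" n x] unipotent[OF that] antimono[of "\<Phi> x - x" "Suc n" n] that by simp
  have \<Phi>_diff: "\<Phi> (x - y) = \<Phi> x - \<Phi> y" if "x \<in> F 0" "y \<in> F 0" for x y
    using additive[of "x - y" y] that by simp
  have "x = y" if xy: "x \<in> F 0" "y \<in> F 0" and eq: "\<Phi> x = \<Phi> y" for x y
  proof (rule eqI)
    fix n show "x - y \<in> F n"
    proof (induction n)
      case (Suc n)
      have "- (\<Phi> (x - y) - (x - y)) \<in> F (Suc n)" using Suc by (intro uminus unipotent)
      then show ?case using xy eq by (simp add: \<Phi>_diff)
    qed (use xy in simp)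
  qed
  moreover have "\<exists>x\<in>F 0. \<Phi> x = y" if y: "y \<in> F 0" for y
  proof (rule successive_approximation[where k = 0 and z\<^sub>0 = 0 and G = F])
    fix n z assume z: "z \<in> F 0" and residual: "y - \<Phi> z \<in> F n"
    have "y - \<Phi> (z + (y - \<Phi> z)) = - (\<Phi> (y - \<Phi> z) - (y - \<Phi> z))"
      using y z \<Phi>_in by (simp add: additive)
    also have "\<dots> \<in> F (Suc n)" using residual by (intro uminus unipotent)
    finally show "\<exists>w\<in>F n. y - \<Phi> (z + w) \<in> F (Suc n)" using residual by blast
  next
    fix n z z' assume "z \<in> F 0" "z' \<in> F 0" "z - z' \<in> F (0 + n)"
    then show "\<Phi> z - \<Phi> z' \<in> F n" using \<Phi>_in[of "z - z'" n] by (simp add: \<Phi>_diff)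
  qed (use y \<Phi>_in[of 0] in \<open>auto intro: separated_filtration_axioms\<close>)
  ultimately show ?thesis using \<Phi>_in unfolding bij_betw_def inj_on_def by blast
qed

lemma complete_filtration_shift: "complete_filtration (\<lambda>n. F (k + n))"
proof
  fix x assume "\<And>n. x \<in> F (k + n)"
  then have "x \<in> F n" for n using antimono[of x "k + n" n] by simp
  then show "x = 0" by (rule eq_0I)
next
  fix f assume f: "\<And>n. f n \<in> F (k + 0)" and Cauchy: "\<And>n. f (Suc n) - f n \<in> F (k + n)"
  have "f (Suc n - k) - f (n - k) \<in> F n" for n
    using Cauchy[of "n - k"] by (cases "k \<le> n") (auto simp: Suc_diff_le)
  moreover have "f (n - k) \<in> F 0" for n using f antimono[of _ k 0] by simp
  ultimately obtain x where x: "\<And>n. x - f (n - k) \<in> F n" using complete[of "\<lambda>n. f (n - k)"] by auto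
  have limit: "x - f n \<in> F (k + n)" for n using x[of "k + n"] by simp
  then have "x - f 0 + f 0 \<in> F (k + 0)" using f by (intro add)
  with limit show "\<exists>x\<in>F (k + 0). \<forall>n. x - f n \<in> F (k + n)" by auto
qed (use Suc_subset in auto)

lemma complete_filtration_Times:
  assumes "complete_filtration G"
  shows "complete_filtration (\<lambda>n. F n \<times> G n)"
proof -
  interpret G: complete_filtration G by (fact assms)
  show ?thesis
  proof
    fix z assume "\<And>n. z \<in> F n \<times> G n"
    then show "z = 0" using eq_0I G.eq_0I by (auto simp: mem_Times_iff prod_eq_iff)
  next
    fix f assume "\<And>n. f n \<in> F 0 \<times> G 0" "\<And>n. f (Suc n) - f n \<in> F n \<times> G n"
    then have f: "\<And>n. fst (f n) \<in> F 0" "\<And>n. snd (f n) \<in> G 0"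
      "\<And>n. fst (f (Suc n)) - fst (f n) \<in> F n" "\<And>n. snd (f (Suc n)) - snd (f n) \<in> G n"
      by (simp_all add: mem_Times_iff)
    obtain x where "x \<in> F 0" "\<And>n. x - fst (f n) \<in> F n" using complete[OF f(1,3)] by blast
    moreover obtain y where "y \<in> G 0" "\<And>n. y - snd (f n) \<in> G n" using G.complete[OF f(2,4)] by blast
    ultimately show "\<exists>z\<in>F 0 \<times> G 0. \<forall>n. z - f n \<in> F n \<times> G n"
      by (intro bexI[of _ "(x, y)"]) (simp_all add: mem_Times_iff)
  qed (use Suc_subset G.Suc_subset in \<open>auto simp: mem_Times_iff\<close>)
qed

lemma complete_filtration_fun: "complete_filtration (\<lambda>n. {d :: 'i \<Rightarrow> 'g. \<forall>i. d i \<in> F n})"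
proof
  fix d :: "'i \<Rightarrow> 'g" assume "\<And>n. d \<in> {d. \<forall>i. d i \<in> F n}"
  then show "d = 0" using eq_0I by (simp add: fun_eq_iff)
next
  fix f :: "nat \<Rightarrow> 'i \<Rightarrow> 'g"
  assume "\<And>n. f n \<in> {d. \<forall>i. d i \<in> F 0}" "\<And>n. f (Suc n) - f n \<in> {d. \<forall>i. d i \<in> F n}"
  then have "\<exists>x\<in>F 0. \<forall>n. x - f n i \<in> F n" for i by (intro complete) simp_all
  then show "\<exists>d\<in>{d. \<forall>i. d i \<in> F 0}. \<forall>n. d - f n \<in> {d. \<forall>i. d i \<in> F n}"
    by (simp add: Bex_def) metis
qed (use Suc_subset in auto)

end

locale ring_filtration = filtration F for F :: "nat \<Rightarrow> 'r::ring_1 set" +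
  assumes one [simp]: "1 \<in> F 0"
    and mult: "x \<in> F m \<Longrightarrow> y \<in> F n \<Longrightarrow> x * y \<in> F (m + n)"
begin

lemma mult_ge: "x \<in> F m \<Longrightarrow> y \<in> F n \<Longrightarrow> k \<le> m + n \<Longrightarrow> x * y \<in> F k"
  by (rule antimono[OF mult])

lemma mult_left [simp]: "x \<in> F 0 \<Longrightarrow> y \<in> F n \<Longrightarrow> x * y \<in> F n"
  using mult[of x 0 y n] by simp

lemma mult_right [simp]: "x \<in> F n \<Longrightarrow> y \<in> F 0 \<Longrightarrow> x * y \<in> F n"
  using mult[of x n y 0] by simp

lemma power [simp]: "x \<in> F 0 \<Longrightarrow> x ^ n \<in> F 0"
  by (induction n) auto

text \<open>Relative to the order k of b, the element p is a perturbation of b of order e, and q is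
  a perturbation of p of order m with linear part \<open>\<delta>\<close>.\<close>

definition first_order_change :: "nat \<Rightarrow> nat \<Rightarrow> nat \<Rightarrow> 'r \<Rightarrow> 'r \<Rightarrow> 'r \<Rightarrow> 'r \<Rightarrow> bool" where
  "first_order_change e m k b p q \<delta> \<longleftrightarrow>
     b \<in> F k \<and> p - b \<in> F (k + e) \<and> q - p \<in> F (k + m) \<and> q - p - \<delta> \<in> F (k + e + m)"

lemma first_order_change_const: "b \<in> F 0 \<Longrightarrow> first_order_change e m 0 b b b 0"
  by (simp add: first_order_change_def)

lemma first_order_change_of_high_order:
  assumes "b \<in> F (k + e + m)" "p \<in> F (k + e + m)" "q \<in> F (k + e + m)" "\<delta> \<in> F (k + e + m)"
  shows "first_order_change e m k b p q \<delta>"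
proof -
  have "x \<in> F k" "x \<in> F (k + e)" "x \<in> F (k + m)" if "x \<in> F (k + e + m)" for x
    using that by (auto elim: antimono)
  with assms show ?thesis by (simp add: first_order_change_def)
qed

lemma first_order_change_add:
  assumes "first_order_change e m k b p q \<delta>" "first_order_change e m k b' p' q' \<delta>'"
  shows "first_order_change e m k (b + b') (p + p') (q + q') (\<delta> + \<delta>')"
proof -
  have "(p - b) + (p' - b') \<in> F (k + e)" "(q - p) + (q' - p') \<in> F (k + m)"
    "(q - p - \<delta>) + (q' - p' - \<delta>') \<in> F (k + e + m)"
    using assms unfolding first_order_change_def by (blast intro: add)+
  with assms show ?thesis by (simp add: first_order_change_def algebra_simps)
qed

lemma first_order_change_sum:
  assumes "\<And>i. i \<in> I \<Longrightarrow> first_order_change e m k (b i) (p i) (q i) (\<delta> i)"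
  shows "first_order_change e m k (\<Sum>i\<in>I. b i) (\<Sum>i\<in>I. p i) (\<Sum>i\<in>I. q i) (\<Sum>i\<in>I. \<delta> i)"
  using assms
  by (induction I rule: infinite_finite_induct)
     (simp_all add: first_order_change_add first_order_change_of_high_order)

lemma first_order_change_antimono:
  assumes "first_order_change e m k b p q \<delta>" "k' \<le> k"
  shows "first_order_change e m k' b p q \<delta>"
  using assms unfolding first_order_change_def by (blast intro: antimono add_le_mono le_refl)

lemma first_order_change_mult:
  assumes "e \<le> m" and "first_order_change e m k b p q \<delta>" and "first_order_change e m k' b' p' q' \<delta>'"
  shows "first_order_change e m (k + k') (b * b') (p * p') (q * q') (\<delta> * b' + b * \<delta>')"
proof -
  have left: "b \<in> F k" "p - b \<in> F (k + e)" "q - p \<in> F (k + m)" "q - p - \<delta> \<in> F (k + e + m)"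
    and right: "b' \<in> F k'" "p' - b' \<in> F (k' + e)" "q' - p' \<in> F (k' + m)" "q' - p' - \<delta>' \<in> F (k' + e + m)"
    using assms(2,3) by (simp_all add: first_order_change_def)
  have \<delta>: "\<delta> \<in> F (k + m)" using diff[OF left(3) antimono[OF left(4)]] by simp
  have \<delta>': "\<delta>' \<in> F (k' + m)" using diff[OF right(3) antimono[OF right(4)]] by simp
  have p: "p \<in> F k" using add[OF left(1) antimono[OF left(2)]] by simp
  have p': "p' \<in> F k'" using add[OF right(1) antimono[OF right(2)]] by simp
  have q': "q' \<in> F k'" using add[OF p' antimono[OF right(3)]] by simp
  have q'_b': "q' - b' \<in> F (k' + e)"
    using add[OF right(2) antimono[OF right(3)]] assms(1) by simp
  have "b * b' \<in> F (k + k')" by (rule mult[OF left(1) right(1)])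
  moreover have "(p - b) * p' + b * (p' - b') \<in> F (k + k' + e)"
    by (intro add; rule mult_ge; (rule left right p')?; simp)
  then have "p * p' - b * b' \<in> F (k + k' + e)" by (simp add: algebra_simps)
  moreover have "(q - p) * q' + p * (q' - p') \<in> F (k + k' + m)"
    by (intro add; rule mult_ge; (rule left right q' p)?; simp)
  then have "q * q' - p * p' \<in> F (k + k' + m)" by (simp add: algebra_simps)
  moreover have "(q - p - \<delta>) * q' + \<delta> * (q' - b') + (p * (q' - p' - \<delta>') + (p - b) * \<delta>') \<in> F (k + k' + e + m)"
    by (intro add; rule mult_ge; (rule left right q' p q'_b' \<delta> \<delta>')?; simp)
  then have "q * q' - p * p' - (\<delta> * b' + b * \<delta>') \<in> F (k + k' + e + m)" by (simp add: algebra_simps)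
  ultimately show ?thesis by (simp add: first_order_change_def)
qed

end

locale complete_ring_filtration = complete_filtration F + ring_filtration F
  for F :: "nat \<Rightarrow> 'r::ring_1 set"

alias lookup = Poly_Mapping.lookup
alias keys = Poly_Mapping.keys
alias single = Poly_Mapping.single

section \<open>Exponent vectors\<close>

definition mdeg :: "(nat \<Rightarrow>\<^sub>0 nat) \<Rightarrow> nat" where
  "mdeg \<alpha> = (\<Sum>i\<in>keys \<alpha>. lookup \<alpha> i)"

lemma mdeg_eq_sum:
  assumes "finite S" "keys \<alpha> \<subseteq> S"
  shows "mdeg \<alpha> = (\<Sum>i\<in>S. lookup \<alpha> i)"
  unfolding mdeg_def using assms
  by (intro sum.mono_neutral_left) (auto simp: in_keys_iff)

lemma mdeg_add [simp]: "mdeg (\<alpha> + \<beta>) = mdeg \<alpha> + mdeg \<beta>"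
  by (simp add: mdeg_eq_sum[of "keys \<alpha> \<union> keys \<beta>"] keys_add lookup_add sum.distrib)

lemma mdeg_zero [simp]: "mdeg 0 = 0"
  by (simp add: mdeg_def)

lemma mdeg_single [simp]: "mdeg (single i n) = n"
  by (simp add: mdeg_def)

lemma lookup_le_mdeg: "lookup \<alpha> i \<le> mdeg \<alpha>"
proof (cases "i \<in> keys \<alpha>")
  case True
  then show ?thesis unfolding mdeg_def by (intro member_le_sum) auto
qed (simp add: in_keys_iff)

lemma mdeg_eq_0_iff [simp]: "mdeg \<alpha> = 0 \<longleftrightarrow> \<alpha> = 0"
  by (auto simp: mdeg_def in_keys_iff intro!: poly_mapping_eqI)

lemma single_add_diff:
  fixes \<alpha> :: "'i \<Rightarrow>\<^sub>0 nat"
  assumes "a \<le> lookup \<alpha> i"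
  shows "single i a + (\<alpha> - single i a) = \<alpha>"
  using assms by (intro poly_mapping_eqI) (auto simp: lookup_add lookup_minus lookup_single when_def)

definition exponents :: "nat \<Rightarrow> (nat \<Rightarrow>\<^sub>0 nat) set" where
  "exponents s = {\<alpha>. keys \<alpha> \<subseteq> {..<s}}"

lemma exponents_iff: "\<alpha> \<in> exponents s \<longleftrightarrow> (\<forall>i\<ge>s. lookup \<alpha> i = 0)"
  unfolding exponents_def by (metis in_keys_iff lessThan_iff mem_Collect_eq not_le subset_eq)

lemma exponents_zero [simp]: "0 \<in> exponents s"
  by (simp add: exponents_def)

lemma exponents_add_iff [simp]: "\<alpha> + \<beta> \<in> exponents s \<longleftrightarrow> \<alpha> \<in> exponents s \<and> \<beta> \<in> exponents s"
  by (auto simp: exponents_iff lookup_add)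

lemma exponents_single [simp]: "i < s \<Longrightarrow> single i a \<in> exponents s"
  by (auto simp: exponents_iff lookup_single when_def)

lemma mdeg_exponents: "\<alpha> \<in> exponents s \<Longrightarrow> mdeg \<alpha> = (\<Sum>i<s. lookup \<alpha> i)"
  by (rule mdeg_eq_sum) (auto simp: exponents_def)

lemma exponents_induct [consumes 1, case_names zero add]:
  assumes "\<alpha> \<in> exponents s" "P 0"
    and step: "\<And>i \<beta>. i < s \<Longrightarrow> \<beta> \<in> exponents s \<Longrightarrow> P \<beta> \<Longrightarrow> P (single i 1 + \<beta>)"
  shows "P \<alpha>"
  using assms(1)
proof (induction "mdeg \<alpha>" arbitrary: \<alpha>)
  case 0
  then show ?case using assms(2) by simp
next
  case (Suc n)
  then have "\<alpha> \<noteq> 0" by auto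
  then obtain i where i: "i \<in> keys \<alpha>" by fastforce
  with Suc.prems have "i < s" by (auto simp: exponents_def)
  let ?\<beta> = "\<alpha> - single i 1"
  have split: "single i 1 + ?\<beta> = \<alpha>"
    using i by (intro single_add_diff) (simp add: in_keys_iff)
  then have "mdeg \<alpha> = 1 + mdeg ?\<beta>" by (metis mdeg_add mdeg_single)
  moreover have "?\<beta> \<in> exponents s" using Suc.prems split by (metis exponents_add_iff)
  ultimately show ?case using Suc.hyps step[OF \<open>i < s\<close>, of ?\<beta>] split by force
qed

lemma finite_exponents_bounded: "finite {\<alpha> \<in> exponents s. mdeg \<alpha> \<le> n}"
proof -
  have "lookup ` {\<alpha> \<in> exponents s. mdeg \<alpha> \<le> n}
    \<subseteq> {f. \<forall>i. (i \<in> {..<s} \<longrightarrow> f i \<in> {..n}) \<and> (i \<notin> {..<s} \<longrightarrow> f i = 0)}"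
    using order_trans[OF lookup_le_mdeg] by (auto simp: exponents_iff)
  then have "finite (lookup ` {\<alpha> \<in> exponents s. mdeg \<alpha> \<le> n})"
    by (rule finite_subset) (rule finite_set_of_finite_funs; simp)
  then show ?thesis
    by (rule finite_imageD) (auto intro!: inj_onI simp: lookup_inject)
qed

lemma ex_exponents: "\<exists>s. \<alpha> \<in> exponents s"
proof -
  have "keys \<alpha> \<subseteq> {..<Suc (Max (keys \<alpha>))}" by (auto simp: less_Suc_eq_le)
  then show ?thesis unfolding exponents_def by blast
qed

definition decomps :: "(nat \<Rightarrow>\<^sub>0 nat) \<Rightarrow> ((nat \<Rightarrow>\<^sub>0 nat) \<times> (nat \<Rightarrow>\<^sub>0 nat)) set" where
  "decomps \<gamma> = {(\<alpha>, \<beta>). \<alpha> + \<beta> = \<gamma>}"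

lemma decomps_iff [simp]: "(\<alpha>, \<beta>) \<in> decomps \<gamma> \<longleftrightarrow> \<alpha> + \<beta> = \<gamma>"
  by (simp add: decomps_def)

lemma finite_decomps [simp]: "finite (decomps \<gamma>)"
proof -
  obtain s where "\<gamma> \<in> exponents s" using ex_exponents by blast
  then have "decomps \<gamma> \<subseteq> {\<alpha> \<in> exponents s. mdeg \<alpha> \<le> mdeg \<gamma>} \<times> {\<alpha> \<in> exponents s. mdeg \<alpha> \<le> mdeg \<gamma>}"
    by (auto simp: decomps_def)
  then show ?thesis by (rule finite_subset) (intro finite_cartesian_product finite_exponents_bounded)
qed

section \<open>The ring of formal power series\<close>

typedef 'a mps = "UNIV :: ((nat \<Rightarrow>\<^sub>0 nat) \<Rightarrow> 'a) set"
  morphisms mps_nth Mps ..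

setup_lifting type_definition_mps

lemma mps_eqI: "(\<And>\<alpha>. mps_nth f \<alpha> = mps_nth g \<alpha>) \<Longrightarrow> f = g"
  by (metis mps_nth_inject ext)

lemma mps_nth_Mps [simp]: "mps_nth (Mps f) = f"
  by (simp add: Mps_inverse)

instantiation mps :: (comm_ring_1) comm_ring_1
begin

lift_definition zero_mps :: "'a mps" is "\<lambda>_. 0" .
lift_definition one_mps :: "'a mps" is "\<lambda>\<alpha>. if \<alpha> = 0 then 1 else 0" .
lift_definition plus_mps :: "'a mps \<Rightarrow> 'a mps \<Rightarrow> 'a mps" is "\<lambda>f g \<alpha>. f \<alpha> + g \<alpha>" .
lift_definition minus_mps :: "'a mps \<Rightarrow> 'a mps \<Rightarrow> 'a mps" is "\<lambda>f g \<alpha>. f \<alpha> - g \<alpha>" .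
lift_definition uminus_mps :: "'a mps \<Rightarrow> 'a mps" is "\<lambda>f \<alpha>. - f \<alpha>" .
lift_definition times_mps :: "'a mps \<Rightarrow> 'a mps \<Rightarrow> 'a mps"
  is "\<lambda>f g \<gamma>. \<Sum>(\<alpha>, \<beta>)\<in>decomps \<gamma>. f \<alpha> * g \<beta>" .

instance
proof
  fix f g h :: "'a mps"
  show "f * g * h = f * (g * h)"
  proof (transfer, rule ext)
    fix f g h :: "(nat \<Rightarrow>\<^sub>0 nat) \<Rightarrow> 'a" and \<gamma>
    have "(\<Sum>(\<alpha>, \<beta>)\<in>decomps \<gamma>. (\<Sum>(\<alpha>, \<beta>)\<in>decomps \<alpha>. f \<alpha> * g \<beta>) * h \<beta>)
      = (\<Sum>p\<in>decomps \<gamma>. \<Sum>q\<in>decomps (fst p). f (fst q) * g (snd q) * h (snd p))"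
      by (simp add: sum_distrib_right case_prod_unfold)
    also have "\<dots> = (\<Sum>(p, q)\<in>Sigma (decomps \<gamma>) (\<lambda>p. decomps (fst p)). f (fst q) * g (snd q) * h (snd p))"
      by (rule sum.Sigma) auto
    also have "\<dots> = (\<Sum>(p, q)\<in>Sigma (decomps \<gamma>) (\<lambda>p. decomps (snd p)). f (fst p) * (g (fst q) * h (snd q)))"
      by (rule sum.reindex_bij_witness[where
            i = "\<lambda>((a, b), (c, d)). ((a + c, d), (a, c))" and j = "\<lambda>((a, b), (c, d)). ((c, d + b), (d, b))"])
         (auto simp: add.assoc mult.assoc)
    also have "\<dots> = (\<Sum>p\<in>decomps \<gamma>. \<Sum>q\<in>decomps (snd p). f (fst p) * (g (fst q) * h (snd q)))"
      by (rule sum.Sigma[symmetric]) auto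
    also have "\<dots> = (\<Sum>(\<alpha>, \<beta>)\<in>decomps \<gamma>. f \<alpha> * (\<Sum>(\<alpha>, \<beta>)\<in>decomps \<beta>. g \<alpha> * h \<beta>))"
      by (simp add: sum_distrib_left case_prod_unfold)
    finally show "(\<Sum>(\<alpha>, \<beta>)\<in>decomps \<gamma>. (\<Sum>(\<alpha>, \<beta>)\<in>decomps \<alpha>. f \<alpha> * g \<beta>) * h \<beta>)
      = (\<Sum>(\<alpha>, \<beta>)\<in>decomps \<gamma>. f \<alpha> * (\<Sum>(\<alpha>, \<beta>)\<in>decomps \<beta>. g \<alpha> * h \<beta>))" .
  qed
  show "f * g = g * f"
    by (transfer, rule ext, rule sum.reindex_bij_witness[where i = prod.swap and j = prod.swap])
       (auto simp: add.commute mult.commute)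
  show "1 * f = f"
  proof (transfer, rule ext)
    fix f :: "(nat \<Rightarrow>\<^sub>0 nat) \<Rightarrow> 'a" and \<gamma>
    have "(\<Sum>(\<alpha>, \<beta>)\<in>decomps \<gamma>. (if \<alpha> = 0 then 1 else 0) * f \<beta>) = (\<Sum>(\<alpha>, \<beta>)\<in>{(0 :: nat \<Rightarrow>\<^sub>0 nat, \<gamma>)}. f \<beta>)"
      by (rule sum.mono_neutral_cong_right) (auto split: if_splits)
    then show "(\<Sum>(\<alpha>, \<beta>)\<in>decomps \<gamma>. (if \<alpha> = 0 then 1 else 0) * f \<beta>) = f \<gamma>" by simp
  qed
  show "(f + g) * h = f * h + g * h"
    by (transfer, rule ext) (simp add: distrib_right sum.distrib case_prod_unfold)
  show "(0 :: 'a mps) \<noteq> 1" by (transfer, auto simp: fun_eq_iff)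
qed (transfer, simp add: add_ac fun_eq_iff)+

end

lemma mps_nth_simps [simp]:
  "mps_nth 0 \<alpha> = 0" "mps_nth (f + g) \<alpha> = mps_nth f \<alpha> + mps_nth g \<alpha>"
  "mps_nth (f - g) \<alpha> = mps_nth f \<alpha> - mps_nth g \<alpha>" "mps_nth (- f) \<alpha> = - mps_nth f \<alpha>"
  by (transfer, simp)+

lemma mps_nth_one: "mps_nth 1 \<alpha> = (if \<alpha> = 0 then 1 else 0)"
  by (transfer, simp)

lemma mps_nth_mult: "mps_nth (f * g) \<gamma> = (\<Sum>(\<alpha>, \<beta>)\<in>decomps \<gamma>. mps_nth f \<alpha> * mps_nth g \<beta>)"
  by (transfer, simp)

lemma mps_nth_mult_neq_0E:
  assumes "mps_nth (f * g) \<gamma> \<noteq> 0"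
  obtains \<alpha> \<beta> where "\<gamma> = \<alpha> + \<beta>" "mps_nth f \<alpha> \<noteq> 0" "mps_nth g \<beta> \<noteq> 0"
proof -
  obtain p where "p \<in> decomps \<gamma>" "(case p of (\<alpha>, \<beta>) \<Rightarrow> mps_nth f \<alpha> * mps_nth g \<beta>) \<noteq> 0"
    using assms unfolding mps_nth_mult by (rule sum.not_neutral_contains_not_neutral)
  then show thesis using that by (cases p) (auto simp: decomps_def dest: mult_not_zero)
qed

lemma mps_nth_mult_0 [simp]: "mps_nth (f * g) 0 = mps_nth f 0 * mps_nth g 0"
proof -
  have "decomps 0 = {(0, 0)}"
    by (auto simp: decomps_def) (metis add_is_0 mdeg_add mdeg_eq_0_iff mdeg_zero)+
  then show ?thesis by (simp add: mps_nth_mult)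
qed

lemma mps_nth_sum [simp]: "mps_nth (\<Sum>i\<in>I. f i) \<alpha> = (\<Sum>i\<in>I. mps_nth (f i) \<alpha>)"
  by (induction I rule: infinite_finite_induct) auto

definition mps_monom :: "(nat \<Rightarrow>\<^sub>0 nat) \<Rightarrow> 'a \<Rightarrow> 'a::comm_ring_1 mps" where
  "mps_monom \<alpha> c = Mps (\<lambda>\<beta>. if \<beta> = \<alpha> then c else 0)"

lemma mps_nth_monom: "mps_nth (mps_monom \<alpha> c) \<beta> = (if \<beta> = \<alpha> then c else 0)"
  by (simp add: mps_monom_def)

lemma mps_monom_0_1 [simp]: "mps_monom 0 1 = 1"
  by (rule mps_eqI) (simp add: mps_nth_monom mps_nth_one)

lemma mps_monom_0_right [simp]: "mps_monom \<alpha> 0 = 0"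
  by (rule mps_eqI) (simp add: mps_nth_monom)

lemma mps_nth_monom_mult: "mps_nth (mps_monom \<alpha> c * f) (\<alpha> + \<beta>) = c * mps_nth f \<beta>"
proof -
  have "mps_nth (mps_monom \<alpha> c * f) (\<alpha> + \<beta>) = (\<Sum>(\<alpha>', \<beta>')\<in>{(\<alpha>, \<beta>)}. c * mps_nth f \<beta>')"
    unfolding mps_nth_mult
    by (rule sum.mono_neutral_cong_right) (auto simp: mps_nth_monom split: if_splits)
  then show ?thesis by simp
qed

lemma mps_nth_monom_mult_eq_0:
  assumes "\<nexists>\<beta>. \<gamma> = \<alpha> + \<beta>"
  shows "mps_nth (mps_monom \<alpha> c * f) \<gamma> = 0"
  using assms by (auto elim!: mps_nth_mult_neq_0E simp: mps_nth_monom split: if_splits intro: ccontr)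

lemma mps_monom_mult: "mps_monom \<alpha> c * mps_monom \<beta> d = mps_monom (\<alpha> + \<beta>) (c * d)"
proof (rule mps_eqI)
  fix \<gamma>
  show "mps_nth (mps_monom \<alpha> c * mps_monom \<beta> d) \<gamma> = mps_nth (mps_monom (\<alpha> + \<beta>) (c * d)) \<gamma>"
  proof (cases "\<exists>\<delta>. \<gamma> = \<alpha> + \<delta>")
    case True
    then show ?thesis by (auto simp: mps_nth_monom_mult) (simp add: mps_nth_monom)
  next
    case False
    then show ?thesis by (subst mps_nth_monom_mult_eq_0) (auto simp: mps_nth_monom)
  qed
qed

abbreviation mps_const :: "'a \<Rightarrow> 'a::comm_ring_1 mps" where
  "mps_const c \<equiv> mps_monom 0 c"

lemma mps_nth_const_mult [simp]: "mps_nth (mps_const c * f) \<alpha> = c * mps_nth f \<alpha>"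
  using mps_nth_monom_mult[of 0 c f \<alpha>] by simp

lemma mps_const_add: "mps_const (a + b) = mps_const a + mps_const b"
  by (rule mps_eqI) (simp add: mps_nth_monom)

lemma mps_const_mult: "mps_const (a * b) = mps_const a * mps_const b"
  by (simp add: mps_monom_mult)

lemma mps_const_power: "mps_const (a ^ n) = mps_const a ^ n"
  by (induction n) (simp_all add: mps_const_mult)

lemma mps_const_diff: "mps_const (a - b) = mps_const a - mps_const b"
  using mps_const_add[of "a - b" b] by simp

lemma mps_const_of_nat: "mps_const (of_nat n) = of_nat n"
  by (induction n) (simp_all add: mps_const_add)

lemma mps_const_numeral: "mps_const (numeral k) = numeral k"
  using mps_const_of_nat[of "numeral k"] by simp

lemmas mps_const_hom = mps_const_add mps_const_diff mps_const_mult mps_const_power mps_const_numeral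

definition mps_X :: "nat \<Rightarrow> 'a::comm_ring_1 mps" where
  "mps_X i = mps_monom (single i 1) 1"

lemma mps_X_power: "mps_X i ^ n = mps_monom (single i n) 1"
  by (induction n) (simp_all add: mps_X_def mps_monom_mult flip: single_add)

lemma mps_X_mult_monom: "mps_X i * mps_monom \<alpha> c = mps_monom (single i 1 + \<alpha>) c"
  by (simp add: mps_X_def mps_monom_mult)

subsection \<open>Partial derivatives\<close>

definition mps_deriv :: "nat \<Rightarrow> 'a::comm_ring_1 mps \<Rightarrow> 'a mps" where
  "mps_deriv \<nu> f = Mps (\<lambda>\<alpha>. of_nat (lookup \<alpha> \<nu> + 1) * mps_nth f (\<alpha> + single \<nu> 1))"

lemma mps_nth_deriv:
  "mps_nth (mps_deriv \<nu> f) \<alpha> = of_nat (lookup \<alpha> \<nu> + 1) * mps_nth f (\<alpha> + single \<nu> 1)"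
  by (simp add: mps_deriv_def)

interpretation mps_deriv: additive "mps_deriv \<nu> :: 'a::comm_ring_1 mps \<Rightarrow> 'a mps" for \<nu>
  by standard (rule mps_eqI, simp add: mps_nth_deriv algebra_simps)

lemmas mps_deriv_simps [simp] = mps_deriv.zero mps_deriv.add mps_deriv.diff mps_deriv.sum

lemma mps_nth_X_mult_deriv: "mps_nth (mps_X \<nu> * mps_deriv \<nu> f) \<alpha> = of_nat (lookup \<alpha> \<nu>) * mps_nth f \<alpha>"
proof (cases "lookup \<alpha> \<nu> = 0")
  case True
  then have "\<nexists>\<beta>. \<alpha> = single \<nu> 1 + \<beta>" by (auto simp: lookup_add)
  with True show ?thesis by (simp add: mps_X_def mps_nth_monom_mult_eq_0)
next
  case False
  define \<beta> where "\<beta> = \<alpha> - single \<nu> 1"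
  have "\<alpha> = single \<nu> 1 + \<beta>" unfolding \<beta>_def using False by (intro single_add_diff[symmetric]) simp
  then show ?thesis
    using mps_nth_monom_mult[of "single \<nu> 1" 1 "mps_deriv \<nu> f" \<beta>]
    by (simp add: mps_X_def mps_nth_deriv lookup_add add.commute)
qed

lemma mps_X_mult_cancel: "mps_X i * f = mps_X i * g \<Longrightarrow> f = g"
  by (rule mps_eqI) (metis mps_X_def mps_nth_monom_mult mult_1)

text \<open>The Euler operator \<open>x\<^sub>\<nu> \<partial>/\<partial>x\<^sub>\<nu>\<close> multiplies the coefficient of \<open>x\<^sup>\<alpha>\<close> by \<open>\<alpha>\<^sub>\<nu>\<close>, so it is a derivation.\<close>

lemma mps_deriv_mult: "mps_deriv \<nu> (f * g) = mps_deriv \<nu> f * g + f * mps_deriv \<nu> g"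
proof (rule mps_X_mult_cancel[of \<nu>], rule mps_eqI)
  fix \<gamma>
  let ?D = "\<lambda>f. mps_X \<nu> * mps_deriv \<nu> f"
  have "mps_nth (?D (f * g)) \<gamma> = (\<Sum>(\<alpha>, \<beta>)\<in>decomps \<gamma>. of_nat (lookup \<gamma> \<nu>) * (mps_nth f \<alpha> * mps_nth g \<beta>))"
    by (simp only: mps_nth_X_mult_deriv) (simp add: mps_nth_mult sum_distrib_left case_prod_unfold)
  also have "\<dots> = (\<Sum>(\<alpha>, \<beta>)\<in>decomps \<gamma>. mps_nth (?D f) \<alpha> * mps_nth g \<beta> + mps_nth f \<alpha> * mps_nth (?D g) \<beta>)"
    by (intro sum.cong) (auto simp: mps_nth_X_mult_deriv lookup_add algebra_simps)
  also have "\<dots> = mps_nth (?D f * g + f * ?D g) \<gamma>"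
    by (simp add: mps_nth_mult sum.distrib case_prod_unfold)
  finally show "mps_nth (?D (f * g)) \<gamma> = mps_nth (mps_X \<nu> * (mps_deriv \<nu> f * g + f * mps_deriv \<nu> g)) \<gamma>"
    by (simp only: distrib_left mult_ac)
qed

lemma mps_deriv_const [simp]: "mps_deriv \<nu> (mps_const c) = 0"
  by (rule mps_eqI) (auto simp: mps_nth_deriv mps_nth_monom dest: arg_cong[of _ _ mdeg])

lemma mps_deriv_one [simp]: "mps_deriv \<nu> 1 = 0"
  using mps_deriv_const[of \<nu> 1] by simp

lemma mps_deriv_X: "mps_deriv \<nu> (mps_X i) = (if i = \<nu> then 1 else 0)"
proof (rule mps_X_mult_cancel[of \<nu>], rule mps_eqI)
  fix \<alpha>
  show "mps_nth (mps_X \<nu> * mps_deriv \<nu> (mps_X i)) \<alpha> = mps_nth (mps_X \<nu> * (if i = \<nu> then 1 else 0)) \<alpha>"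
    by (simp add: mps_nth_X_mult_deriv)
      (auto simp: mps_X_def mps_nth_monom lookup_single when_def dest: arg_cong[of _ _ keys])
qed

lemma mps_deriv_power: "mps_deriv \<nu> (f ^ n) = of_nat n * f ^ (n - 1) * mps_deriv \<nu> f"
proof (induction n)
  case (Suc n)
  then show ?case by (cases n) (auto simp: mps_deriv_mult algebra_simps)
qed simp

section \<open>Powers of the maximal ideal\<close>

text \<open>The n-th power of the maximal ideal of the ring \<open>K[[x\<^sub>0, \<dots>, x\<^sub>s\<^sub>-\<^sub>1]]\<close>, which is itself the zeroth power.\<close>

definition mpow :: "nat \<Rightarrow> nat \<Rightarrow> 'a::comm_ring_1 mps set" where
  "mpow s n = {f. \<forall>\<alpha>. mps_nth f \<alpha> \<noteq> 0 \<longrightarrow> \<alpha> \<in> exponents s \<and> n \<le> mdeg \<alpha>}"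

abbreviation Pser :: "nat \<Rightarrow> 'a::comm_ring_1 mps set" where
  "Pser s \<equiv> mpow s 0"

lemma mpowI:
  "(\<And>\<alpha>. mps_nth f \<alpha> \<noteq> 0 \<Longrightarrow> \<alpha> \<in> exponents s) \<Longrightarrow> (\<And>\<alpha>. mps_nth f \<alpha> \<noteq> 0 \<Longrightarrow> n \<le> mdeg \<alpha>) \<Longrightarrow> f \<in> mpow s n"
  by (simp add: mpow_def)

lemma mpowD:
  assumes "f \<in> mpow s n" "mps_nth f \<alpha> \<noteq> 0"
  shows "\<alpha> \<in> exponents s" "n \<le> mdeg \<alpha>"
  using assms by (auto simp: mpow_def)

interpretation mpow: ring_filtration "mpow s :: nat \<Rightarrow> 'a::comm_ring_1 mps set" for s
proof
  fix f g :: "'a mps" and m n :: nat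
  show "f + g \<in> mpow s n" if "f \<in> mpow s n" "g \<in> mpow s n"
    using that by (intro mpowI) (metis add.right_neutral mpowD mps_nth_simps(2))+
  show "f * g \<in> mpow s (m + n)" if "f \<in> mpow s m" "g \<in> mpow s n"
    using that by (intro mpowI; elim mps_nth_mult_neq_0E) (auto dest: mpowD intro: add_mono)
qed (auto simp: mpow_def mps_nth_one)

interpretation mpow: complete_ring_filtration "mpow s :: nat \<Rightarrow> 'a::comm_ring_1 mps set" for s
proof
  fix f :: "'a mps" assume "\<And>n. f \<in> mpow s n"
  then have "mps_nth f \<alpha> = 0" for \<alpha> using mpowD(2)[of f s "Suc (mdeg \<alpha>)" \<alpha>] by auto
  then show "f = 0" by (intro mps_eqI) simp
next
  fix f :: "nat \<Rightarrow> 'a mps" assume f: "\<And>n. f n \<in> Pser s" and Cauchy: "\<And>n. f (Suc n) - f n \<in> mpow s n"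
  define g where "g = Mps (\<lambda>\<alpha>. mps_nth (f (Suc (mdeg \<alpha>))) \<alpha>)"
  have "g \<in> Pser s" using f by (auto simp: g_def mpow_def)
  moreover have "g - f n \<in> mpow s n" for n
  proof (rule mpowI)
    fix \<alpha> assume nonzero: "mps_nth (g - f n) \<alpha> \<noteq> 0"
    then have "mps_nth (f (Suc (mdeg \<alpha>))) \<alpha> \<noteq> 0 \<or> mps_nth (f n) \<alpha> \<noteq> 0" by (auto simp: g_def)
    then show "\<alpha> \<in> exponents s" using mpowD(1)[OF f] by blast
    show "n \<le> mdeg \<alpha>"
    proof (rule ccontr)
      assume "\<not> n \<le> mdeg \<alpha>"
      then have "f n - f (Suc (mdeg \<alpha>)) \<in> mpow s (Suc (mdeg \<alpha>))"
        by (intro mpow.diff_of_Suc_diff[OF Cauchy]) simp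
      from mpowD(2)[OF this, of \<alpha>] show False using nonzero by (auto simp: g_def)
    qed
  qed
  ultimately show "\<exists>g\<in>Pser s. \<forall>n. g - f n \<in> mpow s n" by blast
qed

lemma Pser_of_mpow: "f \<in> mpow s n \<Longrightarrow> f \<in> Pser s"
  by (erule mpow.antimono) simp

lemma mpow_Suc_0_iff: "f \<in> mpow s (Suc 0) \<longleftrightarrow> f \<in> Pser s \<and> mps_nth f 0 = 0"
proof -
  have "Suc 0 \<le> mdeg \<alpha> \<longleftrightarrow> \<alpha> \<noteq> 0" for \<alpha> using mdeg_eq_0_iff[of \<alpha>] by linarith
  then show ?thesis unfolding mpow_def by auto
qed

lemma mpow_monom [simp]: "\<alpha> \<in> exponents s \<Longrightarrow> n \<le> mdeg \<alpha> \<Longrightarrow> mps_monom \<alpha> c \<in> mpow s n"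
  by (simp add: mpow_def mps_nth_monom)

lemma mpow_X [simp]: "i < s \<Longrightarrow> n \<le> Suc 0 \<Longrightarrow> mps_X i \<in> mpow s n"
  by (simp add: mps_X_def)

lemma mpow_prod [simp]: "(\<And>i. i \<in> I \<Longrightarrow> f i \<in> Pser s) \<Longrightarrow> (\<Prod>i\<in>I. f i) \<in> Pser s"
  by (induction I rule: infinite_finite_induct) auto

lemma mpow_deriv:
  assumes "f \<in> mpow s n"
  shows "mps_deriv \<nu> f \<in> mpow s (n - 1)"
proof (unfold mpow_def, intro CollectI allI impI)
  fix \<alpha> assume "mps_nth (mps_deriv \<nu> f) \<alpha> \<noteq> 0"
  then have "mps_nth f (\<alpha> + single \<nu> 1) \<noteq> 0" by (auto simp: mps_nth_deriv dest: mult_not_zero)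
  from mpowD[OF assms this] show "\<alpha> \<in> exponents s \<and> n - 1 \<le> mdeg \<alpha>" by simp
qed

lemma Pser_deriv [simp]: "f \<in> Pser s \<Longrightarrow> mps_deriv \<nu> f \<in> Pser s"
  using mpow_deriv[of f s 0] by simp

lemma mps_unit:
  fixes f :: "'a::field mps"
  assumes f: "f \<in> Pser s" and "mps_nth f 0 \<noteq> 0"
  obtains g where "g \<in> Pser s" "f * g = 1"
proof -
  define c :: "'a mps" where "c = mps_const (1 / mps_nth f 0)"
  have c: "c \<in> Pser s" by (simp add: c_def)
  have "c * f - 1 \<in> mpow s 1"
    using assms c by (simp add: mpow_Suc_0_iff mps_nth_one c_def mps_nth_monom)
  then have "(c * f - 1) * g \<in> mpow s (Suc n)" if "g \<in> mpow s n" for g n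
    using mpow.mult[OF _ that] by fastforce
  then have "bij_betw (\<lambda>g. c * f * g) (Pser s) (Pser s)"
    by (intro mpow.bij_betw_unipotent) (simp_all add: algebra_simps)
  then obtain g where "g \<in> Pser s" "c * f * g = 1"
    unfolding bij_betw_def by (metis imageE mpow.one)
  then show ?thesis using that[of "c * g"] c by (simp add: mult_ac)
qed

lemma mps_eq_X_power_mult:
  assumes f: "f \<in> mpow s n" and divides: "\<And>\<alpha>. mps_nth f \<alpha> \<noteq> 0 \<Longrightarrow> a \<le> lookup \<alpha> i"
  obtains g where "g \<in> mpow s (n - a)" "f = mps_X i ^ a * g"
proof
  define g where "g = Mps (\<lambda>\<beta>. mps_nth f (single i a + \<beta>))"
  show "g \<in> mpow s (n - a)" using f by (auto simp: g_def mpow_def)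
  show "f = mps_X i ^ a * g"
  proof (rule mps_eqI)
    fix \<alpha>
    show "mps_nth f \<alpha> = mps_nth (mps_X i ^ a * g) \<alpha>"
    proof (cases "a \<le> lookup \<alpha> i")
      case True
      then obtain \<beta> where \<alpha>: "\<alpha> = single i a + \<beta>" by (metis single_add_diff)
      show ?thesis unfolding \<alpha> by (simp add: mps_X_power mps_nth_monom_mult g_def)
    next
      case False
      then have "\<nexists>\<beta>. \<alpha> = single i a + \<beta>" by (auto simp: lookup_add)
      then show ?thesis using False divides by (auto simp: mps_X_power mps_nth_monom_mult_eq_0)
    qed
  qed
qed

lemma mps_eq_sum_X_power_mult:
  assumes "f \<in> mpow s n" "\<And>\<alpha>. mps_nth f \<alpha> \<noteq> 0 \<Longrightarrow> \<exists>i<t. a \<le> lookup \<alpha> i"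
  shows "\<exists>g. (\<forall>i. g i \<in> mpow s (n - a)) \<and> f = (\<Sum>i<t. mps_X i ^ a * g i)"
  using assms
proof (induction t arbitrary: f)
  case 0
  then have "f = 0" by (intro mps_eqI) auto
  then show ?case by (intro exI[of _ "\<lambda>_. 0"]) simp
next
  case (Suc t)
  define h where "h = Mps (\<lambda>\<alpha>. if a \<le> lookup \<alpha> t then mps_nth f \<alpha> else 0)"
  have h: "h \<in> mpow s n" using Suc.prems(1) by (auto simp: h_def mpow_def)
  then obtain g\<^sub>t where g\<^sub>t: "g\<^sub>t \<in> mpow s (n - a)" "h = mps_X t ^ a * g\<^sub>t"
    by (rule mps_eq_X_power_mult) (auto simp: h_def split: if_splits)
  have "\<exists>i<t. a \<le> lookup \<alpha> i" if "mps_nth (f - h) \<alpha> \<noteq> 0" for \<alpha>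
    using Suc.prems(2)[of \<alpha>] that by (auto simp: h_def less_Suc_eq split: if_splits)
  then obtain g where g: "\<And>i. g i \<in> mpow s (n - a)" "f - h = (\<Sum>i<t. mps_X i ^ a * g i)"
    using Suc.IH[of "f - h"] Suc.prems(1) h by auto
  have "f = (f - h) + h" by simp
  also have "\<dots> = (\<Sum>i<Suc t. mps_X i ^ a * (g(t := g\<^sub>t)) i)"
    by (subst g(2)) (simp add: g\<^sub>t(2))
  finally show ?case using g(1) g\<^sub>t(1) by (intro exI[of _ "g(t := g\<^sub>t)"]) simp
qed

lemma mpow_Suc_eq_sum_X_mult:
  assumes f: "f \<in> mpow s (Suc n)"
  shows "\<exists>g. (\<forall>i. g i \<in> mpow s n) \<and> f = (\<Sum>i<s. mps_X i * g i)"
proof -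
  have "\<exists>i<s. 1 \<le> lookup \<alpha> i" if "mps_nth f \<alpha> \<noteq> 0" for \<alpha>
  proof -
    have "0 < (\<Sum>i<s. lookup \<alpha> i)" using mpowD[OF f that] mdeg_exponents[of \<alpha> s] by linarith
    then obtain i where "i < s" "lookup \<alpha> i \<noteq> 0"
      by (metis less_numeral_extra(3) lessThan_iff sum.neutral)
    then show ?thesis by (intro exI[of _ i]) auto
  qed
  from mps_eq_sum_X_power_mult[OF f this] show ?thesis by simp
qed

definition trunc :: "nat \<Rightarrow> nat \<Rightarrow> 'a mps \<Rightarrow> 'a::comm_ring_1 mps" where
  "trunc s n f = (\<Sum>\<alpha> | \<alpha> \<in> exponents s \<and> mdeg \<alpha> \<le> n. mps_monom \<alpha> (mps_nth f \<alpha>))"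

lemma mps_nth_trunc:
  "mps_nth (trunc s n f) \<alpha> = (if \<alpha> \<in> exponents s \<and> mdeg \<alpha> \<le> n then mps_nth f \<alpha> else 0)"
  using finite_exponents_bounded[of s n] by (simp add: trunc_def mps_nth_monom)

lemma Pser_trunc [simp]: "trunc s n f \<in> Pser s"
  by (simp add: mpow_def mps_nth_trunc)

lemma diff_trunc_mpow: "f \<in> Pser s \<Longrightarrow> f - trunc s n f \<in> mpow s (Suc n)"
  by (auto simp: mpow_def mps_nth_trunc)

lemma additive_eqI_monomials:
  fixes \<Theta> \<Theta>' :: "'a::comm_ring_1 mps \<Rightarrow> 'b::comm_ring_1 mps"
  assumes f: "f \<in> Pser s"
    and add: "\<And>g h. g \<in> Pser s \<Longrightarrow> h \<in> Pser s \<Longrightarrow> \<Theta> (g + h) = \<Theta> g + \<Theta> h"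
      "\<And>g h. g \<in> Pser s \<Longrightarrow> h \<in> Pser s \<Longrightarrow> \<Theta>' (g + h) = \<Theta>' g + \<Theta>' h"
    and order: "\<And>n g. g \<in> mpow s (Suc n) \<Longrightarrow> \<Theta> g \<in> mpow s n"
      "\<And>n g. g \<in> mpow s (Suc n) \<Longrightarrow> \<Theta>' g \<in> mpow s n"
    and monom: "\<And>\<alpha> c. \<alpha> \<in> exponents s \<Longrightarrow> \<Theta> (mps_monom \<alpha> c) = \<Theta>' (mps_monom \<alpha> c)"
  shows "\<Theta> f = \<Theta>' f"
proof (rule mpow.eqI)
  fix n
  have "\<Theta> (\<Sum>\<alpha>\<in>I. mps_monom \<alpha> (mps_nth f \<alpha>)) = \<Theta>' (\<Sum>\<alpha>\<in>I. mps_monom \<alpha> (mps_nth f \<alpha>))"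
    if "finite I" "I \<subseteq> exponents s" for I
    using that
  proof (induction I rule: finite_induct)
    case empty
    then show ?case using add[of 0 0] by simp
  next
    case (insert \<alpha> I)
    then have "(\<Sum>\<alpha>\<in>I. mps_monom \<alpha> (mps_nth f \<alpha>)) \<in> Pser s" by (intro mpow.sum) auto
    with insert show ?case by (simp add: add monom)
  qed
  then have trunc: "\<Theta> (trunc s n f) = \<Theta>' (trunc s n f)"
    unfolding trunc_def by (simp add: finite_exponents_bounded)
  define r where "r = f - trunc s n f"
  have r: "r \<in> mpow s (Suc n)" "f = trunc s n f + r"
    using diff_trunc_mpow[OF f] by (simp_all add: r_def)
  have "\<Theta> f - \<Theta>' f = \<Theta> r - \<Theta>' r"
    using trunc Pser_of_mpow[OF r(1)] by (subst (1 2) r(2)) (simp add: add)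
  also have "\<dots> \<in> mpow s n" using order r(1) by (intro mpow.diff)
  finally show "\<Theta> f - \<Theta>' f \<in> mpow s n" .
qed

section \<open>Substitution\<close>

definition power_prod :: "nat \<Rightarrow> (nat \<Rightarrow> 'a) \<Rightarrow> (nat \<Rightarrow>\<^sub>0 nat) \<Rightarrow> 'a::comm_ring_1" where
  "power_prod s g \<alpha> = (\<Prod>i<s. g i ^ lookup \<alpha> i)"

lemma power_prod_0 [simp]: "power_prod s g 0 = 1"
  by (simp add: power_prod_def)

lemma power_prod_add: "power_prod s g (\<alpha> + \<beta>) = power_prod s g \<alpha> * power_prod s g \<beta>"
  by (simp add: power_prod_def lookup_add power_add prod.distrib)

lemma power_prod_single: "i < s \<Longrightarrow> power_prod s g (single i n) = g i ^ n"
  by (simp add: power_prod_def lookup_single when_def if_distrib[of "(^) _"] cong: if_cong)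

lemma power_prod_Pser [simp]: "(\<And>i. i < s \<Longrightarrow> g i \<in> Pser s) \<Longrightarrow> power_prod s g \<alpha> \<in> Pser s"
  unfolding power_prod_def by (intro mpow_prod mpow.power) auto

text \<open>The truncation of the sum to \<open>mdeg \<alpha> \<le> mdeg \<gamma>\<close> is harmless when the \<open>g i\<close> have no constant term.\<close>

definition mps_subst :: "nat \<Rightarrow> (nat \<Rightarrow> 'a mps) \<Rightarrow> 'a mps \<Rightarrow> 'a::comm_ring_1 mps" where
  "mps_subst s g f = Mps (\<lambda>\<gamma>. \<Sum>\<alpha> | \<alpha> \<in> exponents s \<and> mdeg \<alpha> \<le> mdeg \<gamma>.
     mps_nth f \<alpha> * mps_nth (power_prod s g \<alpha>) \<gamma>)"

lemma mps_nth_subst: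
  "mps_nth (mps_subst s g f) \<gamma> = (\<Sum>\<alpha> | \<alpha> \<in> exponents s \<and> mdeg \<alpha> \<le> mdeg \<gamma>.
     mps_nth f \<alpha> * mps_nth (power_prod s g \<alpha>) \<gamma>)"
  by (simp add: mps_subst_def)

interpretation mps_subst: additive "mps_subst s g :: 'a::comm_ring_1 mps \<Rightarrow> 'a mps" for s g
  by standard (rule mps_eqI, simp add: mps_nth_subst distrib_right sum.distrib)

lemma mpow_subst [simp]:
  assumes "f \<in> mpow s n" "\<And>i. i < s \<Longrightarrow> g i \<in> Pser s"
  shows "mps_subst s g f \<in> mpow s n"
proof (unfold mpow_def, intro CollectI allI impI)
  fix \<gamma> assume "mps_nth (mps_subst s g f) \<gamma> \<noteq> 0"
  then obtain \<alpha> where "\<alpha> \<in> exponents s" "mdeg \<alpha> \<le> mdeg \<gamma>" "mps_nth f \<alpha> \<noteq> 0" "mps_nth (power_prod s g \<alpha>) \<gamma> \<noteq> 0"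
    unfolding mps_nth_subst by (auto elim!: sum.not_neutral_contains_not_neutral dest: mult_not_zero)
  moreover have "power_prod s g \<alpha> \<in> Pser s" using assms(2) by simp
  ultimately show "\<gamma> \<in> exponents s \<and> n \<le> mdeg \<gamma>" using mpowD assms(1) order_trans by blast
qed

context
  fixes s :: nat and g :: "nat \<Rightarrow> 'a::comm_ring_1 mps"
  assumes g: "\<And>i. i < s \<Longrightarrow> g i \<in> mpow s 1"
begin

lemma power_prod_mpow: "\<alpha> \<in> exponents s \<Longrightarrow> power_prod s g \<alpha> \<in> mpow s (mdeg \<alpha>)"
proof (induction \<alpha> rule: exponents_induct)
  case (add i \<beta>)
  then show ?case using mpow.mult[OF g add.IH] by (simp add: power_prod_add power_prod_single del: One_nat_def)
qed simp

lemma mps_subst_monom: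
  assumes "\<alpha> \<in> exponents s"
  shows "mps_subst s g (mps_monom \<alpha> c) = mps_const c * power_prod s g \<alpha>"
proof (rule mps_eqI)
  fix \<gamma>
  have "mps_nth (mps_subst s g (mps_monom \<alpha> c)) \<gamma> = (\<Sum>\<beta> | \<beta> \<in> exponents s \<and> mdeg \<beta> \<le> mdeg \<gamma>.
      if \<beta> = \<alpha> then c * mps_nth (power_prod s g \<alpha>) \<gamma> else 0)"
    unfolding mps_nth_subst by (intro sum.cong) (auto simp: mps_nth_monom)
  also have "\<dots> = (if mdeg \<alpha> \<le> mdeg \<gamma> then c * mps_nth (power_prod s g \<alpha>) \<gamma> else 0)"
    using assms finite_exponents_bounded[of s "mdeg \<gamma>"] by simp
  also have "\<dots> = c * mps_nth (power_prod s g \<alpha>) \<gamma>"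
    using mpowD(2)[OF power_prod_mpow[OF assms], of \<gamma>]
    by (cases "mps_nth (power_prod s g \<alpha>) \<gamma> = 0") auto
  finally show "mps_nth (mps_subst s g (mps_monom \<alpha> c)) \<gamma> = mps_nth (mps_const c * power_prod s g \<alpha>) \<gamma>"
    by simp
qed

lemma mps_subst_const: "mps_subst s g (mps_const c) = mps_const c"
  by (simp add: mps_subst_monom)

lemma mps_subst_mult:
  assumes f: "f \<in> Pser s" and h: "h \<in> Pser s"
  shows "mps_subst s g (f * h) = mps_subst s g f * mps_subst s g h"
proof -
  have Pser: "mps_subst s g f \<in> Pser s" if "f \<in> Pser s" for f
    using that g[THEN Pser_of_mpow] by simp
  have mpow: "mps_subst s g f \<in> mpow s n" if "f \<in> mpow s (Suc n)" for f n
    using mpow.antimono[OF that, of n] g[THEN Pser_of_mpow] by simp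
  have monom_mult: "mps_subst s g (mps_monom \<alpha> a * h) = mps_subst s g (mps_monom \<alpha> a) * mps_subst s g h"
    if \<alpha>: "\<alpha> \<in> exponents s" for \<alpha> a
  proof (rule additive_eqI_monomials[OF h, where \<Theta> = "\<lambda>h. mps_subst s g (mps_monom \<alpha> a * h)"
        and \<Theta>' = "\<lambda>h. mps_subst s g (mps_monom \<alpha> a) * mps_subst s g h"])
    fix \<beta> b assume "\<beta> \<in> exponents s"
    with \<alpha> have "mps_subst s g (mps_monom \<alpha> a * mps_monom \<beta> b)
        = mps_const (a * b) * (power_prod s g \<alpha> * power_prod s g \<beta>)"
      by (simp add: mps_monom_mult mps_subst_monom power_prod_add)
    then show "mps_subst s g (mps_monom \<alpha> a * mps_monom \<beta> b)
        = mps_subst s g (mps_monom \<alpha> a) * mps_subst s g (mps_monom \<beta> b)"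
      using \<alpha> \<open>\<beta> \<in> exponents s\<close> by (simp only: mps_subst_monom mps_const_mult mult_ac)
  qed (use \<alpha> in \<open>simp_all add: mps_subst.add distrib_left mpow Pser\<close>)
  show ?thesis
    by (rule additive_eqI_monomials[OF f, where \<Theta> = "\<lambda>f. mps_subst s g (f * h)"
          and \<Theta>' = "\<lambda>f. mps_subst s g f * mps_subst s g h"])
       (use h in \<open>simp_all add: mps_subst.add distrib_right monom_mult mpow Pser\<close>)
qed

end

subsection \<open>Perturbations of the identity substitution\<close>

context
  fixes s e m :: nat and d d' :: "nat \<Rightarrow> 'a::comm_ring_1 mps"
  assumes d: "\<And>i. i < s \<Longrightarrow> d i \<in> mpow s (Suc e)" and d': "\<And>i. i < s \<Longrightarrow> d' i \<in> mpow s (Suc m)"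
    and em: "e \<le> m"
begin

lemma first_order_change_power_prod:
  assumes "\<alpha> \<in> exponents s"
  shows "mpow.first_order_change s e m (mdeg \<alpha>) (mps_monom \<alpha> 1)
    (power_prod s (\<lambda>i. mps_X i + d i) \<alpha>) (power_prod s (\<lambda>i. mps_X i + d i + d' i) \<alpha>)
    (\<Sum>\<nu><s. d' \<nu> * mps_deriv \<nu> (mps_monom \<alpha> 1))"
  using assms
proof (induction \<alpha> rule: exponents_induct)
  case zero
  then show ?case using mpow.first_order_change_const[of 1] by simp
next
  case (add i \<beta>)
  let ?\<delta> = "\<lambda>b. \<Sum>\<nu><s. d' \<nu> * mps_deriv \<nu> b"
  have "mpow.first_order_change s e m 1 (mps_X i) (mps_X i + d i) (mps_X i + d i + d' i) (d' i)"
    using d[OF add.hyps(1)] d'[OF add.hyps(1)] add.hyps(1) by (simp add: mpow.first_order_change_def)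
  from mpow.first_order_change_mult[OF em this add.IH]
  have "mpow.first_order_change s e m (1 + mdeg \<beta>) (mps_X i * mps_monom \<beta> 1)
    (power_prod s (\<lambda>i. mps_X i + d i) (single i 1 + \<beta>)) (power_prod s (\<lambda>i. mps_X i + d i + d' i) (single i 1 + \<beta>))
    (d' i * mps_monom \<beta> 1 + mps_X i * ?\<delta> (mps_monom \<beta> 1))"
    using add.hyps(1) by (simp add: power_prod_add power_prod_single)
  moreover have linear_X: "?\<delta> (mps_X i) = d' i"
    using add.hyps(1) by (simp add: mps_deriv_X if_distrib cong: if_cong)
  have "?\<delta> (mps_X i * mps_monom \<beta> 1) = ?\<delta> (mps_X i) * mps_monom \<beta> 1 + mps_X i * ?\<delta> (mps_monom \<beta> 1)"
    by (simp add: mps_deriv_mult sum.distrib sum_distrib_left sum_distrib_right distrib_left mult_ac)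
  then have "?\<delta> (mps_X i * mps_monom \<beta> 1) = d' i * mps_monom \<beta> 1 + mps_X i * ?\<delta> (mps_monom \<beta> 1)"
    unfolding linear_X .
  ultimately show ?case by (simp add: mps_X_mult_monom)
qed

lemma X_add_mpow:
  assumes "i < s"
  shows "mps_X i + d i \<in> mpow s (Suc 0)" "mps_X i + d i + d' i \<in> mpow s (Suc 0)"
  using mpow.antimono[OF d, of i "Suc 0"] mpow.antimono[OF d', of i "Suc 0"] assms by simp_all

lemma first_order_change_subst_monom:
  assumes \<alpha>: "\<alpha> \<in> exponents s"
  shows "mpow.first_order_change s e m (mdeg \<alpha>) (mps_monom \<alpha> c) (mps_subst s (\<lambda>i. mps_X i + d i) (mps_monom \<alpha> c))
    (mps_subst s (\<lambda>i. mps_X i + d i + d' i) (mps_monom \<alpha> c)) (\<Sum>\<nu><s. d' \<nu> * mps_deriv \<nu> (mps_monom \<alpha> c))"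
proof -
  let ?g = "\<lambda>i. mps_X i + d i" and ?g' = "\<lambda>i. mps_X i + d i + d' i"
  have "mpow.first_order_change s e m (0 + mdeg \<alpha>) (mps_const c * mps_monom \<alpha> 1)
    (mps_const c * power_prod s ?g \<alpha>) (mps_const c * power_prod s ?g' \<alpha>)
    (0 * mps_monom \<alpha> 1 + mps_const c * (\<Sum>\<nu><s. d' \<nu> * mps_deriv \<nu> (mps_monom \<alpha> 1)))"
    using em by (intro mpow.first_order_change_mult mpow.first_order_change_const
        first_order_change_power_prod \<alpha>) simp_all
  moreover have "mps_monom \<alpha> c = mps_const c * mps_monom \<alpha> 1" by (simp add: mps_monom_mult)
  moreover have "mps_deriv \<nu> (mps_const c * mps_monom \<alpha> 1) = mps_const c * mps_deriv \<nu> (mps_monom \<alpha> 1)" for \<nu>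
    using mps_deriv_mult[of \<nu> "mps_const c" "mps_monom \<alpha> 1"] by simp
  moreover have "mps_subst s ?g (mps_monom \<alpha> c) = mps_const c * power_prod s ?g \<alpha>"
    "mps_subst s ?g' (mps_monom \<alpha> c) = mps_const c * power_prod s ?g' \<alpha>"
    using X_add_mpow \<alpha> by (simp_all add: mps_subst_monom)
  ultimately show ?thesis by (simp add: sum_distrib_left mult.left_commute)
qed

lemma first_order_change_subst:
  assumes f: "f \<in> mpow s k"
  shows "mpow.first_order_change s e m k f (mps_subst s (\<lambda>i. mps_X i + d i) f)
    (mps_subst s (\<lambda>i. mps_X i + d i + d' i) f) (\<Sum>\<nu><s. d' \<nu> * mps_deriv \<nu> f)"
    (is "?change f")
proof -
  have monom: "?change (mps_monom \<alpha> (mps_nth f \<alpha>))" if "\<alpha> \<in> exponents s" for \<alpha>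
  proof (cases "mps_nth f \<alpha> = 0")
    case True
    then show ?thesis by (simp add: mps_subst.zero mpow.first_order_change_of_high_order)
  next
    case False
    then have "k \<le> mdeg \<alpha>" by (rule mpowD(2)[OF f])
    with first_order_change_subst_monom[OF that] show ?thesis by (rule mpow.first_order_change_antimono)
  qed
  define r where "r = f - trunc s (k + e + m) f"
  have "?change (trunc s (k + e + m) f)"
    unfolding trunc_def mps_subst.sum mps_deriv.sum sum_distrib_left
    by (subst sum.swap) (intro mpow.first_order_change_sum; simp add: monom)
  moreover have r: "r \<in> mpow s (Suc (k + e + m))"
    using diff_trunc_mpow[OF Pser_of_mpow[OF f]] by (simp add: r_def)
  then have "?change r"
    using mpow.antimono[OF r, of "k + e + m"] X_add_mpow[THEN Pser_of_mpow] mpow_deriv[OF r] d'[THEN Pser_of_mpow]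
    by (intro mpow.first_order_change_of_high_order) (auto intro!: mpow.sum mpow.mult_left)
  ultimately have "?change (trunc s (k + e + m) f + r)"
    using mpow.first_order_change_add by (simp add: mps_subst.add distrib_left sum.distrib)
  then show ?thesis by (simp add: r_def)
qed

end

lemma mps_subst_X: "f \<in> Pser s \<Longrightarrow> mps_subst s mps_X f = f"
proof (rule mpow.eqI)
  fix n assume "f \<in> Pser s"
  then show "mps_subst s mps_X f - f \<in> mpow s n"
    using first_order_change_subst[of s "\<lambda>_. 0" n "\<lambda>_. 0" n f 0] by (simp add: mpow.first_order_change_def)
qed

lemma bij_betw_subst:
  assumes d: "\<And>i. i < s \<Longrightarrow> d i \<in> mpow s 2"
  shows "bij_betw (mps_subst s (\<lambda>i. mps_X i + d i)) (Pser s) (Pser s)"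
proof (rule mpow.bij_betw_unipotent)
  fix n and f :: "'a mps" assume "f \<in> mpow s n"
  then show "mps_subst s (\<lambda>i. mps_X i + d i) f - f \<in> mpow s (Suc n)"
    using first_order_change_subst[of s d 1 "\<lambda>_. 0" 1 f n] d
    by (simp add: mpow.first_order_change_def numeral_2_eq_2)
qed (rule mps_subst.add)

section \<open>Two by two matrices\<close>

datatype 'r m2 = M2 (e00: 'r) (e01: 'r) (e10: 'r) (e11: 'r)

instantiation m2 :: (comm_ring_1) ring_1
begin

definition "0 = M2 0 0 0 0"
definition "1 = M2 1 0 0 1"
definition "A + B = M2 (e00 A + e00 B) (e01 A + e01 B) (e10 A + e10 B) (e11 A + e11 B)"
definition "A - B = M2 (e00 A - e00 B) (e01 A - e01 B) (e10 A - e10 B) (e11 A - e11 B)"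
definition "- A = M2 (- e00 A) (- e01 A) (- e10 A) (- e11 A)"
definition "A * B = M2 (e00 A * e00 B + e01 A * e10 B) (e00 A * e01 B + e01 A * e11 B)
  (e10 A * e00 B + e11 A * e10 B) (e10 A * e01 B + e11 A * e11 B)"

instance
  by standard (auto simp: zero_m2_def one_m2_def plus_m2_def minus_m2_def uminus_m2_def times_m2_def algebra_simps)

end

lemma m2_sel_simps [simp]:
  "e00 0 = 0" "e01 0 = 0" "e10 0 = 0" "e11 0 = 0"
  "e00 1 = 1" "e01 1 = 0" "e10 1 = 0" "e11 1 = 1"
  "e00 (A + B) = e00 A + e00 B" "e01 (A + B) = e01 A + e01 B"
  "e10 (A + B) = e10 A + e10 B" "e11 (A + B) = e11 A + e11 B"
  "e00 (A - B) = e00 A - e00 B" "e01 (A - B) = e01 A - e01 B"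
  "e10 (A - B) = e10 A - e10 B" "e11 (A - B) = e11 A - e11 B"
  "e00 (- A) = - e00 A" "e01 (- A) = - e01 A" "e10 (- A) = - e10 A" "e11 (- A) = - e11 A"
  "e00 (A * B) = e00 A * e00 B + e01 A * e10 B" "e01 (A * B) = e00 A * e01 B + e01 A * e11 B"
  "e10 (A * B) = e10 A * e00 B + e11 A * e10 B" "e11 (A * B) = e10 A * e01 B + e11 A * e11 B"
  by (simp_all add: zero_m2_def one_m2_def plus_m2_def minus_m2_def uminus_m2_def times_m2_def)

lemma m2_sel_sum [simp]:
  "e00 (\<Sum>i\<in>I. f i) = (\<Sum>i\<in>I. e00 (f i))" "e01 (\<Sum>i\<in>I. f i) = (\<Sum>i\<in>I. e01 (f i))"
  "e10 (\<Sum>i\<in>I. f i) = (\<Sum>i\<in>I. e10 (f i))" "e11 (\<Sum>i\<in>I. f i) = (\<Sum>i\<in>I. e11 (f i))"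
  by (induction I rule: infinite_finite_induct) auto

lemma m2_sel_map [simp]:
  "e00 (map_m2 f A) = f (e00 A)" "e01 (map_m2 f A) = f (e01 A)"
  "e10 (map_m2 f A) = f (e10 A)" "e11 (map_m2 f A) = f (e11 A)"
  by (cases A; simp)+

lemma m2_eq_iff: "A = B \<longleftrightarrow> e00 A = e00 B \<and> e01 A = e01 B \<and> e10 A = e10 B \<and> e11 A = e11 B"
  by (cases A; cases B) simp

definition smul :: "'r::comm_ring_1 \<Rightarrow> 'r m2 \<Rightarrow> 'r m2" where
  "smul r A = M2 (r * e00 A) (r * e01 A) (r * e10 A) (r * e11 A)"

lemma m2_sel_smul [simp]:
  "e00 (smul r A) = r * e00 A" "e01 (smul r A) = r * e01 A"
  "e10 (smul r A) = r * e10 A" "e11 (smul r A) = r * e11 A"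
  by (simp_all add: smul_def)

interpretation smul: module "smul :: 'r::comm_ring_1 \<Rightarrow> 'r m2 \<Rightarrow> 'r m2"
  by standard (simp_all add: m2_eq_iff algebra_simps)

lemma smul_mult_left [simp]: "smul r A * B = smul r (A * B)"
  by (simp add: m2_eq_iff algebra_simps)

lemma smul_mult_right [simp]: "A * smul r B = smul r (A * B)"
  by (simp add: m2_eq_iff algebra_simps)

definition det :: "'r::comm_ring_1 m2 \<Rightarrow> 'r" where
  "det A = e00 A * e11 A - e01 A * e10 A"

definition trace :: "'r::comm_ring_1 m2 \<Rightarrow> 'r" where
  "trace A = e00 A + e11 A"

definition adjugate :: "'r::comm_ring_1 m2 \<Rightarrow> 'r m2" where
  "adjugate A = M2 (e11 A) (- e01 A) (- e10 A) (e00 A)"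

lemma mult_adjugate: "A * adjugate A = smul (det A) 1"
  by (simp add: m2_eq_iff adjugate_def det_def algebra_simps)

lemma adjugate_mult: "adjugate A * A = smul (det A) 1"
  by (simp add: m2_eq_iff adjugate_def det_def algebra_simps)

definition unit_mats :: "'r::comm_ring_1 m2 set" where
  "unit_mats = {M2 1 0 0 0, M2 0 1 0 0, M2 0 0 1 0, M2 0 0 0 1}"

lemma finite_unit_mats: "finite unit_mats"
  by (simp add: unit_mats_def)

lemma m2_eq_sum_units:
  "A = smul (e00 A) (M2 1 0 0 0) + smul (e01 A) (M2 0 1 0 0) + smul (e10 A) (M2 0 0 1 0) + smul (e11 A) (M2 0 0 0 1)"
  by (simp add: m2_eq_iff)

subsection \<open>Matrices over a filtered ring\<close>

definition mats :: "'r set \<Rightarrow> 'r m2 set" where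
  "mats S = {A. e00 A \<in> S \<and> e01 A \<in> S \<and> e10 A \<in> S \<and> e11 A \<in> S}"

lemma mats_map: "A \<in> mats S \<Longrightarrow> (\<And>x. x \<in> S \<Longrightarrow> f x \<in> T) \<Longrightarrow> map_m2 f A \<in> mats T"
  by (simp add: mats_def)

lemma map_m2_ident: "A \<in> mats S \<Longrightarrow> (\<And>x. x \<in> S \<Longrightarrow> f x = x) \<Longrightarrow> map_m2 f A = A"
  by (simp add: mats_def m2_eq_iff)

lemma complete_ring_filtration_mats:
  fixes F :: "nat \<Rightarrow> 'r::comm_ring_1 set"
  assumes "complete_ring_filtration F"
  shows "complete_ring_filtration (\<lambda>n. mats (F n))"
proof -
  interpret complete_ring_filtration F by (fact assms)
  show ?thesis
  proof
    fix A B and m n assume "A \<in> mats (F m)" "B \<in> mats (F n)"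
    then show "A * B \<in> mats (F (m + n))" by (auto simp: mats_def intro!: add mult)
  next
    fix A assume "\<And>n. A \<in> mats (F n)"
    then show "A = 0" using eq_0I by (simp add: mats_def m2_eq_iff)
  next
    fix f assume f: "\<And>n. f n \<in> mats (F 0)" "\<And>n. f (Suc n) - f n \<in> mats (F n)"
    have "\<exists>x\<in>F 0. \<forall>n. x - e (f n) \<in> F n" if "e \<in> {e00, e01, e10, e11}" for e
      using f that by (intro complete) (auto simp: mats_def)
    then obtain a b c d where "a \<in> F 0" "\<And>n. a - e00 (f n) \<in> F n" "b \<in> F 0" "\<And>n. b - e01 (f n) \<in> F n"
      "c \<in> F 0" "\<And>n. c - e10 (f n) \<in> F n" "d \<in> F 0" "\<And>n. d - e11 (f n) \<in> F n"
      by (metis insertCI)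
    then show "\<exists>A\<in>mats (F 0). \<forall>n. A - f n \<in> mats (F n)"
      by (intro bexI[of _ "M2 a b c d"]) (simp_all add: mats_def)
  qed (use Suc_subset in \<open>auto simp: mats_def\<close>)
qed

interpretation mats: complete_ring_filtration "\<lambda>n. mats (mpow s n :: 'a::comm_ring_1 mps set)" for s
  by (rule complete_ring_filtration_mats) (rule mpow.complete_ring_filtration_axioms)

lemma smul_mats_mpow: "r \<in> mpow s m \<Longrightarrow> A \<in> mats (mpow s n) \<Longrightarrow> smul r A \<in> mats (mpow s (m + n))"
  by (simp add: mats_def mpow.mult)

lemma smul_mats_Pser [simp]:
  "r \<in> Pser s \<Longrightarrow> A \<in> mats (mpow s n) \<Longrightarrow> smul r A \<in> mats (mpow s n)"
  "r \<in> mpow s n \<Longrightarrow> A \<in> mats (Pser s) \<Longrightarrow> smul r A \<in> mats (mpow s n)"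
  by (simp_all add: mats_def)

lemma unit_mats_Pser: "unit_mats \<subseteq> mats (Pser s)"
  by (simp add: unit_mats_def mats_def)

lemma det_Pser [simp]: "A \<in> mats (Pser s) \<Longrightarrow> det A \<in> Pser s"
  by (simp add: det_def mats_def)

lemma trace_Pser [simp]: "A \<in> mats (Pser s) \<Longrightarrow> trace A \<in> Pser s"
  by (simp add: trace_def mats_def)

lemma adjugate_Pser [simp]: "A \<in> mats (Pser s) \<Longrightarrow> adjugate A \<in> mats (Pser s)"
  by (simp add: adjugate_def mats_def)

lemma deriv_mats_Pser [simp]: "A \<in> mats (Pser s) \<Longrightarrow> map_m2 (mps_deriv \<nu>) A \<in> mats (Pser s)"
  by (erule mats_map) simp

lemma mats_mpow_Suc_eq_sum_X_smul:
  fixes A :: "'a::comm_ring_1 mps m2"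
  assumes A: "A \<in> mats (mpow s (Suc n))"
  obtains B where "\<And>i. B i \<in> mats (mpow s n)" "A = (\<Sum>i<s. smul (mps_X i) (B i))"
proof -
  have "\<exists>g. \<forall>f\<in>mpow s (Suc n). (\<forall>i. g f i \<in> mpow s n) \<and> (f :: 'a mps) = (\<Sum>i<s. mps_X i * g f i)"
    by (intro bchoice ballI mpow_Suc_eq_sum_X_mult)
  then obtain g where g: "\<forall>f\<in>mpow s (Suc n). (\<forall>i. g f i \<in> mpow s n) \<and> (f :: 'a mps) = (\<Sum>i<s. mps_X i * g f i)" ..
  show thesis
  proof (rule that)
    show "map_m2 (\<lambda>f. g f i) A \<in> mats (mpow s n)" for i using A by (rule mats_map) (use g in blast)
    have "(\<Sum>i<s. mps_X i * g f i) = f" if "f \<in> mpow s (Suc n)" for f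
      by (rule bspec[OF g that, THEN conjunct2, symmetric])
    then show "A = (\<Sum>i<s. smul (mps_X i) (map_m2 (\<lambda>f. g f i) A))"
      using A by (simp add: m2_eq_iff mats_def)
  qed
qed

lemma mats_inverse:
  fixes A :: "'a::field mps m2"
  assumes A: "A \<in> mats (Pser s)" and "mps_nth (det A) 0 \<noteq> 0"
  obtains B where "B \<in> mats (Pser s)" "A * B = 1" "B * A = 1"
proof -
  obtain g where g: "g \<in> Pser s" "det A * g = 1" using mps_unit assms det_Pser by blast
  show thesis
  proof (rule that)
    show "smul g (adjugate A) \<in> mats (Pser s)" using g A by simp
    show "A * smul g (adjugate A) = 1" "smul g (adjugate A) * A = 1"
      using g(2) by (simp_all add: mult_adjugate adjugate_mult mult.commute)
  qed
qed

section \<open>Submodules of finite colength\<close>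

locale submodule =
  fixes s :: nat and N :: "'a::comm_ring_1 mps m2 set"
  assumes zero: "0 \<in> N"
    and add: "A \<in> N \<Longrightarrow> B \<in> N \<Longrightarrow> A + B \<in> N"
    and smul: "r \<in> Pser s \<Longrightarrow> A \<in> N \<Longrightarrow> smul r A \<in> N"
begin

lemma uminus: "A \<in> N \<Longrightarrow> - A \<in> N"
  using smul[of "- 1" A] by simp

lemma diff: "A \<in> N \<Longrightarrow> B \<in> N \<Longrightarrow> A - B \<in> N"
  using add[of A "- B"] uminus by simp

lemma sum: "(\<And>i. i \<in> I \<Longrightarrow> f i \<in> N) \<Longrightarrow> (\<Sum>i\<in>I. f i) \<in> N"
  by (induction I rule: infinite_finite_induct) (auto simp: zero add)

lemma smul_mats_mem:
  assumes r: "r \<in> Pser s" "\<And>E. E \<in> unit_mats \<Longrightarrow> smul r E \<in> N" and A: "A \<in> mats (Pser s)"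
  shows "smul r A \<in> N"
proof -
  have "smul a (smul r E) \<in> N" if "a \<in> Pser s" "E \<in> unit_mats" for a E
    using that r smul by blast
  then have "smul r (smul a E) \<in> N" if "a \<in> Pser s" "E \<in> unit_mats" for a E
    using that by (simp add: mult.commute)
  moreover have "e00 A \<in> Pser s" "e01 A \<in> Pser s" "e10 A \<in> Pser s" "e11 A \<in> Pser s"
    using A by (simp_all add: mats_def)
  ultimately show ?thesis
    by (subst m2_eq_sum_units) (simp only: smul.scale_right_distrib; intro add; simp add: unit_mats_def)
qed

end

definition finite_colength :: "nat \<Rightarrow> 'a::comm_ring_1 mps m2 set \<Rightarrow> bool" where
  "finite_colength s N \<longleftrightarrow> (\<exists>n. mats (mpow s n) \<subseteq> N)"

lemma (in submodule) finite_colength_of_X_powers: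
  assumes "\<And>i E. i < s \<Longrightarrow> E \<in> unit_mats \<Longrightarrow> \<exists>a. smul (mps_X i ^ a) E \<in> N"
  shows "finite_colength s N"
proof -
  obtain a where a: "\<And>i E. i < s \<Longrightarrow> E \<in> unit_mats \<Longrightarrow> smul (mps_X i ^ a i E) E \<in> N"
    using assms by metis
  define b where "b = (\<Sum>(i, E)\<in>{..<s} \<times> unit_mats. a i E)"
  have power_b: "smul (mps_X i ^ b) E \<in> N" if "i < s" "E \<in> unit_mats" for i E
  proof -
    have "(\<lambda>(i, E). a i E) (i, E) \<le> b"
      unfolding b_def using that finite_unit_mats by (intro member_le_sum) auto
    then have "mps_X i ^ b = mps_X i ^ (b - a i E) * (mps_X i ^ a i E :: 'a mps)"
      by (simp flip: power_add)
    moreover have "smul (mps_X i ^ (b - a i E)) (smul (mps_X i ^ a i E) E) \<in> N"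
      using that by (intro smul a) auto
    ultimately show ?thesis by simp
  qed
  have "smul f E \<in> N" if f: "f \<in> mpow s (Suc (s * b))" and E: "E \<in> unit_mats" for f E
  proof -
    have "\<exists>i<s. b \<le> lookup \<alpha> i" if nonzero: "mps_nth f \<alpha> \<noteq> 0" for \<alpha>
    proof (rule ccontr)
      assume "\<not> (\<exists>i<s. b \<le> lookup \<alpha> i)"
      then have "(\<Sum>i<s. lookup \<alpha> i) \<le> (\<Sum>i<s. b)" by (intro sum_mono) (auto simp: not_le)
      then show False using mpowD[OF f nonzero] mdeg_exponents[of \<alpha> s] by simp
    qed
    then obtain g where g: "\<And>i. g i \<in> mpow s (Suc (s * b) - b)" "f = (\<Sum>i<s. mps_X i ^ b * g i)"
      using mps_eq_sum_X_power_mult[OF f] by metis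
    have "(\<Sum>i<s. smul (g i) (smul (mps_X i ^ b) E)) \<in> N"
      using E by (intro sum smul[OF Pser_of_mpow[OF g(1)]] power_b) auto
    then show ?thesis by (simp add: g(2) smul.scale_sum_left mult.commute)
  qed
  then have "A \<in> N" if "A \<in> mats (mpow s (Suc (s * b)))" for A
    using that by (subst m2_eq_sum_units) (intro add; simp add: mats_def unit_mats_def)
  then show ?thesis unfolding finite_colength_def by blast
qed

subsection \<open>Spans over the base field\<close>

interpretation mat_space: vector_space "\<lambda>c. smul (mps_const c) :: 'a::field mps m2 \<Rightarrow> 'a mps m2"
  by standard (simp_all add: algebra_simps mps_const_add mps_const_mult)

lemma (in vector_space) ex_nontrivial_relation:
  assumes G: "finite G" and J: "finite J" "card G < card J" and r: "r ` J \<subseteq> span G"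
  shows "\<exists>b. (\<exists>j\<in>J. b j \<noteq> 0) \<and> (\<Sum>j\<in>J. b j *s r j) = 0"
proof (cases "inj_on r J")
  case True
  then have "dependent (r ` J)"
    using independent_span_bound[OF G _ r] J by (auto simp: card_image)
  then obtain u where "\<exists>v\<in>r ` J. u v \<noteq> 0" "(\<Sum>v\<in>r ` J. u v *s v) = 0"
    using J by (auto simp: dependent_finite)
  then show ?thesis using True by (intro exI[of _ "u \<circ> r"]) (simp add: sum.reindex)
next
  case False
  then obtain i k where ik: "i \<in> J" "k \<in> J" "i \<noteq> k" "r i = r k" by (auto simp: inj_on_def)
  let ?b = "\<lambda>j. if j = i then 1 else if j = k then - 1 else 0"
  have "(\<Sum>j\<in>J. ?b j *s r j) = (\<Sum>j\<in>{i, k}. ?b j *s r j)"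
    using J ik by (intro sum.mono_neutral_right) auto
  also have "\<dots> = 0" using ik by simp
  finally show ?thesis using ik by (intro exI[of _ ?b]) auto
qed

lemma (in vector_space) ex_combination_in_subspace:
  assumes N: "subspace N" and G: "finite G" and span: "\<And>j. \<exists>r\<in>span G. f j - r \<in> N"
  shows "\<exists>b. (\<exists>j\<le>card G. b j \<noteq> 0) \<and> (\<Sum>j\<le>card G. b j *s f j) \<in> N"
proof -
  obtain r where r: "\<And>j. r j \<in> span G" "\<And>j. f j - r j \<in> N" using span by metis
  have "\<exists>b. (\<exists>j\<in>{..card G}. b j \<noteq> 0) \<and> (\<Sum>j\<in>{..card G}. b j *s r j) = 0"
    by (rule ex_nontrivial_relation[OF G]) (use r(1) in auto)
  then obtain b where b: "\<exists>j\<le>card G. b j \<noteq> 0" "(\<Sum>j\<le>card G. b j *s r j) = 0" by auto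
  have "(\<Sum>j\<le>card G. b j *s (f j - r j)) \<in> N"
    by (intro subspace_sum[OF N] subspace_scale[OF N] r(2))
  then have "(\<Sum>j\<le>card G. b j *s f j) \<in> N"
    using b(2) by (simp add: scale_right_diff_distrib sum_subtractf)
  with b(1) show ?thesis by blast
qed

lemma X_polynomial_dvd_X_power:
  fixes b :: "nat \<Rightarrow> 'a::field"
  assumes i: "i < s" and nonzero: "\<exists>j\<le>m. b j \<noteq> 0"
  obtains a v where "v \<in> Pser s" "v * (\<Sum>j\<le>m. mps_const (b j) * mps_X i ^ j) = mps_X i ^ a"
proof -
  define p where "p = (\<Sum>j\<le>m. mps_const (b j) * mps_X i ^ j)"
  define a where "a = (LEAST j. b j \<noteq> 0)"
  have least: "a \<le> j" if "b j \<noteq> 0" for j unfolding a_def using that by (rule Least_le)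
  have a: "b a \<noteq> 0" unfolding a_def using nonzero LeastI_ex[of "\<lambda>j. b j \<noteq> 0"] by blast
  have "a \<le> m" using nonzero least order_trans by blast
  have nth_p: "mps_nth p \<alpha> = (\<Sum>j\<le>m. if \<alpha> = single i j then b j else 0)" for \<alpha>
    by (auto simp: p_def mps_X_power mps_nth_monom intro!: sum.cong)
  have "p \<in> Pser s" using i by (simp add: p_def)
  moreover have "a \<le> lookup \<alpha> i" if "mps_nth p \<alpha> \<noteq> 0" for \<alpha>
    using that least unfolding nth_p by (auto elim!: sum.not_neutral_contains_not_neutral split: if_splits)
  ultimately obtain u where u: "u \<in> mpow s (0 - a)" "p = mps_X i ^ a * u" by (rule mps_eq_X_power_mult)
  have "mps_nth u 0 = mps_nth p (single i a)"
    using mps_nth_monom_mult[of "single i a" 1 u 0] by (simp add: u(2) mps_X_power)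
  also have "\<dots> = (\<Sum>j\<le>m. if a = j then b j else 0)"
    unfolding nth_p by (intro sum.cong) (auto dest: arg_cong[of _ _ mdeg])
  finally have "mps_nth u 0 \<noteq> 0" using a \<open>a \<le> m\<close> by simp
  then obtain v where v: "v \<in> Pser s" "u * v = 1" using u(1) mps_unit[of u s] by auto
  have "v * p = mps_X i ^ a" unfolding u(2) using v(2) by (metis mult.commute mult.assoc mult_1_right)
  with v(1) show thesis unfolding p_def by (rule that)
qed

locale field_submodule = submodule s N for s and N :: "'a::field mps m2 set"
begin

lemma subspace: "mat_space.subspace N"
  by (rule mat_space.subspaceI) (auto intro: zero add smul)

lemma cancel_const: "smul (mps_const c) A \<in> N \<Longrightarrow> c \<noteq> 0 \<Longrightarrow> A \<in> N"
  using mat_space.subspace_scale[OF subspace, of _ "1 / c"] by (fastforce simp: mps_monom_mult)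

lemma finite_colength_of_span:
  assumes G: "finite G"
    and span: "\<And>i j E. i < s \<Longrightarrow> E \<in> unit_mats \<Longrightarrow> \<exists>r\<in>mat_space.span G. smul (mps_X i ^ j) E - r \<in> N"
  shows "finite_colength s N"
proof (rule finite_colength_of_X_powers)
  fix i and E :: "'a mps m2" assume iE: "i < s" "E \<in> unit_mats"
  obtain b where nonzero: "\<exists>j\<le>card G. b j \<noteq> 0"
    and mem: "(\<Sum>j\<le>card G. smul (mps_const (b j)) (smul (mps_X i ^ j) E)) \<in> N"
    using mat_space.ex_combination_in_subspace[OF subspace G, of "\<lambda>j. smul (mps_X i ^ j) E"] span[OF iE] by auto
  obtain a v where v: "v \<in> Pser s" "v * (\<Sum>j\<le>card G. mps_const (b j) * mps_X i ^ j) = mps_X i ^ a"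
    by (rule X_polynomial_dvd_X_power[OF iE(1) nonzero])
  have "(\<Sum>j\<le>card G. smul (mps_const (b j)) (smul (mps_X i ^ j) E))
    = smul (\<Sum>j\<le>card G. mps_const (b j) * mps_X i ^ j) E"
    by (simp add: smul.scale_sum_left)
  then have "smul v (\<Sum>j\<le>card G. smul (mps_const (b j)) (smul (mps_X i ^ j) E)) = smul (mps_X i ^ a) E"
    by (simp only: smul.scale_scale v(2))
  then show "\<exists>a. smul (mps_X i ^ a) E \<in> N" using smul[OF v(1) mem] by metis
qed

end

definition monomial_mats :: "nat \<Rightarrow> nat \<Rightarrow> 'a::comm_ring_1 mps m2 set" where
  "monomial_mats s n = (\<lambda>(\<alpha>, E). smul (mps_monom \<alpha> 1) E) ` ({\<alpha> \<in> exponents s. mdeg \<alpha> \<le> n} \<times> unit_mats)"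

lemma finite_monomial_mats: "finite (monomial_mats s n)"
  unfolding monomial_mats_def
  by (intro finite_imageI finite_cartesian_product finite_exponents_bounded finite_unit_mats)

lemma monomial_mats_Pser: "monomial_mats s n \<subseteq> mats (Pser s)"
  unfolding monomial_mats_def using unit_mats_Pser[of s]
  by (auto intro!: smul_mats_Pser)

lemma trunc_in_span_monomial_mats: "map_m2 (trunc s n) A \<in> mat_space.span (monomial_mats s n)"
proof -
  have "smul (trunc s n f) E \<in> mat_space.span (monomial_mats s n)" if "E \<in> unit_mats" for f and E :: "'a mps m2"
  proof -
    have "smul (trunc s n f) E =
        (\<Sum>\<alpha> | \<alpha> \<in> exponents s \<and> mdeg \<alpha> \<le> n. smul (mps_const (mps_nth f \<alpha>)) (smul (mps_monom \<alpha> 1) E))"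
      unfolding trunc_def smul.scale_sum_left by (simp add: mps_monom_mult)
    also have "\<dots> \<in> mat_space.span (monomial_mats s n)"
      by (intro mat_space.span_sum mat_space.span_scale mat_space.span_base)
         (use that in \<open>auto simp: monomial_mats_def\<close>)
    finally show ?thesis .
  qed
  then show ?thesis
    by (subst m2_eq_sum_units) (simp; intro mat_space.span_add; simp add: unit_mats_def)
qed

section \<open>The infinitesimal action\<close>

text \<open>A triple \<open>(u, v, d)\<close> is the displacement from the identity of the element of G given by the matrices
  \<open>1 + u\<close> and \<open>1 + v\<close> and the substitution \<open>x\<^sub>\<nu> \<mapsto> x\<^sub>\<nu> + d\<^sub>\<nu>\<close>.\<close>

type_synonym 'a displacement = "'a mps m2 \<times> 'a mps m2 \<times> (nat \<Rightarrow> 'a mps)"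

definition displacements :: "nat \<Rightarrow> nat \<Rightarrow> 'a::comm_ring_1 displacement set" where
  "displacements s n = mats (mpow s n) \<times> mats (mpow s n) \<times> {d. \<forall>\<nu>. d \<nu> \<in> mpow s (Suc n)}"

lemma displacements_iff:
  "(u, v, d) \<in> displacements s n
    \<longleftrightarrow> u \<in> mats (mpow s n) \<and> v \<in> mats (mpow s n) \<and> (\<forall>\<nu>. d \<nu> \<in> mpow s (Suc n))"
  by (simp add: displacements_def)

interpretation displacements: complete_filtration "displacements s :: nat \<Rightarrow> 'a::comm_ring_1 displacement set" for s
proof -
  have "complete_filtration (\<lambda>n. mpow s (Suc n) :: 'a mps set)"
    using mpow.complete_filtration_shift[of s 1] by simp
  then have "complete_filtration (\<lambda>n. {d :: nat \<Rightarrow> 'a mps. \<forall>\<nu>. d \<nu> \<in> mpow s (Suc n)})"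
    by (rule complete_filtration.complete_filtration_fun)
  then show "complete_filtration (displacements s :: nat \<Rightarrow> 'a displacement set)"
    unfolding displacements_def by (intro mats.complete_filtration_Times)
qed

definition group_act :: "nat \<Rightarrow> 'a::comm_ring_1 mps m2 \<Rightarrow> 'a displacement \<Rightarrow> 'a mps m2" where
  "group_act s A = (\<lambda>(u, v, d). (1 + u) * map_m2 (mps_subst s (\<lambda>i. mps_X i + d i)) A * (1 + v))"

definition inf_act :: "nat \<Rightarrow> 'a::comm_ring_1 mps m2 \<Rightarrow> 'a displacement \<Rightarrow> 'a mps m2" where
  "inf_act s A = (\<lambda>(u, v, d). u * A + A * v + (\<Sum>\<nu><s. smul (d \<nu>) (map_m2 (mps_deriv \<nu>) A)))"

definition tangent_module :: "nat \<Rightarrow> 'a::comm_ring_1 mps m2 \<Rightarrow> 'a mps m2 set" where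
  "tangent_module s A = inf_act s A ` displacements s 0"

lemma inf_act_Pair: "inf_act s A (u, v, d) = u * A + A * v + (\<Sum>\<nu><s. smul (d \<nu>) (map_m2 (mps_deriv \<nu>) A))"
  by (simp add: inf_act_def)

interpretation inf_act: additive "inf_act s A :: 'a::comm_ring_1 displacement \<Rightarrow> 'a mps m2" for s A
  by standard (simp add: inf_act_def case_prod_unfold algebra_simps sum.distrib)

lemma inf_act_mats:
  assumes "A \<in> mats (Pser s)" "z \<in> displacements s n"
  shows "inf_act s A z \<in> mats (mpow s n)"
proof -
  obtain u v d where z: "z = (u, v, d)" by (cases z)
  with assms have "u \<in> mats (mpow s n)" "v \<in> mats (mpow s n)" "\<And>\<nu>. d \<nu> \<in> mpow s n"
    using mpow.antimono[of _ s "Suc n" n] by (auto simp: displacements_iff)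
  then show ?thesis unfolding z inf_act_Pair using assms(1)
    by (intro mats.add mats.sum mats.mult_left mats.mult_right smul_mats_Pser(2)) simp_all
qed

definition scale_displacement :: "'a mps \<Rightarrow> 'a displacement \<Rightarrow> 'a::comm_ring_1 displacement" where
  "scale_displacement r = (\<lambda>(u, v, d). (smul r u, smul r v, \<lambda>\<nu>. r * d \<nu>))"

lemma scale_displacement_in:
  "r \<in> mpow s m \<Longrightarrow> z \<in> displacements s n \<Longrightarrow> scale_displacement r z \<in> displacements s (m + n)"
  using mpow.mult[of r s m _ "Suc n"]
  by (cases z) (simp add: displacements_iff scale_displacement_def smul_mats_mpow)

lemma inf_act_scale: "inf_act s A (scale_displacement r z) = smul r (inf_act s A z)"
  by (cases z) (simp add: inf_act_Pair scale_displacement_def smul.scale_right_distrib smul.scale_sum_right)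

lemma tangent_moduleI: "z \<in> displacements s 0 \<Longrightarrow> inf_act s A z \<in> tangent_module s A"
  by (simp add: tangent_module_def)

lemma tangent_moduleE:
  assumes "B \<in> tangent_module s A"
  obtains z where "z \<in> displacements s 0" "B = inf_act s A z"
  using assms by (auto simp: tangent_module_def)

interpretation tangent_module: submodule s "tangent_module s A" for s and A :: "'a::comm_ring_1 mps m2"
proof
  show "0 \<in> tangent_module s A"
    using tangent_moduleI[OF displacements.zero, of s A] by (simp add: inf_act.zero)
next
  fix B C assume "B \<in> tangent_module s A" "C \<in> tangent_module s A"
  then obtain z w where "z \<in> displacements s 0" "B = inf_act s A z" "w \<in> displacements s 0" "C = inf_act s A w"
    by (elim tangent_moduleE)
  then show "B + C \<in> tangent_module s A"
    using tangent_moduleI[OF displacements.add, of z s w A] by (simp add: inf_act.add)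
next
  fix r :: "'a mps" and B assume "r \<in> Pser s" "B \<in> tangent_module s A"
  then obtain z where "z \<in> displacements s 0" "B = inf_act s A z" by (elim tangent_moduleE)
  then show "smul r B \<in> tangent_module s A"
    using tangent_moduleI[of "scale_displacement r z" s A] scale_displacement_in[OF \<open>r \<in> Pser s\<close>, of z 0]
    by (simp add: inf_act_scale)
qed

interpretation tangent_module: field_submodule s "tangent_module s A" for s and A :: "'a::field mps m2" ..

lemma tangent_module_mult:
  assumes "X \<in> mats (Pser s)"
  shows "X * A \<in> tangent_module s A" "A * X \<in> tangent_module s A"
proof -
  have "(X, 0, \<lambda>_. 0) \<in> displacements s 0" "(0, X, \<lambda>_. 0) \<in> displacements s 0"
    using assms by (simp_all add: displacements_iff)
  from this[THEN tangent_moduleI, of A] show "X * A \<in> tangent_module s A" "A * X \<in> tangent_module s A"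
    by (simp_all add: inf_act_Pair)
qed

lemma tangent_module_deriv:
  assumes "\<nu> < s" "f \<in> mpow s (Suc 0)"
  shows "smul f (map_m2 (mps_deriv \<nu>) A) \<in> tangent_module s A"
proof -
  let ?z = "(0, 0, \<lambda>\<mu>. if \<mu> = \<nu> then f else 0)"
  have "inf_act s A ?z = (\<Sum>\<mu><s. if \<mu> = \<nu> then smul f (map_m2 (mps_deriv \<nu>) A) else 0)"
    unfolding inf_act_Pair by (simp add: if_distrib[of "\<lambda>r. smul r _"] cong: if_cong)
  also have "\<dots> = smul f (map_m2 (mps_deriv \<nu>) A)" using assms by simp
  finally show ?thesis using assms tangent_moduleI[of ?z s A] by (simp add: displacements_iff)
qed

lemma inf_act_lift:
  assumes c: "mats (mpow s c) \<subseteq> tangent_module s A" and C: "C \<in> mats (mpow s (c + n))"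
  shows "\<exists>z\<in>displacements s n. inf_act s A z = C"
  using C
proof (induction n arbitrary: C)
  case 0
  then have "C \<in> tangent_module s A" using c by auto
  then show ?case by (elim tangent_moduleE) blast
next
  case (Suc n)
  then obtain D where D: "\<And>i. D i \<in> mats (mpow s (c + n))" "C = (\<Sum>i<s. smul (mps_X i) (D i))"
    using mats_mpow_Suc_eq_sum_X_smul[of C s "c + n"] by auto
  obtain z where z: "\<And>i. z i \<in> displacements s n" "\<And>i. inf_act s A (z i) = D i"
    using Suc.IH[OF D(1)] by metis
  have "scale_displacement (mps_X i) (z i) \<in> displacements s (Suc n)" if "i < s" for i
    using scale_displacement_in[OF _ z(1), of "mps_X i" "Suc 0" i] that by simp
  then have "(\<Sum>i<s. scale_displacement (mps_X i) (z i)) \<in> displacements s (Suc n)"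
    by (intro displacements.sum) simp
  moreover have "inf_act s A (\<Sum>i<s. scale_displacement (mps_X i) (z i)) = C"
    by (simp add: inf_act.sum inf_act_scale z(2) D(2))
  ultimately show ?case by blast
qed

section \<open>Finite colength implies finite determinacy\<close>

lemma group_act_zero: "A \<in> mats (Pser s) \<Longrightarrow> group_act s A 0 = A"
  by (simp add: group_act_def zero_prod_def map_m2_ident mps_subst_X)

lemma first_order_change_map_subst:
  fixes A :: "'a::comm_ring_1 mps m2"
  assumes A: "A \<in> mats (Pser s)" and "e \<le> m"
    and d: "\<And>i. d i \<in> mpow s (Suc e)" "\<And>i. d' i \<in> mpow s (Suc m)"
  shows "mats.first_order_change s e m 0 A (map_m2 (mps_subst s (\<lambda>i. mps_X i + d i)) A)
    (map_m2 (mps_subst s (\<lambda>i. mps_X i + d i + d' i)) A) (\<Sum>\<nu><s. smul (d' \<nu>) (map_m2 (mps_deriv \<nu>) A))"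
proof -
  have "mpow.first_order_change s e m 0 f (mps_subst s (\<lambda>i. mps_X i + d i) f)
    (mps_subst s (\<lambda>i. mps_X i + d i + d' i) f) (\<Sum>\<nu><s. d' \<nu> * mps_deriv \<nu> f)" if "f \<in> Pser s" for f
    by (rule first_order_change_subst[OF d \<open>e \<le> m\<close> that])
  then show ?thesis using A
    unfolding mats.first_order_change_def mpow.first_order_change_def by (simp add: mats_def)
qed

lemma group_act_first_order:
  assumes A: "A \<in> mats (Pser s)" and "e \<le> m"
    and z: "z \<in> displacements s e" and w: "w \<in> displacements s m"
  shows "group_act s A (z + w) - group_act s A z - inf_act s A w \<in> mats (mpow s (e + m))"
proof -
  obtain u v d u' v' d' where zw: "z = (u, v, d)" "w = (u', v', d')" by (cases z; cases w)
  let ?P = "map_m2 (mps_subst s (\<lambda>i. mps_X i + d i)) A" and ?Q = "map_m2 (mps_subst s (\<lambda>i. mps_X i + d i + d' i)) A"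
    and ?D = "\<Sum>\<nu><s. smul (d' \<nu>) (map_m2 (mps_deriv \<nu>) A)"
  have "mats.first_order_change s e m 0 1 (1 + u) (1 + u + u') u'"
    "mats.first_order_change s e m 0 1 (1 + v) (1 + v + v') v'"
    using z w by (simp_all add: zw displacements_iff mats.first_order_change_def)
  moreover have "mats.first_order_change s e m 0 A ?P ?Q ?D"
    using z w by (intro first_order_change_map_subst A \<open>e \<le> m\<close>) (simp_all add: zw displacements_iff)
  ultimately have "mats.first_order_change s e m (0 + 0 + 0) (1 * A * 1) ((1 + u) * ?P * (1 + v))
    ((1 + u + u') * ?Q * (1 + v + v')) ((u' * A + 1 * ?D) * 1 + 1 * A * v')"
    by (intro mats.first_order_change_mult \<open>e \<le> m\<close>)
  then show ?thesis
    by (simp add: mats.first_order_change_def group_act_def inf_act_def zw add.assoc add_ac)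
qed

lemma group_act_continuous:
  assumes A: "A \<in> mats (Pser s)" and z: "z \<in> displacements s 0" "z' \<in> displacements s 0"
    and close: "z - z' \<in> displacements s n"
  shows "group_act s A z - group_act s A z' \<in> mats (mpow s n)"
proof -
  have "group_act s A (z' + (z - z')) - group_act s A z' - inf_act s A (z - z') \<in> mats (mpow s (0 + n))"
    by (rule group_act_first_order[OF A _ z(2) close]) simp
  then have "(group_act s A z - group_act s A z' - inf_act s A (z - z')) + inf_act s A (z - z') \<in> mats (mpow s n)"
    using inf_act_mats[OF A close] by (intro mats.add) simp_all
  then show ?thesis by simp
qed

text \<open>The residual \<open>B - group_act s A z\<close> gains one order when z is corrected by a preimage of the residual
  under the infinitesimal action, because the new error is quadratic.\<close>

lemma group_act_transitive:
  fixes A :: "'a::comm_ring_1 mps m2"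
  assumes A: "A \<in> mats (Pser s)" and c: "mats (mpow s c) \<subseteq> tangent_module s A"
    and B: "B - A \<in> mats (mpow s (2 * c + 1))"
  shows "\<exists>z\<in>displacements s 1. group_act s A z = B"
proof -
  define e where "e = Suc c"
  interpret shifted: complete_filtration "\<lambda>n. displacements s (e + n)"
    by (rule displacements.complete_filtration_shift)
  have in_0: "z \<in> displacements s 0" if "z \<in> displacements s n" for z n
    using displacements.antimono[OF that] by simp
  have "\<exists>z\<in>displacements s (e + 0). group_act s A z = B"
  proof (rule shifted.successive_approximation[where G = "\<lambda>n. mats (mpow s (c + e + n))" and k = c and z\<^sub>0 = 0])
    show "separated_filtration (\<lambda>n. mats (mpow s (c + e + n)))"
      using mats.complete_filtration_shift[of s "c + e"] by (rule complete_filtration.axioms)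
    show "B - group_act s A 0 \<in> mats (mpow s (c + e + 0))"
      using B by (simp add: group_act_zero[OF A] e_def mult_2)
  next
    fix n and z :: "'a displacement"
    assume z: "z \<in> displacements s (e + 0)" and "B - group_act s A z \<in> mats (mpow s (c + e + n))"
    then obtain w where w: "w \<in> displacements s (e + n)" "inf_act s A w = B - group_act s A z"
      using inf_act_lift[OF c, of _ "e + n"] by (metis add.assoc)
    have "- (group_act s A (z + w) - group_act s A z - inf_act s A w) \<in> mats (mpow s (e + (e + n)))"
      using z w(1) by (intro mats.uminus group_act_first_order[OF A]) simp_all
    then have "B - group_act s A (z + w) \<in> mats (mpow s (c + e + Suc n))"
      by (simp add: w(2) e_def add.assoc)
    with w(1) show "\<exists>w\<in>displacements s (e + n). B - group_act s A (z + w) \<in> mats (mpow s (c + e + Suc n))" ..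
  next
    fix n and z z' :: "'a displacement"
    assume "z \<in> displacements s (e + 0)" "z' \<in> displacements s (e + 0)" "z - z' \<in> displacements s (e + (c + n))"
    then show "group_act s A z - group_act s A z' \<in> mats (mpow s (c + e + n))"
      using group_act_continuous[OF A in_0 in_0, of z _ z' _ "e + (c + n)"] by (simp add: add_ac)
  qed simp
  then show ?thesis using displacements.antimono[of _ s e 1] by (auto simp: e_def)
qed

section \<open>Invariance of finite colength under the group\<close>

lemma map_deriv_mult:
  "map_m2 (mps_deriv \<nu>) (A * B) = map_m2 (mps_deriv \<nu>) A * B + A * map_m2 (mps_deriv \<nu>) B"
  by (simp add: m2_eq_iff mps_deriv_mult)

lemma inf_act_mult:
  fixes U :: "'a::comm_ring_1 mps m2"
  assumes U: "U' * U = 1" and V: "V * V' = 1"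
  shows "U' * inf_act s (U * A * V) (u, v, d) * V' = inf_act s A
    (U' * u * U + (\<Sum>\<nu><s. smul (d \<nu>) (U' * map_m2 (mps_deriv \<nu>) U)),
     V * v * V' + (\<Sum>\<nu><s. smul (d \<nu>) (map_m2 (mps_deriv \<nu>) V * V')), d)"
proof -
  have cancel: "U' * (U * X) = X" "X * V * V' = X" for X
    using U V by (metis mult.assoc mult_1_left, metis mult.assoc mult_1_right)
  have deriv: "U' * map_m2 (mps_deriv \<nu>) (U * A * V) * V'
    = U' * map_m2 (mps_deriv \<nu>) U * A + A * (map_m2 (mps_deriv \<nu>) V * V') + map_m2 (mps_deriv \<nu>) A" for \<nu>
    by (simp add: map_deriv_mult distrib_left distrib_right mult.assoc cancel V)
  have "U' * inf_act s (U * A * V) (u, v, d) * V' = U' * (u * (U * A * V)) * V' + U' * ((U * A * V) * v) * V'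
      + (\<Sum>\<nu><s. smul (d \<nu>) (U' * map_m2 (mps_deriv \<nu>) (U * A * V) * V'))"
    unfolding inf_act_Pair by (simp add: distrib_left distrib_right sum_distrib_left sum_distrib_right)
  also have "U' * (u * (U * A * V)) * V' = U' * u * U * A" by (simp add: mult.assoc V)
  also have "U' * ((U * A * V) * v) * V' = A * (V * v * V')" by (simp add: mult.assoc cancel)
  finally show ?thesis
    unfolding inf_act_Pair deriv
    by (simp add: smul.scale_right_distrib sum.distrib sum_distrib_left sum_distrib_right
        distrib_left distrib_right add_ac)
qed

lemma tangent_module_mult_pullback:
  assumes U: "U \<in> mats (Pser s)" "U' \<in> mats (Pser s)" "U' * U = 1"
    and V: "V \<in> mats (Pser s)" "V' \<in> mats (Pser s)" "V * V' = 1"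
    and C: "U * C * V \<in> tangent_module s (U * A * V)"
  shows "C \<in> tangent_module s A"
proof -
  obtain u v d where uvd: "u \<in> mats (Pser s)" "v \<in> mats (Pser s)" "\<And>\<nu>. d \<nu> \<in> mpow s (Suc 0)"
    and UCV: "U * C * V = inf_act s (U * A * V) (u, v, d)"
    using C by (elim tangent_moduleE) (auto simp: displacements_def)
  have "C = U' * (U * C * V) * V'" using U(3) V(3) by (metis mult.assoc mult_1_left mult_1_right)
  also have "\<dots> = U' * inf_act s (U * A * V) (u, v, d) * V'" by (simp only: UCV)
  also note inf_act_mult[OF U(3) V(3)]
  finally show ?thesis using U V uvd Pser_of_mpow[OF uvd(3)]
    by (auto simp: displacements_iff intro!: tangent_moduleI mats.add mats.sum smul_mats_Pser)
qed

locale power_series_automorphism =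
  fixes s :: nat and \<phi> :: "'a::field mps \<Rightarrow> 'a mps"
  assumes bij: "bij_betw \<phi> (Pser s) (Pser s)"
    and add: "f \<in> Pser s \<Longrightarrow> g \<in> Pser s \<Longrightarrow> \<phi> (f + g) = \<phi> f + \<phi> g"
    and mult: "f \<in> Pser s \<Longrightarrow> g \<in> Pser s \<Longrightarrow> \<phi> (f * g) = \<phi> f * \<phi> g"
    and const: "\<phi> (mps_const c) = mps_const c"
begin

lemma Pser [simp]: "f \<in> Pser s \<Longrightarrow> \<phi> f \<in> Pser s"
  using bij by (auto simp: bij_betw_def)

lemma surj: "g \<in> Pser s \<Longrightarrow> \<exists>f\<in>Pser s. \<phi> f = g"
  using bij unfolding bij_betw_def by (metis image_iff)

lemma inj: "f \<in> Pser s \<Longrightarrow> g \<in> Pser s \<Longrightarrow> \<phi> f = \<phi> g \<longleftrightarrow> f = g"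
  using bij by (auto simp: bij_betw_def inj_on_def)

lemma one [simp]: "\<phi> 1 = 1"
  using const[of 1] by simp

lemma zero [simp]: "\<phi> 0 = 0"
  using const[of 0] by simp

lemma sum: "(\<And>i. i \<in> I \<Longrightarrow> f i \<in> Pser s) \<Longrightarrow> \<phi> (\<Sum>i\<in>I. f i) = (\<Sum>i\<in>I. \<phi> (f i))"
  by (induction I rule: infinite_finite_induct) (auto simp: add)

lemma mpow_Suc_0_iff:
  assumes f: "f \<in> Pser s"
  shows "\<phi> f \<in> mpow s (Suc 0) \<longleftrightarrow> f \<in> mpow s (Suc 0)"
proof -
  have unit_iff: "h \<notin> mpow s (Suc 0) \<longleftrightarrow> (\<exists>g\<in>Pser s. h * g = 1)" if h: "h \<in> Pser s" for h :: "'a mps"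
  proof
    assume "h \<notin> mpow s (Suc 0)"
    with h have "mps_nth h 0 \<noteq> 0" by (simp add: mpow_Suc_0_iff)
    then show "\<exists>g\<in>Pser s. h * g = 1" by (rule mps_unit[OF h]) blast
  next
    assume "\<exists>g\<in>Pser s. h * g = 1"
    then obtain g where "h * g = 1" by blast
    then have "mps_nth h 0 * mps_nth g 0 = 1" by (metis mps_nth_mult_0 mps_nth_one)
    then show "h \<notin> mpow s (Suc 0)" by (auto simp: mpow_Suc_0_iff)
  qed
  have "\<phi> f * \<phi> g = 1 \<longleftrightarrow> f * g = 1" if "g \<in> Pser s" for g
    using inj[of "f * g" 1] f that by (simp add: mult)
  then have "(\<exists>g\<in>Pser s. \<phi> f * g = 1) \<longleftrightarrow> (\<exists>g\<in>Pser s. f * g = 1)"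
    using surj Pser by metis
  then show ?thesis using unit_iff[OF f] unit_iff[OF Pser[OF f]] by blast
qed

lemma mpow:
  assumes "f \<in> mpow s n"
  shows "\<phi> f \<in> mpow s n"
  using assms
proof (induction n arbitrary: f)
  case (Suc n)
  obtain g where g: "\<And>i. g i \<in> mpow s n" "f = (\<Sum>i<s. mps_X i * g i)"
    using mpow_Suc_eq_sum_X_mult[OF Suc.prems] by blast
  have "\<phi> f = (\<Sum>i<s. \<phi> (mps_X i) * \<phi> (g i))"
    unfolding g(2) using Pser_of_mpow[OF g(1)] by (subst sum) (simp_all add: mult)
  also have "\<dots> \<in> mpow s (Suc n)"
  proof (rule mpow.sum)
    fix i assume "i \<in> {..<s}"
    then have "\<phi> (mps_X i) \<in> mpow s (Suc 0)" by (simp add: mpow_Suc_0_iff)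
    from mpow.mult[OF this Suc.IH[OF g(1)]] show "\<phi> (mps_X i) * \<phi> (g i) \<in> mpow s (Suc n)" by simp
  qed
  finally show ?case .
qed simp

lemma chain_rule:
  assumes f: "f \<in> Pser s"
  shows "mps_deriv \<nu> (\<phi> f) = (\<Sum>\<mu><s. \<phi> (mps_deriv \<mu> f) * mps_deriv \<nu> (\<phi> (mps_X \<mu>)))"
proof -
  define E where "E f = (\<Sum>\<mu><s. \<phi> (mps_deriv \<mu> f) * mps_deriv \<nu> (\<phi> (mps_X \<mu>)))" for f
  have E_mult: "E (f * g) = E f * \<phi> g + \<phi> f * E g" if "f \<in> Pser s" "g \<in> Pser s" for f g
    using that
    by (simp add: E_def add mult mps_deriv_mult sum_distrib_left sum_distrib_right algebra_simps flip: sum.distrib)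
  have E_X: "E (mps_X i) = mps_deriv \<nu> (\<phi> (mps_X i))" if "i < s" for i
  proof -
    have "E (mps_X i) = (\<Sum>\<mu><s. if i = \<mu> then mps_deriv \<nu> (\<phi> (mps_X i)) else 0)"
      unfolding E_def by (intro sum.cong) (auto simp: mps_deriv_X)
    then show ?thesis using that by simp
  qed
  have "mps_deriv \<nu> (\<phi> f) = E f"
  proof (rule additive_eqI_monomials[OF f, where \<Theta> = "\<lambda>f. mps_deriv \<nu> (\<phi> f)" and \<Theta>' = E])
    fix \<alpha> c assume "\<alpha> \<in> exponents s"
    then show "mps_deriv \<nu> (\<phi> (mps_monom \<alpha> c)) = E (mps_monom \<alpha> c)"
    proof (induction \<alpha> rule: exponents_induct)
      case zero
      then show ?case by (simp add: const E_def)
    next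
      case (add i \<beta>)
      then have "mps_deriv \<nu> (\<phi> (mps_X i * mps_monom \<beta> c)) = E (mps_X i * mps_monom \<beta> c)"
        by (simp add: mult E_mult mps_deriv_mult E_X)
      then show ?case by (simp add: mps_X_mult_monom)
    qed
  next
    fix n and h :: "'a mps" assume h: "h \<in> mpow s (Suc n)"
    show "mps_deriv \<nu> (\<phi> h) \<in> mpow s n" using mpow_deriv[OF mpow[OF h], of \<nu>] by simp
    show "E h \<in> mpow s n"
      unfolding E_def using mpow[OF mpow_deriv[OF h]] by (intro mpow.sum mpow.mult_right) simp_all
  qed (simp_all add: E_def add distrib_right sum.distrib)
  then show ?thesis by (simp only: E_def)
qed

abbreviation mmap :: "'a mps m2 \<Rightarrow> 'a mps m2" where "mmap \<equiv> map_m2 \<phi>"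

lemma mmap_add: "A \<in> mats (Pser s) \<Longrightarrow> B \<in> mats (Pser s) \<Longrightarrow> mmap (A + B) = mmap A + mmap B"
  by (simp add: m2_eq_iff mats_def add)

lemma mmap_mult: "A \<in> mats (Pser s) \<Longrightarrow> B \<in> mats (Pser s) \<Longrightarrow> mmap (A * B) = mmap A * mmap B"
  by (simp add: m2_eq_iff mats_def add mult)

lemma mmap_smul: "r \<in> Pser s \<Longrightarrow> A \<in> mats (Pser s) \<Longrightarrow> mmap (smul r A) = smul (\<phi> r) (mmap A)"
  by (simp add: m2_eq_iff mats_def mult)

lemma mmap_sum: "(\<And>i. i \<in> I \<Longrightarrow> f i \<in> mats (Pser s)) \<Longrightarrow> mmap (\<Sum>i\<in>I. f i) = (\<Sum>i\<in>I. mmap (f i))"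
  by (simp add: m2_eq_iff mats_def sum)

lemma mmap_mats [simp]: "A \<in> mats (mpow s n) \<Longrightarrow> mmap A \<in> mats (mpow s n)"
  using mpow by (erule_tac mats_map)

lemma mmap_surj:
  assumes "A \<in> mats (Pser s)"
  shows "\<exists>B\<in>mats (Pser s). mmap B = A"
proof -
  obtain \<psi> where \<psi>: "\<And>f. f \<in> Pser s \<Longrightarrow> \<psi> f \<in> Pser s" "\<And>f. f \<in> Pser s \<Longrightarrow> \<phi> (\<psi> f) = f"
    using surj by metis
  have "map_m2 \<psi> A \<in> mats (Pser s)" using assms \<psi>(1) by (rule mats_map)
  moreover have "mmap (map_m2 \<psi> A) = A" using assms by (simp add: m2_eq_iff mats_def \<psi>(2))
  ultimately show ?thesis by blast
qed

lemma mmap_inj: "A \<in> mats (Pser s) \<Longrightarrow> B \<in> mats (Pser s) \<Longrightarrow> mmap A = mmap B \<Longrightarrow> A = B"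
  by (simp add: m2_eq_iff mats_def inj)

lemma map_deriv_mmap:
  "A \<in> mats (Pser s) \<Longrightarrow> map_m2 (mps_deriv \<nu>) (mmap A)
    = (\<Sum>\<mu><s. smul (mps_deriv \<nu> (\<phi> (mps_X \<mu>))) (mmap (map_m2 (mps_deriv \<mu>) A)))"
  by (simp add: m2_eq_iff mats_def chain_rule mult.commute)

lemma inf_act_mmap:
  assumes A: "A \<in> mats (Pser s)" and z: "z \<in> displacements s 0"
  shows "\<exists>w\<in>displacements s 0. mmap (inf_act s A w) = inf_act s (mmap A) z"
proof -
  obtain u v d where z_eq: "z = (u, v, d)" by (cases z)
  with z have uvd: "u \<in> mats (Pser s)" "v \<in> mats (Pser s)" "\<And>\<nu>. d \<nu> \<in> mpow s (Suc 0)"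
    by (simp_all add: displacements_iff)
  obtain u' v' where uv': "u' \<in> mats (Pser s)" "mmap u' = u" "v' \<in> mats (Pser s)" "mmap v' = v"
    using mmap_surj uvd(1,2) by metis
  define e where "e \<mu> = (if \<mu> < s then \<Sum>\<nu><s. d \<nu> * mps_deriv \<nu> (\<phi> (mps_X \<mu>)) else 0)" for \<mu>
  have e: "e \<mu> \<in> mpow s (Suc 0)" for \<mu>
    using uvd(3) by (auto simp: e_def intro!: mpow.sum mpow.mult_right)
  have "\<exists>f\<in>Pser s. \<phi> f = e \<mu>" for \<mu> by (intro surj Pser_of_mpow[OF e])
  then obtain d' where d': "\<And>\<mu>. d' \<mu> \<in> Pser s" "\<And>\<mu>. \<phi> (d' \<mu>) = e \<mu>" by metis
  have "mmap (inf_act s A (u', v', d')) = u * mmap A + mmap A * v + (\<Sum>\<mu><s. smul (e \<mu>) (mmap (map_m2 (mps_deriv \<mu>) A)))"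
    using A uv' d' by (simp add: inf_act_Pair mmap_add mmap_mult mmap_sum mmap_smul)
  also have "(\<Sum>\<mu><s. smul (e \<mu>) (mmap (map_m2 (mps_deriv \<mu>) A)))
    = (\<Sum>\<nu><s. smul (d \<nu>) (map_m2 (mps_deriv \<nu>) (mmap A)))"
    unfolding map_deriv_mmap[OF A] smul.scale_sum_right
    by (subst sum.swap) (simp add: e_def smul.scale_sum_left)
  finally have "mmap (inf_act s A (u', v', d')) = inf_act s (mmap A) z"
    by (simp add: z_eq inf_act_Pair)
  moreover have "(u', v', d') \<in> displacements s 0"
    using uv' d' e mpow_Suc_0_iff[OF d'(1)] by (simp add: displacements_iff)
  ultimately show ?thesis by blast
qed

lemma tangent_module_mmap_pullback:
  assumes A: "A \<in> mats (Pser s)" and C: "C \<in> mats (Pser s)" "mmap C \<in> tangent_module s (mmap A)"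
  shows "C \<in> tangent_module s A"
proof -
  obtain z where z: "z \<in> displacements s 0" "mmap C = inf_act s (mmap A) z"
    using C(2) by (rule tangent_moduleE)
  then obtain w where w: "w \<in> displacements s 0" "mmap C = mmap (inf_act s A w)"
    using inf_act_mmap[OF A z(1)] by metis
  have "C = inf_act s A w" by (rule mmap_inj[OF C(1) inf_act_mats[OF A w(1)] w(2)])
  with w(1) show ?thesis by (simp add: tangent_moduleI)
qed

lemma finite_colength_tangent_module_pullback:
  assumes A: "A \<in> mats (Pser s)"
    and U: "U \<in> mats (Pser s)" "U' \<in> mats (Pser s)" "U' * U = 1"
    and V: "V \<in> mats (Pser s)" "V' \<in> mats (Pser s)" "V * V' = 1"
    and colength: "finite_colength s (tangent_module s (U * mmap A * V))"
  shows "finite_colength s (tangent_module s A)"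
proof -
  obtain n where n: "mats (mpow s n) \<subseteq> tangent_module s (U * mmap A * V)"
    using colength unfolding finite_colength_def ..
  have "mats (mpow s n) \<subseteq> tangent_module s A"
  proof
    fix C :: "'a mps m2" assume C: "C \<in> mats (mpow s n)"
    then have "U * mmap C * V \<in> mats (mpow s n)"
      by (intro mats.mult_right[OF mats.mult_left[OF U(1)] V(1)] mmap_mats)
    then have "U * mmap C * V \<in> tangent_module s (U * mmap A * V)" using n by (rule rev_subsetD)
    then have "mmap C \<in> tangent_module s (mmap A)" by (rule tangent_module_mult_pullback[OF U V])
    then show "C \<in> tangent_module s A"
      by (rule tangent_module_mmap_pullback[OF A mats.antimono[OF C le0]])
  qed
  then show ?thesis unfolding finite_colength_def ..
qed

end

section \<open>Top degree forms\<close>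

definition forms :: "nat \<Rightarrow> nat \<Rightarrow> 'a::comm_ring_1 mps set" where
  "forms s d = {f. \<forall>\<alpha>. mps_nth f \<alpha> \<noteq> 0 \<longrightarrow> \<alpha> \<in> exponents s \<and> mdeg \<alpha> = d}"

definition polys_below :: "nat \<Rightarrow> nat \<Rightarrow> 'a::comm_ring_1 mps set" where
  "polys_below s d = {f. \<forall>\<alpha>. mps_nth f \<alpha> \<noteq> 0 \<longrightarrow> \<alpha> \<in> exponents s \<and> mdeg \<alpha> < d}"

definition hom_part :: "nat \<Rightarrow> 'a::comm_ring_1 mps \<Rightarrow> 'a mps" where
  "hom_part d f = Mps (\<lambda>\<alpha>. if mdeg \<alpha> = d then mps_nth f \<alpha> else 0)"

lemma mps_nth_hom_part: "mps_nth (hom_part d f) \<alpha> = (if mdeg \<alpha> = d then mps_nth f \<alpha> else 0)"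
  by (simp add: hom_part_def)

interpretation hom_part: additive "hom_part d :: 'a::comm_ring_1 mps \<Rightarrow> 'a mps" for d
  by standard (rule mps_eqI, simp add: mps_nth_hom_part)

lemma hom_part_forms [simp]: "f \<in> Pser s \<Longrightarrow> hom_part d f \<in> forms s d"
  by (simp add: forms_def mpow_def mps_nth_hom_part)

lemma hom_part_ident: "f \<in> forms s d \<Longrightarrow> hom_part d f = f"
  by (rule mps_eqI) (auto simp: forms_def mps_nth_hom_part)

lemma forms_mpow: "f \<in> forms s d \<Longrightarrow> n \<le> d \<Longrightarrow> f \<in> mpow s n"
  by (auto simp: forms_def mpow_def)

lemma polys_below_Pser: "f \<in> polys_below s d \<Longrightarrow> f \<in> Pser s"
  by (simp add: polys_below_def mpow_def)

lemma polys_below_mono: "f \<in> polys_below s d \<Longrightarrow> d \<le> e \<Longrightarrow> f \<in> polys_below s e"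
  by (fastforce simp: polys_below_def)

lemma zero_polys_below [simp]: "0 \<in> polys_below s d"
  by (simp add: polys_below_def)

lemma add_polys_below [simp]: "f \<in> polys_below s d \<Longrightarrow> g \<in> polys_below s d \<Longrightarrow> f + g \<in> polys_below s d"
  unfolding polys_below_def mem_Collect_eq by (metis add.right_neutral mps_nth_simps(2))

lemma uminus_polys_below [simp]: "f \<in> polys_below s d \<Longrightarrow> - f \<in> polys_below s d"
  by (simp add: polys_below_def)

lemma sum_polys_below [simp]: "(\<And>i. i \<in> I \<Longrightarrow> f i \<in> polys_below s d) \<Longrightarrow> (\<Sum>i\<in>I. f i) \<in> polys_below s d"
  by (induction I rule: infinite_finite_induct) auto

lemma trunc_polys_below: "trunc s n f \<in> polys_below s (Suc n)"
  by (simp add: polys_below_def mps_nth_trunc)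

lemma trunc_ident: "f \<in> polys_below s n \<Longrightarrow> trunc s n f = f"
  by (rule mps_eqI) (auto simp: polys_below_def mps_nth_trunc)

lemma diff_hom_part_polys_below: "f \<in> polys_below s (Suc d) \<Longrightarrow> f - hom_part d f \<in> polys_below s d"
  by (auto simp: polys_below_def mps_nth_hom_part less_Suc_eq)

lemma forms_mult_polys_below:
  assumes "f \<in> forms s m" "g \<in> polys_below s n"
  shows "f * g \<in> polys_below s (m + n)" "g * f \<in> polys_below s (m + n)"
proof -
  show "f * g \<in> polys_below s (m + n)"
    unfolding polys_below_def
  proof (intro CollectI allI impI)
    fix \<gamma> assume "mps_nth (f * g) \<gamma> \<noteq> 0"
    then show "\<gamma> \<in> exponents s \<and> mdeg \<gamma> < m + n"
      by (rule mps_nth_mult_neq_0E) (use assms in \<open>auto simp: forms_def polys_below_def\<close>)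
  qed
  then show "g * f \<in> polys_below s (m + n)" by (simp add: mult.commute)
qed

lemma hom_part_mult_forms:
  assumes g: "g \<in> forms s n" and "n \<le> d"
  shows "hom_part d (f * g) = hom_part (d - n) f * g" "hom_part d (g * f) = g * hom_part (d - n) f"
proof -
  show "hom_part d (f * g) = hom_part (d - n) f * g"
  proof (rule mps_eqI)
    fix \<gamma>
    have "(if mdeg \<gamma> = d then mps_nth f \<alpha> * mps_nth g \<beta> else 0) = mps_nth (hom_part (d - n) f) \<alpha> * mps_nth g \<beta>"
      if "\<alpha> + \<beta> = \<gamma>" for \<alpha> \<beta>
    proof (cases "mps_nth g \<beta> = 0")
      case False
      with g have "mdeg \<beta> = n" by (auto simp: forms_def)
      then show ?thesis using that \<open>n \<le> d\<close> by (auto simp: mps_nth_hom_part)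
    qed simp
    then have "(\<Sum>(\<alpha>, \<beta>)\<in>decomps \<gamma>. if mdeg \<gamma> = d then mps_nth f \<alpha> * mps_nth g \<beta> else 0)
        = (\<Sum>(\<alpha>, \<beta>)\<in>decomps \<gamma>. mps_nth (hom_part (d - n) f) \<alpha> * mps_nth g \<beta>)"
      by (intro sum.cong) auto
    then show "mps_nth (hom_part d (f * g)) \<gamma> = mps_nth (hom_part (d - n) f * g) \<gamma>"
      by (auto simp: mps_nth_hom_part mps_nth_mult)
  qed
  then show "hom_part d (g * f) = g * hom_part (d - n) f" by (simp add: mult.commute)
qed

lemma deriv_forms: "f \<in> forms s n \<Longrightarrow> mps_deriv \<nu> f \<in> forms s (n - 1)"
  unfolding forms_def mem_Collect_eq mps_nth_deriv
  by (metis exponents_add_iff add_diff_cancel_right' mdeg_add mdeg_single mult_zero_right)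

lemma deriv_polys_below: "f \<in> polys_below s n \<Longrightarrow> mps_deriv \<nu> f \<in> polys_below s (n - 1)"
  unfolding polys_below_def mem_Collect_eq mps_nth_deriv
  by (metis exponents_add_iff less_diff_conv mdeg_add mdeg_single mult_zero_right)

lemma hom_part_inf_act:
  assumes B: "B \<in> mats (forms s n)" and n: "0 < n" "n \<le> d"
  shows "map_m2 (hom_part d) (inf_act s B (u, v, \<delta>))
    = inf_act s B (map_m2 (hom_part (d - n)) u, map_m2 (hom_part (d - n)) v, \<lambda>\<nu>. hom_part (d - n + 1) (\<delta> \<nu>))"
proof -
  have "hom_part d (f * mps_deriv \<nu> g) = hom_part (d - n + 1) f * mps_deriv \<nu> g"
    if "g \<in> forms s n" for f g :: "'a mps" and \<nu>
    using hom_part_mult_forms(1)[OF deriv_forms[OF that], of d f \<nu>] n by (simp add: Suc_diff_le)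
  then show ?thesis
    using B n by (simp add: inf_act_Pair m2_eq_iff mats_def hom_part.add hom_part.sum hom_part_mult_forms[of _ s n])
qed

lemma inf_act_polys_below:
  assumes A: "A \<in> mats (polys_below s n)" and n: "0 < n" "n \<le> d"
    and uv: "u \<in> mats (forms s (d - n))" "v \<in> mats (forms s (d - n))" and \<delta>: "\<And>\<nu>. \<delta> \<nu> \<in> forms s (d - n + 1)"
  shows "inf_act s A (u, v, \<delta>) \<in> mats (polys_below s d)"
proof -
  have mult: "f * g \<in> polys_below s d" "g * f \<in> polys_below s d"
    if "f \<in> forms s (d - n)" "g \<in> polys_below s n" for f g :: "'a mps"
    using forms_mult_polys_below[OF that] n by simp_all
  have "(\<Sum>\<nu><s. \<delta> \<nu> * mps_deriv \<nu> g) \<in> polys_below s d" if "g \<in> polys_below s n" for g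
    using forms_mult_polys_below(1)[OF \<delta> deriv_polys_below[OF that]] n by (intro sum_polys_below) simp
  then show ?thesis using A uv by (simp add: inf_act_Pair mats_def mult)
qed

lemma inf_act_add_left: "inf_act s (A + B) z = inf_act s A z + inf_act s B z"
proof -
  have "map_m2 (mps_deriv \<nu>) (A + B) = map_m2 (mps_deriv \<nu>) A + map_m2 (mps_deriv \<nu>) B" for \<nu>
    by (simp add: m2_eq_iff)
  then show ?thesis
    by (cases z) (simp add: inf_act_Pair distrib_left distrib_right smul.scale_right_distrib sum.distrib add_ac)
qed

lemma form_reduces_mod_tangent_module:
  fixes A B :: "'a::comm_ring_1 mps m2"
  assumes A: "A \<in> mats (polys_below s n)" and B: "B \<in> mats (forms s n)" and n: "0 < n" "n \<le> d"
    and D: "mats (mpow s d) \<subseteq> tangent_module s B" and h: "h \<in> mats (forms s d)"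
  shows "\<exists>r\<in>mats (polys_below s d). h - r \<in> tangent_module s (A + B)"
proof -
  have "h \<in> mats (mpow s d)" using h forms_mpow by (auto simp: mats_def)
  with D have "h \<in> tangent_module s B" ..
  then obtain u v \<delta> where "(u, v, \<delta>) \<in> displacements s 0" and h_eq: "h = inf_act s B (u, v, \<delta>)"
    by (elim tangent_moduleE) auto
  then have uv: "u \<in> mats (Pser s)" "v \<in> mats (Pser s)" and \<delta>: "\<And>\<nu>. \<delta> \<nu> \<in> Pser s"
    using Pser_of_mpow by (auto simp: displacements_iff)
  define z where "z = (map_m2 (hom_part (d - n)) u, map_m2 (hom_part (d - n)) v, \<lambda>\<nu>. hom_part (d - n + 1) (\<delta> \<nu>))"
  have "h = map_m2 (hom_part d) h" using map_m2_ident[OF h hom_part_ident] by simp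
  also have "\<dots> = inf_act s B z" unfolding h_eq z_def by (rule hom_part_inf_act[OF B n])
  finally have h_z: "h = inf_act s B z" .
  have "- inf_act s A z \<in> mats (polys_below s d)"
    using inf_act_polys_below[OF A n mats_map[OF uv(1)] mats_map[OF uv(2)], of "hom_part (d - n)" "hom_part (d - n)"] \<delta>
    by (simp add: z_def mats_def)
  moreover have "z \<in> displacements s 0"
    using uv \<delta> by (auto simp: z_def displacements_iff intro!: mats_map forms_mpow[OF hom_part_forms])
  then have "h - (- inf_act s A z) \<in> tangent_module s (A + B)"
    using tangent_moduleI[of z s "A + B"] by (simp add: h_z inf_act_add_left add.commute)
  ultimately show ?thesis by blast
qed

lemma (in submodule) poly_reduces_of_forms:
  assumes forms: "\<And>d h. D \<le> d \<Longrightarrow> h \<in> mats (forms s d) \<Longrightarrow> \<exists>r\<in>mats (polys_below s d). h - r \<in> N"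
    and C: "C \<in> mats (polys_below s e)"
  shows "\<exists>r\<in>mats (polys_below s D). C - r \<in> N"
  using C
proof (induction e arbitrary: C)
  case 0
  then have "C \<in> mats (polys_below s D)" by (auto simp: mats_def intro: polys_below_mono)
  then show ?case using zero by (intro bexI[of _ C]) simp_all
next
  case (Suc e)
  show ?case
  proof (cases "D \<le> e")
    case True
    define h where "h = map_m2 (hom_part e) C"
    have "h \<in> mats (forms s e)"
      unfolding h_def using Suc.prems by (rule mats_map) (simp add: polys_below_Pser)
    then obtain r where r: "r \<in> mats (polys_below s e)" "h - r \<in> N" using forms[OF True] by blast
    have "C - h + r \<in> mats (polys_below s e)"
      using Suc.prems r(1) by (simp add: h_def mats_def diff_hom_part_polys_below)
    then obtain r' where r': "r' \<in> mats (polys_below s D)" "C - h + r - r' \<in> N" using Suc.IH by blast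
    have "(C - h + r - r') + (h - r) \<in> N" using r'(2) r(2) by (rule add)
    then show ?thesis using r'(1) by (intro bexI[of _ r']) simp_all
  next
    case False
    then have "C \<in> mats (polys_below s D)"
      using Suc.prems polys_below_mono[of _ s "Suc e" D] by (auto simp: mats_def)
    then show ?thesis using zero by (intro bexI[of _ C]) simp_all
  qed
qed

lemma (in field_submodule) finite_colength_of_forms:
  assumes forms: "\<And>d h. D \<le> d \<Longrightarrow> h \<in> mats (forms s d) \<Longrightarrow> \<exists>r\<in>mats (polys_below s d). h - r \<in> N"
  shows "finite_colength s N"
proof (rule finite_colength_of_span[OF finite_monomial_mats])
  fix i j and E :: "'a mps m2" assume "i < s" and E: "E \<in> unit_mats"
  then have "mps_X i ^ j \<in> polys_below s (Suc j)"
    by (auto simp: mps_X_power polys_below_def mps_nth_monom split: if_splits)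
  then have "smul (mps_X i ^ j) E \<in> mats (polys_below s (Suc j))"
    using E by (auto simp: unit_mats_def mats_def)
  then obtain r where r: "r \<in> mats (polys_below s D)" "smul (mps_X i ^ j) E - r \<in> N"
    using poly_reduces_of_forms[OF forms] by blast
  have "map_m2 (trunc s D) r = r" using r(1) trunc_ident by (rule map_m2_ident)
  then show "\<exists>r\<in>mat_space.span (monomial_mats s D). smul (mps_X i ^ j) E - r \<in> N"
    using trunc_in_span_monomial_mats[of s D r] r(2) by auto
qed

lemma finite_colength_of_top_form:
  fixes A B :: "'a::field mps m2"
  assumes A: "A \<in> mats (polys_below s n)" and B: "B \<in> mats (forms s n)" and n: "0 < n"
    and colength: "finite_colength s (tangent_module s B)"
  shows "finite_colength s (tangent_module s (A + B))"
proof -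
  obtain D where D: "mats (mpow s D) \<subseteq> tangent_module s B"
    using colength unfolding finite_colength_def ..
  show ?thesis
  proof (rule tangent_module.finite_colength_of_forms)
    fix d and h :: "'a mps m2" assume d: "max D n \<le> d" and h: "h \<in> mats (forms s d)"
    have "mats (mpow s d) \<subseteq> tangent_module s B" using mats.antimono[of _ s d D] d D by auto
    then show "\<exists>r\<in>mats (polys_below s d). h - r \<in> tangent_module s (A + B)"
      using d by (intro form_reduces_mod_tangent_module[OF A B n _ _ h]) simp_all
  qed
qed

section \<open>Generic points of a twisted cubic\<close>

definition curve_mat :: "'r::comm_ring_1 \<Rightarrow> 'r m2" where
  "curve_mat a = M2 1 a (a ^ 3) (a\<^sup>2)"

text \<open>The discriminant of the binary form \<open>det (x M\<^sub>a + y M\<^sub>b)\<close> for the points \<open>M\<^sub>a = curve_mat a\<close> of the twisted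
  cubic, and up to sign the determinant of the matrix orthogonal to \<open>M\<^sub>a\<close>, \<open>M\<^sub>b\<close> and \<open>M\<^sub>c\<close>.
  They vanish for a degenerate tangency with the cone of singular matrices.\<close>

definition pencil_disc :: "'a::comm_ring_1 \<Rightarrow> 'a \<Rightarrow> 'a" where
  "pencil_disc a b = (a\<^sup>2 + b\<^sup>2 - a * b ^ 3 - a ^ 3 * b)\<^sup>2 - 4 * (a\<^sup>2 - a ^ 4) * (b\<^sup>2 - b ^ 4)"

definition net_disc :: "'a::comm_ring_1 \<Rightarrow> 'a \<Rightarrow> 'a \<Rightarrow> 'a" where
  "net_disc a b c = (a + b + c) * (a * b * c) - (a * b + a * c + b * c)"

definition generic_points :: "nat \<Rightarrow> (nat \<Rightarrow> 'a::field) \<Rightarrow> bool" where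
  "generic_points s t \<longleftrightarrow> (\<forall>i<s. t i \<noteq> 0 \<and> (t i)\<^sup>2 \<noteq> 1)
    \<and> (\<forall>i<s. \<forall>j<s. i \<noteq> j \<longrightarrow> t i \<noteq> t j \<and> pencil_disc (t i) (t j) \<noteq> 0)
    \<and> (\<forall>i<s. \<forall>j<s. \<forall>k<s. i \<noteq> j \<and> i \<noteq> k \<and> j \<noteq> k \<longrightarrow> net_disc (t i) (t j) (t k) \<noteq> 0)"

lemma pencil_disc_commute: "pencil_disc a b = pencil_disc b a"
  by (simp add: pencil_disc_def algebra_simps)

lemma net_disc_rotate: "net_disc a b c = net_disc b c a" "net_disc a b c = net_disc a c b"
  by (simp_all add: net_disc_def algebra_simps)

lemma finite_pencil_disc_eq_0:
  fixes a :: "'a::field"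
  assumes "a \<noteq> 0"
  shows "finite {x. pencil_disc a x = 0}"
proof -
  let ?p = "[:a\<^sup>2, - (a ^ 3), 1, - a:]\<^sup>2 - smult (4 * (a\<^sup>2 - a ^ 4)) [:0, 0, 1, 0, - 1:]"
  have poly_p: "poly ?p x = pencil_disc a x" for x
    by (simp add: pencil_disc_def algebra_simps power2_eq_square power3_eq_cube power4_eq_xxxx)
  have "poly ?p 0 \<noteq> 0" unfolding poly_p using assms by (simp add: pencil_disc_def)
  then have "?p \<noteq> 0" by (metis poly_0)
  then show ?thesis using poly_roots_finite[of ?p] unfolding poly_p by simp
qed

lemma finite_net_disc_eq_0:
  fixes a b :: "'a::field"
  assumes "a \<noteq> 0" "b \<noteq> 0"
  shows "finite {x. net_disc a b x = 0}"
proof -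
  let ?p = "[:- (a * b), (a + b) * (a * b) - (a + b), a * b:]"
  have poly_p: "poly ?p x = net_disc a b x" for x
    by (simp add: net_disc_def algebra_simps)
  have "?p \<noteq> 0" using assms by simp
  then show ?thesis using poly_roots_finite[of ?p] unfolding poly_p by simp
qed

lemma ex_generic_points:
  assumes "infinite (UNIV :: 'a::field set)"
  shows "\<exists>t :: nat \<Rightarrow> 'a. generic_points s t"
proof (induction s)
  case 0
  then show ?case by (simp add: generic_points_def)
next
  case (Suc s)
  then obtain t :: "nat \<Rightarrow> 'a" where t: "generic_points s t" by blast
  define F where "F = {0, 1, - 1} \<union> t ` {..<s} \<union> (\<Union>i<s. {x. pencil_disc (t i) x = 0})
    \<union> (\<Union>i<s. \<Union>j<s. {x. net_disc (t i) (t j) x = 0})"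
  have nonzero: "t i \<noteq> 0" if "i < s" for i using t that by (simp add: generic_points_def)
  have "finite F"
    unfolding F_def
    by (intro finite_UnI finite_UN_I finite_pencil_disc_eq_0 finite_net_disc_eq_0 nonzero) auto
  then obtain x where x: "x \<notin> F" using assms ex_new_if_finite by blast
  then have "x \<noteq> 0" "x\<^sup>2 \<noteq> 1" "\<And>i. i < s \<Longrightarrow> t i \<noteq> x"
    and pencil: "\<And>i. i < s \<Longrightarrow> pencil_disc (t i) x \<noteq> 0"
    and net: "\<And>i j. i < s \<Longrightarrow> j < s \<Longrightarrow> net_disc (t i) (t j) x \<noteq> 0"
    by (auto simp: F_def power2_eq_1_iff)
  moreover have "pencil_disc x (t i) \<noteq> 0" if "i < s" for i
    using pencil[OF that] by (simp add: pencil_disc_commute)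
  moreover have "net_disc (t i) x (t j) \<noteq> 0" "net_disc x (t i) (t j) \<noteq> 0" if "i < s" "j < s" for i j
    using net[OF that] net_disc_rotate by metis+
  ultimately have "generic_points (Suc s) (t(s := x))"
    using t unfolding generic_points_def by (auto simp: less_Suc_eq)
  then show ?case by blast
qed

section \<open>Annihilators modulo a submodule\<close>

definition (in submodule) annihilates :: "'a mps \<Rightarrow> bool" where
  "annihilates r \<longleftrightarrow> (\<forall>X\<in>mats (Pser s). smul r X \<in> N)"

lemma (in submodule) annihilatesD: "annihilates r \<Longrightarrow> X \<in> mats (Pser s) \<Longrightarrow> smul r X \<in> N"
  by (simp add: annihilates_def)

text \<open>By divided differences along the cubic; the entries are the elementary symmetric functions of a, b, c.\<close>

lemma (in field_submodule) three_curve_mats: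
  fixes a b c :: 'a
  assumes neq: "a \<noteq> b" "a \<noteq> c" "b \<noteq> c"
    and mem: "\<And>x. x \<in> {a, b, c} \<Longrightarrow> smul w (curve_mat (mps_const x)) \<in> N"
  shows "smul w (M2 0 0 (mps_const (a + b + c)) 1) \<in> N"
    and "smul w (M2 0 1 (- mps_const (a * b + a * c + b * c)) 0) \<in> N"
    and "smul w (M2 1 0 (mps_const (a * b * c)) 0) \<in> N"
proof -
  let ?D = "\<lambda>x. smul w (M2 0 1 (mps_const (a\<^sup>2 + a * x + x\<^sup>2)) (mps_const (a + x)))"
  have D: "?D x \<in> N" if "a \<noteq> x" "x \<in> {b, c}" for x
  proof (rule cancel_const)
    have "smul (mps_const (a - x)) (?D x) = smul w (curve_mat (mps_const a)) - smul w (curve_mat (mps_const x))"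
      by (simp add: m2_eq_iff mps_const_hom curve_mat_def power2_eq_square power3_eq_cube algebra_simps)
    then show "smul (mps_const (a - x)) (?D x) \<in> N" using diff mem that(2) by simp
  qed (use that(1) in simp)
  show e1: "smul w (M2 0 0 (mps_const (a + b + c)) 1) \<in> N"
  proof (rule cancel_const)
    have "smul (mps_const (b - c)) (smul w (M2 0 0 (mps_const (a + b + c)) 1)) = ?D b - ?D c"
      by (simp add: m2_eq_iff mps_const_hom power2_eq_square algebra_simps)
    then show "smul (mps_const (b - c)) (smul w (M2 0 0 (mps_const (a + b + c)) 1)) \<in> N"
      using diff D neq by simp
  qed (use neq in simp)
  have "smul w (M2 0 1 (- mps_const (a * b + a * c + b * c)) 0)
    = ?D b - smul (mps_const (a + b)) (smul w (M2 0 0 (mps_const (a + b + c)) 1))"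
    by (simp add: m2_eq_iff mps_const_hom power2_eq_square algebra_simps)
  also have "\<dots> \<in> N" using neq by (intro diff D smul[OF _ e1]) simp_all
  finally show e2: "smul w (M2 0 1 (- mps_const (a * b + a * c + b * c)) 0) \<in> N" .
  have "smul w (M2 1 0 (mps_const (a * b * c)) 0) = smul w (curve_mat (mps_const a))
      - smul (mps_const a) (smul w (M2 0 1 (- mps_const (a * b + a * c + b * c)) 0))
      - smul (mps_const (a\<^sup>2)) (smul w (M2 0 0 (mps_const (a + b + c)) 1))"
    by (simp add: m2_eq_iff mps_const_hom curve_mat_def power2_eq_square power3_eq_cube algebra_simps)
  also have "\<dots> \<in> N" by (intro diff mem smul[OF _ e1] smul[OF _ e2]) simp_all
  finally show "smul w (M2 1 0 (mps_const (a * b * c)) 0) \<in> N" .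
qed

lemma (in field_submodule) annihilates_of_corner:
  fixes a b c :: 'a
  assumes w: "w \<in> Pser s" and neq: "a \<noteq> b" "a \<noteq> c" "b \<noteq> c"
    and mem: "\<And>x. x \<in> {a, b, c} \<Longrightarrow> smul w (curve_mat (mps_const x)) \<in> N"
    and corner: "smul w (M2 0 0 1 0) \<in> N"
  shows "annihilates w"
  unfolding annihilates_def
proof (rule ballI, rule smul_mats_mem[OF w])
  fix E :: "'a mps m2" assume E: "E \<in> unit_mats"
  note basis = three_curve_mats[OF neq mem]
  have corner_mult: "smul r (smul w (M2 0 0 1 0)) \<in> N" if "r \<in> Pser s" for r
    using that corner by (rule smul)
  have "smul w (M2 0 0 0 1) \<in> N"
    using diff[OF basis(1) corner_mult[of "mps_const (a + b + c)"]]
    by (simp add: smul_def minus_m2_def mult.commute)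
  moreover have "smul w (M2 0 1 0 0) \<in> N"
    using diff[OF basis(2) corner_mult[of "- mps_const (a * b + a * c + b * c)"]]
    by (simp add: smul_def minus_m2_def mult.commute)
  moreover have "smul w (M2 1 0 0 0) \<in> N"
    using diff[OF basis(3) corner_mult[of "mps_const (a * b * c)"]]
    by (simp add: smul_def minus_m2_def mult.commute)
  ultimately show "smul w E \<in> N" using E corner by (auto simp: unit_mats_def)
qed

lemma (in field_submodule) annihilates_of_four_curve_mats:
  fixes a b c d :: 'a
  assumes w: "w \<in> Pser s" and neq: "a \<noteq> b" "a \<noteq> c" "b \<noteq> c" "d \<noteq> a" "d \<noteq> b" "d \<noteq> c"
    and mem: "\<And>x. x \<in> {a, b, c, d} \<Longrightarrow> smul w (curve_mat (mps_const x)) \<in> N"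
  shows "annihilates w"
proof -
  note basis = three_curve_mats[OF neq(1-3) mem]
  have "smul (mps_const ((d - a) * (d - b) * (d - c))) (smul w (M2 0 0 1 0))
    = smul w (curve_mat (mps_const d)) - smul w (M2 1 0 (mps_const (a * b * c)) 0)
      - smul (mps_const d) (smul w (M2 0 1 (- mps_const (a * b + a * c + b * c)) 0))
      - smul (mps_const (d\<^sup>2)) (smul w (M2 0 0 (mps_const (a + b + c)) 1))"
    by (simp add: m2_eq_iff mps_const_hom curve_mat_def power2_eq_square power3_eq_cube algebra_simps)
  also have "\<dots> \<in> N" by (intro diff mem basis(3) smul[OF _ basis(1)] smul[OF _ basis(2)]) auto
  finally have "smul w (M2 0 0 1 0) \<in> N" by (rule cancel_const) (use neq in simp)
  then show ?thesis using mem by (intro annihilates_of_corner[OF w neq(1-3)]) auto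
qed

lemma (in field_submodule) corner_of_columns:
  fixes a b c :: 'a
  assumes neq: "a \<noteq> b" "a \<noteq> c" "b \<noteq> c" and net: "net_disc a b c \<noteq> 0"
    and mem: "\<And>x. x \<in> {a, b, c} \<Longrightarrow> smul w (curve_mat (mps_const x)) \<in> N"
    and pq: "p \<in> Pser s" "q \<in> Pser s" and columns: "smul w (M2 p 0 q 0) \<in> N" "smul w (M2 0 p 0 q) \<in> N"
  shows "smul (w * p) (M2 0 0 1 0) \<in> N" "smul (w * q) (M2 0 0 1 0) \<in> N"
proof -
  let ?E = "M2 0 0 1 0 :: 'a mps m2"
  let ?e1 = "mps_const (a + b + c)" and ?e2 = "mps_const (a * b + a * c + b * c)" and ?e3 = "mps_const (a * b * c)"
  note basis = three_curve_mats[OF neq mem]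
  have "smul (w * (q - ?e3 * p)) ?E = smul w (M2 p 0 q 0) - smul p (smul w (M2 1 0 ?e3 0))"
    by (simp add: m2_eq_iff algebra_simps)
  also have "\<dots> \<in> N" by (intro diff columns smul pq basis)
  finally have left: "smul (w * (q - ?e3 * p)) ?E \<in> N" .
  have "smul (w * (?e2 * p - ?e1 * q)) ?E
    = smul w (M2 0 p 0 q) - smul p (smul w (M2 0 1 (- ?e2) 0)) - smul q (smul w (M2 0 0 ?e1 1))"
    by (simp add: m2_eq_iff algebra_simps)
  also have "\<dots> \<in> N" by (intro diff columns smul pq basis)
  finally have right: "smul (w * (?e2 * p - ?e1 * q)) ?E \<in> N" .
  have "smul (mps_const (net_disc a b c)) (smul (w * p) ?E)
    = - (smul ?e1 (smul (w * (q - ?e3 * p)) ?E) + smul (w * (?e2 * p - ?e1 * q)) ?E)"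
    by (simp add: m2_eq_iff net_disc_def mps_const_hom algebra_simps)
  also have "\<dots> \<in> N" by (intro uminus add smul[OF _ left] right) simp
  finally show p: "smul (w * p) ?E \<in> N" using net by (rule cancel_const)
  have "smul (w * q) ?E = smul (w * (q - ?e3 * p)) ?E + smul ?e3 (smul (w * p) ?E)"
    by (simp add: m2_eq_iff algebra_simps)
  also have "\<dots> \<in> N" by (intro add left smul[OF _ p]) simp
  finally show "smul (w * q) ?E \<in> N" .
qed

lemma (in field_submodule) corner_of_right_multiples:
  fixes a b c :: 'a
  assumes neq: "a \<noteq> b" "a \<noteq> c" "b \<noteq> c" and net: "net_disc a b c \<noteq> 0"
    and mem: "\<And>x. x \<in> {a, b, c} \<Longrightarrow> smul w (curve_mat (mps_const x)) \<in> N"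
    and B: "B \<in> mats (Pser s)" and right: "\<And>X. X \<in> mats (Pser s) \<Longrightarrow> smul w (B * X) \<in> N"
  shows "smul (w * e00 B) (M2 0 0 1 0) \<in> N" "smul (w * e01 B) (M2 0 0 1 0) \<in> N" "smul (w * e11 B) (M2 0 0 1 0) \<in> N"
proof -
  have "B * M2 1 0 0 0 = M2 (e00 B) 0 (e10 B) 0" "B * M2 0 1 0 0 = M2 0 (e00 B) 0 (e10 B)"
    "B * M2 0 0 1 0 = M2 (e01 B) 0 (e11 B) 0" "B * M2 0 0 0 1 = M2 0 (e01 B) 0 (e11 B)"
    by (simp_all add: m2_eq_iff)
  moreover have "smul w (B * E) \<in> N" if "E \<in> unit_mats" for E
    using right unit_mats_Pser that by blast
  ultimately have columns: "smul w (M2 (e00 B) 0 (e10 B) 0) \<in> N" "smul w (M2 0 (e00 B) 0 (e10 B)) \<in> N"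
    "smul w (M2 (e01 B) 0 (e11 B) 0) \<in> N" "smul w (M2 0 (e01 B) 0 (e11 B)) \<in> N"
    by (metis insertCI unit_mats_def)+
  have "e00 B \<in> Pser s" "e01 B \<in> Pser s" "e10 B \<in> Pser s" "e11 B \<in> Pser s" using B by (simp_all add: mats_def)
  with columns show "smul (w * e00 B) (M2 0 0 1 0) \<in> N"
    "smul (w * e01 B) (M2 0 0 1 0) \<in> N" "smul (w * e11 B) (M2 0 0 1 0) \<in> N"
    using corner_of_columns[OF neq net mem] by blast+
qed

lemma double_commutator:
  fixes Z S :: "'r::comm_ring_1 m2"
  shows "smul ((trace S)\<^sup>2 - 4 * det S) Z
    = (Z * S - S * Z) * S - S * (Z * S - S * Z)
      - smul (trace S * trace Z - 2 * trace (Z * S)) S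
      - smul (trace S * (trace (Z * S) - trace Z * trace S) + 2 * det S * trace Z) 1"
  by (simp add: m2_eq_iff trace_def det_def power2_eq_square algebra_simps)

text \<open>With \<open>S = P\<^sup>-\<^sup>1 Q\<close> up to a scalar, the submodule contains \<open>q P [Z, S]\<close> for all Z, \<open>q P\<close> and \<open>q P S\<close>, which
  generate \<open>q M\<^sub>2\<^sub>,\<^sub>2\<close> if the discriminant of S is invertible.\<close>

context submodule
begin

lemma commutator_mem:
  assumes P: "P \<in> mats (Pser s)" and Z: "Z \<in> mats (Pser s)"
    and left: "\<And>X. X \<in> mats (Pser s) \<Longrightarrow> smul w (X * (smul p P + smul q Q)) \<in> N"
    and right: "\<And>X. X \<in> mats (Pser s) \<Longrightarrow> smul w ((smul p P + smul q Q) * X) \<in> N"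
  defines "S \<equiv> adjugate P * Q"
  shows "smul (w * q) (P * (Z * S - S * Z)) \<in> N"
proof -
  have PS: "P * S = smul (det P) Q" by (simp add: S_def mult_adjugate flip: mult.assoc)
  have "smul w ((P * Z * adjugate P) * (smul p P + smul q Q)) \<in> N"
    using P Z by (intro left) simp
  also have "smul w ((P * Z * adjugate P) * (smul p P + smul q Q))
    = smul (w * p * det P) (P * Z) + smul (w * q) (P * Z * S)"
    by (simp add: distrib_left smul.scale_right_distrib mult.assoc adjugate_mult S_def)
  finally have ZS: "smul (w * p * det P) (P * Z) + smul (w * q) (P * Z * S) \<in> N" .
  have "smul (det P) (smul w ((smul p P + smul q Q) * Z)) \<in> N"
    using P Z by (intro smul right) simp_all
  also have "smul (det P) (smul w ((smul p P + smul q Q) * Z))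
    = smul (w * p * det P) (P * Z) + smul (w * q) (P * S * Z)"
    by (simp add: distrib_right smul.scale_right_distrib PS mult_ac)
  finally have SZ: "smul (w * p * det P) (P * Z) + smul (w * q) (P * S * Z) \<in> N" .
  from diff[OF ZS SZ] show ?thesis
    by (simp add: right_diff_distrib smul.scale_right_diff_distrib mult.assoc)
qed

lemma annihilates_of_commutators:
  assumes P: "P \<in> mats (Pser s)" and S: "S \<in> mats (Pser s)"
    and scalars: "smul r P \<in> N" "smul r (P * S) \<in> N"
    and commutator: "\<And>Z. Z \<in> mats (Pser s) \<Longrightarrow> smul r (P * (Z * S - S * Z)) \<in> N"
  shows "annihilates (((trace S)\<^sup>2 - 4 * det S) * (det P * r))"
  unfolding annihilates_def
proof
  fix X :: "'a mps m2" assume X: "X \<in> mats (Pser s)"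
  define Z where "Z = adjugate P * X"
  have Z: "Z \<in> mats (Pser s)" using P X by (simp add: Z_def)
  define \<sigma> \<mu> where "\<sigma> = trace S * trace Z - 2 * trace (Z * S)"
    and "\<mu> = trace S * (trace (Z * S) - trace Z * trace S) + 2 * det S * trace Z"
  have two: "(2 :: 'a mps) \<in> Pser s" by (simp flip: mps_const_numeral)
  have "smul (((trace S)\<^sup>2 - 4 * det S) * (det P * r)) X = smul r (P * smul ((trace S)\<^sup>2 - 4 * det S) Z)"
    by (simp add: Z_def mult_adjugate mult_ac flip: mult.assoc[of _ "adjugate _"])
  also have "\<dots> = smul r (P * ((Z * S - S * Z) * S - S * (Z * S - S * Z)))
      - smul \<sigma> (smul r (P * S)) - smul \<mu> (smul r P)"
    unfolding double_commutator \<sigma>_def[symmetric] \<mu>_def[symmetric]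
    by (simp add: right_diff_distrib smul.scale_right_diff_distrib mult_ac)
  also have "\<dots> \<in> N"
    using S Z two by (intro diff commutator smul scalars) (simp_all add: \<sigma>_def \<mu>_def)
  finally show "smul (((trace S)\<^sup>2 - 4 * det S) * (det P * r)) X \<in> N" .
qed

end

section \<open>A homogeneous matrix of finite colength\<close>

definition curve_comb :: "nat set \<Rightarrow> (nat \<Rightarrow> 'a mps) \<Rightarrow> (nat \<Rightarrow> 'a) \<Rightarrow> 'a::comm_ring_1 mps m2" where
  "curve_comb I y t = (\<Sum>i\<in>I. smul (y i) (curve_mat (mps_const (t i))))"

locale generic_curve_comb = field_submodule s N for s and N :: "'a::field mps m2 set" +
  fixes y :: "nat \<Rightarrow> 'a mps" and t :: "nat \<Rightarrow> 'a"
  assumes y: "i < s \<Longrightarrow> y i \<in> Pser s" and generic: "generic_points s t"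
    and summand: "i < s \<Longrightarrow> smul (y i) (curve_mat (mps_const (t i))) \<in> N"
    and left: "X \<in> mats (Pser s) \<Longrightarrow> X * curve_comb {..<s} y t \<in> N"
    and right: "X \<in> mats (Pser s) \<Longrightarrow> curve_comb {..<s} y t * X \<in> N"
begin

abbreviation "M i \<equiv> curve_mat (mps_const (t i))"

lemma M_Pser [simp]: "M i \<in> mats (Pser s)"
  by (simp add: curve_mat_def mats_def)

lemma summand_mult: "i < s \<Longrightarrow> r \<in> Pser s \<Longrightarrow> smul (r * y i) (M i) \<in> N"
  using smul[OF _ summand, of r i] by simp

lemma annihilates_cancel_const: "annihilates (mps_const c * r) \<Longrightarrow> c \<noteq> 0 \<Longrightarrow> annihilates r"
  unfolding annihilates_def by (metis cancel_const smul.scale_scale)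

lemma annihilates_cancel_det:
  assumes "i < s" "annihilates (det (M i) * r)"
  shows "annihilates r"
proof -
  have "det (M i) = mps_const ((t i)\<^sup>2 * (1 - (t i)\<^sup>2))"
    by (simp add: det_def curve_mat_def mps_const_hom power_numeral_reduce algebra_simps)
  moreover have "(t i)\<^sup>2 * (1 - (t i)\<^sup>2) \<noteq> 0" using generic assms(1) by (simp add: generic_points_def)
  ultimately show ?thesis using assms(2) annihilates_cancel_const by simp
qed

lemma curve_comb_restrict:
  assumes I: "I \<subseteq> {..<s}" and w: "w \<in> Pser s" and outside: "\<And>l. l < s \<Longrightarrow> l \<notin> I \<Longrightarrow> annihilates (w * y l)"
    and X: "X \<in> mats (Pser s)"
  shows "smul w (curve_comb I y t * X) \<in> N" "smul w (X * curve_comb I y t) \<in> N"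
proof -
  have comb: "curve_comb I y t = curve_comb {..<s} y t - curve_comb ({..<s} - I) y t"
    unfolding curve_comb_def by (subst sum_diff[OF _ I]) simp_all
  have "(\<Sum>l\<in>{..<s} - I. smul (w * y l) (M l * X)) \<in> N" "(\<Sum>l\<in>{..<s} - I. smul (w * y l) (X * M l)) \<in> N"
    using X by (auto intro!: sum annihilatesD outside)
  then have "smul w (curve_comb ({..<s} - I) y t * X) \<in> N" "smul w (X * curve_comb ({..<s} - I) y t) \<in> N"
    by (simp_all add: curve_comb_def sum_distrib_left sum_distrib_right smul.scale_sum_right)
  then show "smul w (curve_comb I y t * X) \<in> N" "smul w (X * curve_comb I y t) \<in> N"
    unfolding comb left_diff_distrib right_diff_distrib smul.scale_right_diff_distrib
    using X by (auto intro!: diff smul[OF w] left right)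
qed

text \<open>Geometrically, these lemmas cover the points with at least four, exactly three, two and one nonzero \<open>y\<^sub>i\<close>.\<close>

lemma annihilates_four:
  assumes "i < s" "j < s" "k < s" "l < s" "distinct [i, j, k, l]"
  shows "annihilates (y i * y j * y k * y l)"
proof (rule annihilates_of_four_curve_mats)
  fix x assume "x \<in> {t i, t j, t k, t l}"
  then show "smul (y i * y j * y k * y l) (curve_mat (mps_const x)) \<in> N"
    using summand_mult[OF assms(1), of "y j * y k * y l"] summand_mult[OF assms(2), of "y i * y k * y l"]
      summand_mult[OF assms(3), of "y i * y j * y l"] summand_mult[OF assms(4), of "y i * y j * y k"] y assms
    by (auto simp: mult_ac)
qed (use generic y assms in \<open>auto simp: generic_points_def\<close>)

lemma annihilates_three:
  assumes ijk: "i < s" "j < s" "k < s" and distinct: "distinct [i, j, k]"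
  shows "annihilates (y i * y j * y k * y i)"
proof -
  let ?w = "y i * y j * y k" and ?E = "M2 0 0 1 0 :: 'a mps m2"
  have w: "?w \<in> Pser s" using y ijk by simp
  have neq: "t i \<noteq> t j" "t i \<noteq> t k" "t j \<noteq> t k" and net: "net_disc (t i) (t j) (t k) \<noteq> 0"
    using generic ijk distinct by (auto simp: generic_points_def)
  have mem: "smul ?w (curve_mat (mps_const x)) \<in> N" if "x \<in> {t i, t j, t k}" for x
    using that summand_mult[OF ijk(1), of "y j * y k"] summand_mult[OF ijk(2), of "y i * y k"]
      summand_mult[OF ijk(3), of "y i * y j"] y ijk
    by (auto simp: mult_ac)
  define B where "B = curve_comb {i, j, k} y t"
  have B: "B \<in> mats (Pser s)" unfolding B_def curve_comb_def using y ijk by (intro mats.sum) auto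
  have right_B: "smul ?w (B * X) \<in> N" if "X \<in> mats (Pser s)" for X
    unfolding B_def using ijk distinct by (intro curve_comb_restrict(1) w that annihilates_four) auto
  note corner = corner_of_right_multiples[OF neq net mem B right_B]
  have "smul (mps_const ((t i - t j) * (t i - t k))) (smul (?w * y i) ?E)
    = smul (mps_const (t j * t k)) (smul (?w * e00 B) ?E) - smul (mps_const (t j + t k)) (smul (?w * e01 B) ?E)
      + smul (?w * e11 B) ?E"
    using distinct
    by (simp add: B_def curve_comb_def curve_mat_def m2_eq_iff mps_const_hom power2_eq_square algebra_simps)
  also have "\<dots> \<in> N" by (intro add diff corner(3) smul[OF _ corner(1)] smul[OF _ corner(2)]) simp_all
  finally have "smul (?w * y i) ?E \<in> N" by (rule cancel_const) (use neq in simp)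
  moreover have "smul (?w * y i) (curve_mat (mps_const x)) \<in> N" if "x \<in> {t i, t j, t k}" for x
    using smul[OF y[OF ijk(1)] mem[OF that]] by (simp add: mult_ac)
  ultimately show ?thesis using w y ijk by (intro annihilates_of_corner[OF _ neq]) simp_all
qed

lemma annihilates_two:
  assumes ij: "i < s" "j < s" and "i \<noteq> j"
  shows "annihilates (y i ^ 3 * y j)"
proof -
  let ?w = "y i * y i * y j"
  define S where "S = adjugate (M i) * M j"
  have w: "?w \<in> Pser s" using y ij by simp
  have S: "S \<in> mats (Pser s)" by (simp add: S_def)
  have MS: "M i * S = smul (det (M i)) (M j)"
    by (simp add: S_def mult_adjugate flip: mult.assoc)
  have outside: "annihilates (?w * y l)" if "l < s" "l \<notin> {i, j}" for l
    using annihilates_three[of i j l] assms that by (simp add: mult_ac)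
  have comb: "smul ?w ((smul (y i) (M i) + smul (y j) (M j)) * X) \<in> N"
    "smul ?w (X * (smul (y i) (M i) + smul (y j) (M j))) \<in> N" if "X \<in> mats (Pser s)" for X
    using curve_comb_restrict[of "{i, j}", OF _ w outside that] assms by (simp_all add: curve_comb_def)
  have "annihilates (((trace S)\<^sup>2 - 4 * det S) * (det (M i) * (?w * y j)))"
  proof (rule annihilates_of_commutators[OF M_Pser S])
    show "smul (?w * y j) (M i) \<in> N" "smul (?w * y j) (M i * S) \<in> N"
      using summand_mult[OF ij(1), of "y i * y j * y j"] summand_mult[OF ij(2), of "?w * det (M i)"] y ij
      by (simp_all add: mult_ac MS)
    show "smul (?w * y j) (M i * (Z * S - S * Z)) \<in> N" if "Z \<in> mats (Pser s)" for Z
      unfolding S_def by (rule commutator_mem[OF M_Pser that comb(2,1)])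
  qed
  moreover have "(trace S)\<^sup>2 - 4 * det S = mps_const (pencil_disc (t i) (t j))"
    by (simp add: S_def trace_def det_def adjugate_def curve_mat_def pencil_disc_def mps_const_hom
        power_numeral_reduce algebra_simps)
  moreover have "pencil_disc (t i) (t j) \<noteq> 0" using generic assms by (simp add: generic_points_def)
  ultimately have "annihilates (det (M i) * (?w * y j))" using annihilates_cancel_const by metis
  then have wj: "annihilates (?w * y j)" by (rule annihilates_cancel_det[OF ij(1)])
  show ?thesis
  proof (rule annihilates_cancel_det[OF ij(1)], unfold annihilates_def, rule ballI)
    fix X :: "'a mps m2" assume X: "X \<in> mats (Pser s)"
    have "smul (det (M i) * (y i ^ 3 * y j)) X
      = smul ?w ((X * adjugate (M i)) * (smul (y i) (M i) + smul (y j) (M j))) - smul (?w * y j) (X * S)"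
      by (simp add: distrib_left smul.scale_right_distrib mult.assoc adjugate_mult S_def power3_eq_cube mult_ac)
    also have "\<dots> \<in> N" using X S by (intro diff comb annihilatesD[OF wj]) simp_all
    finally show "smul (det (M i) * (y i ^ 3 * y j)) X \<in> N" .
  qed
qed

lemma annihilates_one:
  assumes i: "i < s"
  shows "annihilates (y i ^ 4)"
proof (rule annihilates_cancel_det[OF i], unfold annihilates_def, rule ballI)
  fix X :: "'a mps m2" assume X: "X \<in> mats (Pser s)"
  have "smul (y i ^ 3) (curve_comb {i} y t * (adjugate (M i) * X)) \<in> N"
    by (rule curve_comb_restrict) (use i X y annihilates_two in auto)
  also have "smul (y i ^ 3) (curve_comb {i} y t * (adjugate (M i) * X)) = smul (det (M i) * y i ^ 4) X"
    by (simp add: curve_comb_def mult_adjugate power_numeral_reduce mult_ac flip: mult.assoc[of _ "adjugate _"])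
  finally show "smul (det (M i) * y i ^ 4) X \<in> N" .
qed

end

definition fermat_mat :: "nat \<Rightarrow> nat \<Rightarrow> (nat \<Rightarrow> 'a) \<Rightarrow> 'a::comm_ring_1 mps m2" where
  "fermat_mat s n t = curve_comb {..<s} (\<lambda>i. mps_X i ^ n) t"

lemma fermat_mat_sel:
  "e00 (fermat_mat s n t) = (\<Sum>i<s. mps_X i ^ n * mps_const 1)"
  "e01 (fermat_mat s n t) = (\<Sum>i<s. mps_X i ^ n * mps_const (t i))"
  "e10 (fermat_mat s n t) = (\<Sum>i<s. mps_X i ^ n * mps_const (t i ^ 3))"
  "e11 (fermat_mat s n t) = (\<Sum>i<s. mps_X i ^ n * mps_const ((t i)\<^sup>2))"
  by (simp_all add: fermat_mat_def curve_comb_def curve_mat_def mps_const_power)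

lemma fermat_mat_forms: "fermat_mat s n t \<in> mats (forms s n)"
proof -
  have "(\<Sum>i<s. mps_X i ^ n * mps_const (c i)) \<in> forms s n" for c :: "nat \<Rightarrow> 'a"
    by (auto simp: forms_def mps_X_power mps_monom_mult mps_nth_monom
        elim!: sum.not_neutral_contains_not_neutral split: if_splits)
  from this[of "\<lambda>_. 1"] this[of t] this[of "\<lambda>i. t i ^ 3"] this[of "\<lambda>i. (t i)\<^sup>2"] show ?thesis
    by (simp add: mats_def fermat_mat_sel)
qed

lemma X_smul_deriv_fermat_mat:
  assumes i: "i < s" and n: "0 < n"
  shows "smul (mps_X i) (map_m2 (mps_deriv i) (fermat_mat s n t)) =
    smul (of_nat n * mps_X i ^ n) (curve_mat (mps_const (t i)))"
proof -
  have "mps_X i * mps_deriv i (\<Sum>l<s. mps_X l ^ n * mps_const (c l)) = of_nat n * mps_X i ^ n * mps_const (c i)"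
    for c :: "nat \<Rightarrow> 'a"
  proof -
    have "mps_X i * mps_deriv i (\<Sum>l<s. mps_X l ^ n * mps_const (c l))
      = mps_X i * (\<Sum>l<s. if l = i then of_nat n * mps_X i ^ (n - 1) * mps_const (c i) else 0)"
      unfolding mps_deriv.sum
      by (intro arg_cong[of _ _ "(*) _"] sum.cong) (auto simp: mps_deriv_mult mps_deriv_power mps_deriv_X)
    also have "\<dots> = of_nat n * (mps_X i ^ (n - 1) * mps_X i) * mps_const (c i)"
      using i by (simp add: mult_ac)
    finally show ?thesis using n by (simp only: power_minus_mult)
  qed
  from this[of "\<lambda>_. 1"] this[of t] this[of "\<lambda>i. t i ^ 3"] this[of "\<lambda>i. (t i)\<^sup>2"] show ?thesis
    by (simp add: m2_eq_iff fermat_mat_sel curve_mat_def mps_const_power)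
qed

lemma finite_colength_fermat_mat:
  fixes t :: "nat \<Rightarrow> 'a::field"
  assumes generic: "generic_points s t" and n: "0 < n" "(of_nat n :: 'a) \<noteq> 0"
  shows "finite_colength s (tangent_module s (fermat_mat s n t))"
proof -
  let ?T = "tangent_module s (fermat_mat s n t)"
  interpret generic_curve_comb s ?T "\<lambda>i. mps_X i ^ n" t
  proof
    fix i assume i: "i < s"
    have "smul (mps_X i) (map_m2 (mps_deriv i) (fermat_mat s n t)) \<in> ?T"
      using i by (intro tangent_module_deriv) simp_all
    then have "smul (mps_const (of_nat n)) (smul (mps_X i ^ n) (curve_mat (mps_const (t i)))) \<in> ?T"
      unfolding X_smul_deriv_fermat_mat[OF i n(1)] by (simp add: mps_const_of_nat)
    then show "smul (mps_X i ^ n) (curve_mat (mps_const (t i))) \<in> ?T"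
      using n(2) by (rule tangent_module.cancel_const)
  qed (use generic tangent_module_mult in \<open>simp_all flip: fermat_mat_def\<close>)
  show ?thesis
  proof (rule tangent_module.finite_colength_of_X_powers)
    fix i and E :: "'a mps m2" assume i: "i < s" and "E \<in> unit_mats"
    then have "smul ((mps_X i ^ n) ^ 4) E \<in> ?T"
      using tangent_module.annihilatesD[OF annihilates_one[OF i]] unit_mats_Pser by blast
    then show "\<exists>a. smul (mps_X i ^ a) E \<in> ?T" by (metis power_mult)
  qed
qed

lemma ex_nonzero_of_nat_gt: "\<exists>n>k. (of_nat n :: 'a::ring_1) \<noteq> 0"
proof (cases "(of_nat (Suc k) :: 'a) = 0")
  case True
  then have "(of_nat (Suc (Suc k)) :: 'a) = 1" by simp
  then show ?thesis by (metis less_Suc_eq lessI zero_neq_one)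
qed blast

lemma ex_finite_colength_perturbation:
  fixes A :: "'a::field mps m2"
  assumes infinite: "infinite (UNIV :: 'a set)" and A: "A \<in> mats (Pser s)"
  shows "\<exists>B. B - A \<in> mats (mpow s (Suc k)) \<and> finite_colength s (tangent_module s B)"
proof -
  obtain t :: "nat \<Rightarrow> 'a" where t: "generic_points s t" using ex_generic_points[OF infinite] by blast
  obtain n where n: "k < n" "(of_nat n :: 'a) \<noteq> 0" using ex_nonzero_of_nat_gt by blast
  define A' where "A' = map_m2 (trunc s k) A"
  have "A' \<in> mats (polys_below s n)"
    unfolding A'_def using A by (rule mats_map) (use n(1) in \<open>auto intro: polys_below_mono[OF trunc_polys_below]\<close>)
  then have "finite_colength s (tangent_module s (A' + fermat_mat s n t))"
    using n by (intro finite_colength_of_top_form[OF _ fermat_mat_forms] finite_colength_fermat_mat t) auto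
  moreover have fermat: "fermat_mat s n t \<in> mats (mpow s (Suc k))"
    using fermat_mat_forms[of s n t] n(1) forms_mpow[of _ s n "Suc k"] by (auto simp: mats_def)
  have tail: "A - A' \<in> mats (mpow s (Suc k))"
    using A diff_trunc_mpow by (auto simp: A'_def mats_def)
  from mats.diff[OF fermat tail] have "(A' + fermat_mat s n t) - A \<in> mats (mpow s (Suc k))"
    by (simp add: algebra_simps)
  ultimately show ?thesis by blast
qed

section \<open>Translation of coefficient functions\<close>

definition of_ps :: "'a ps \<Rightarrow> 'a mps" where
  "of_ps f = Mps (\<lambda>\<alpha>. f (lookup \<alpha>))"

definition to_ps :: "'a::zero mps \<Rightarrow> 'a ps" where
  "to_ps f = (\<lambda>a. if finite {i. a i \<noteq> 0} then mps_nth f (Abs_poly_mapping a) else 0)"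

lemma mps_nth_of_ps: "mps_nth (of_ps f) \<alpha> = f (lookup \<alpha>)"
  by (simp add: of_ps_def)

lemma of_ps_to_ps [simp]: "of_ps (to_ps f) = f"
  by (rule mps_eqI) (simp add: mps_nth_of_ps to_ps_def lookup_inverse)

lemma finite_support_expvecs: "a \<in> expvecs s \<Longrightarrow> finite {i. a i \<noteq> 0}"
  by (rule finite_subset[of _ "{..<s}"]) (auto simp: expvecs_def intro: ccontr)

lemma lookup_expvecs: "lookup \<alpha> \<in> expvecs s \<longleftrightarrow> \<alpha> \<in> exponents s"
  by (simp add: expvecs_def exponents_iff)

lemma to_ps_of_ps [simp]: "f \<in> PS s \<Longrightarrow> to_ps (of_ps f) = f"
  using finite_support_expvecs[of _ s] by (fastforce simp: to_ps_def mps_nth_of_ps PS_def)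

lemma of_ps_Pser [simp]: "f \<in> PS s \<Longrightarrow> of_ps f \<in> Pser s"
  by (auto simp: PS_def mpow_def mps_nth_of_ps simp flip: lookup_expvecs)

lemma to_ps_PS [simp]:
  assumes "f \<in> Pser s"
  shows "to_ps f \<in> PS s"
  unfolding PS_def
proof (intro CollectI allI impI)
  fix a assume "a \<notin> expvecs s"
  then show "to_ps f a = 0"
    using assms lookup_expvecs[of "Abs_poly_mapping a" s] mpowD(1)[of f s 0] by (auto simp: to_ps_def)
qed

lemma of_ps_inj: "f \<in> PS s \<Longrightarrow> g \<in> PS s \<Longrightarrow> of_ps f = of_ps g \<Longrightarrow> f = g"
  by (metis to_ps_of_ps)

lemma bij_betw_of_ps: "bij_betw of_ps (PS s) (Pser s :: 'a::comm_ring_1 mps set)"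
  by (rule bij_betw_byWitness[where f' = to_ps]) auto

lemma bij_betw_to_ps: "bij_betw to_ps (Pser s :: 'a::comm_ring_1 mps set) (PS s)"
  by (rule bij_betw_byWitness[where f' = of_ps]) auto

lemma PS_basic [simp]:
  "ps_zero \<in> PS s" "ps_const c \<in> PS s" "ps_one \<in> PS s" "i < s \<Longrightarrow> ps_X i \<in> PS s"
  by (auto simp: PS_def ps_zero_def ps_const_def ps_one_def ps_X_def expvecs_def)

context
  fixes f g :: "'a::comm_ring_1 ps" and s :: nat
  assumes f: "f \<in> PS s"
begin

lemma PS_add [simp]: "g \<in> PS s \<Longrightarrow> ps_add f g \<in> PS s"
  using f by (simp add: PS_def ps_add_def)

lemma PS_sub [simp]: "g \<in> PS s \<Longrightarrow> ps_sub f g \<in> PS s"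
  using f by (simp add: PS_def ps_sub_def)

lemma PS_mult [simp]:
  assumes "g \<in> PS s"
  shows "ps_mult f g \<in> PS s"
  unfolding PS_def
proof (intro CollectI allI impI)
  fix a assume a: "a \<notin> expvecs s"
  have "f b * g (\<lambda>i. a i - b i) = 0" if "\<forall>i. b i \<le> a i" for b
  proof (cases "b \<in> expvecs s \<and> (\<lambda>i. a i - b i) \<in> expvecs s")
    case True
    then have "a \<in> expvecs s" using that by (fastforce simp: expvecs_def)
    with a show ?thesis by simp
  next
    case False
    then show ?thesis using f assms by (auto simp: PS_def)
  qed
  then show "ps_mult f g a = 0" unfolding ps_mult_def by (intro sum.neutral) simp
qed

lemma PS_deriv [simp]: "ps_deriv \<nu> f \<in> PS s"
  unfolding PS_def ps_deriv_def
proof (intro CollectI allI impI)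
  fix a :: "nat \<Rightarrow> nat" assume "a \<notin> expvecs s"
  then have "a(\<nu> := a \<nu> + 1) \<notin> expvecs s" by (auto simp: expvecs_def split: if_splits)
  then show "of_nat (a \<nu> + 1) * f (a(\<nu> := a \<nu> + 1)) = 0" using f by (simp add: PS_def)
qed

end

lemma PS_sum [simp]:
  "(\<And>x. x \<in> F \<Longrightarrow> f x \<in> PS s) \<Longrightarrow> (\<lambda>\<alpha>. \<Sum>x\<in>F. f x \<alpha>) \<in> PS s" for f :: "'i \<Rightarrow> 'a::comm_ring_1 ps"
  by (auto simp: PS_def intro!: sum.neutral)

lemma of_ps_zero [simp]: "of_ps ps_zero = 0"
  by (rule mps_eqI) (simp add: mps_nth_of_ps ps_zero_def)

lemma of_ps_const [simp]: "of_ps (ps_const c) = mps_const c"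
proof (rule mps_eqI)
  fix \<alpha> :: "nat \<Rightarrow>\<^sub>0 nat"
  have "lookup \<alpha> = (\<lambda>_. 0) \<longleftrightarrow> \<alpha> = 0" by (metis lookup_inject lookup_zero ext)
  then show "mps_nth (of_ps (ps_const c)) \<alpha> = mps_nth (mps_const c) \<alpha>"
    by (simp add: mps_nth_of_ps ps_const_def mps_nth_monom)
qed

lemma to_ps_const: "to_ps (mps_const c) = ps_const c"
  by (metis PS_basic(2) of_ps_const to_ps_of_ps)

lemma of_ps_one [simp]: "of_ps ps_one = 1"
  by (simp add: ps_one_def)

lemma of_ps_add [simp]: "of_ps (ps_add f g) = of_ps f + of_ps g"
  by (rule mps_eqI) (simp add: mps_nth_of_ps ps_add_def)

lemma of_ps_sub [simp]: "of_ps (ps_sub f g) = of_ps f - of_ps g"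
  by (rule mps_eqI) (simp add: mps_nth_of_ps ps_sub_def)

lemma of_ps_sum [simp]: "of_ps (\<lambda>\<alpha>. \<Sum>x\<in>F. f x \<alpha>) = (\<Sum>x\<in>F. of_ps (f x))"
  by (rule mps_eqI) (simp add: mps_nth_of_ps)

lemma of_ps_X [simp]: "of_ps (ps_X i) = mps_X i"
proof (rule mps_eqI)
  fix \<alpha> :: "nat \<Rightarrow>\<^sub>0 nat"
  have "(\<lambda>j. if j = i then 1 else 0) = lookup (single i (1 :: nat))"
    by (auto simp: fun_eq_iff lookup_single when_def)
  then show "mps_nth (of_ps (ps_X i)) \<alpha> = mps_nth (mps_X i :: 'a mps) \<alpha>"
    by (simp add: mps_nth_of_ps ps_X_def mps_X_def mps_nth_monom lookup_inject)
qed

lemma of_ps_deriv [simp]: "of_ps (ps_deriv \<nu> f) = mps_deriv \<nu> (of_ps f)"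
proof (rule mps_eqI)
  fix \<alpha> :: "nat \<Rightarrow>\<^sub>0 nat"
  have "(lookup \<alpha>)(\<nu> := lookup \<alpha> \<nu> + 1) = lookup (\<alpha> + single \<nu> 1)"
    by (auto simp: fun_eq_iff lookup_add lookup_single when_def)
  then show "mps_nth (of_ps (ps_deriv \<nu> f)) \<alpha> = mps_nth (mps_deriv \<nu> (of_ps f)) \<alpha>"
    by (simp add: mps_nth_of_ps ps_deriv_def mps_nth_deriv)
qed

lemma bij_betw_lookup_decomps: "bij_betw (lookup \<circ> fst) (decomps \<gamma>) {b. \<forall>i. b i \<le> lookup \<gamma> i}"
proof (rule bij_betw_imageI)
  show "inj_on (lookup \<circ> fst) (decomps \<gamma>)"
    by (auto simp: inj_on_def decomps_def lookup_inject)
  have "b \<in> (lookup \<circ> fst) ` decomps \<gamma>" if b: "\<forall>i. b i \<le> lookup \<gamma> i" for b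
  proof -
    define \<alpha> where "\<alpha> = Abs_poly_mapping b"
    have "i \<in> keys \<gamma>" if "b i \<noteq> 0" for i using that b by (metis in_keys_iff le_zero_eq)
    then have "finite {i. b i \<noteq> 0}" by (intro finite_subset[OF _ finite_keys[of \<gamma>]]) blast
    then have b_eq: "b = lookup \<alpha>" by (simp add: \<alpha>_def)
    then have "\<alpha> + (\<gamma> - \<alpha>) = \<gamma>" using b by (intro poly_mapping_eqI) (simp add: lookup_add lookup_minus)
    then show ?thesis unfolding b_eq by (intro image_eqI[of _ _ "(\<alpha>, \<gamma> - \<alpha>)"]) simp_all
  qed
  then show "(lookup \<circ> fst) ` decomps \<gamma> = {b. \<forall>i. b i \<le> lookup \<gamma> i}"
    by (auto simp: decomps_def lookup_add)
qed

lemma of_ps_mult [simp]: "of_ps (ps_mult f g) = of_ps f * of_ps g" for f :: "'a::comm_ring_1 ps"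
proof (rule mps_eqI)
  fix \<gamma> :: "nat \<Rightarrow>\<^sub>0 nat"
  have "mps_nth (of_ps (ps_mult f g)) \<gamma>
    = (\<Sum>(\<alpha>, \<beta>)\<in>decomps \<gamma>. f (lookup \<alpha>) * g (\<lambda>i. lookup \<gamma> i - lookup \<alpha> i))"
    unfolding mps_nth_of_ps ps_mult_def sum.reindex_bij_betw[OF bij_betw_lookup_decomps, symmetric]
    by (simp add: case_prod_unfold)
  also have "\<dots> = (\<Sum>(\<alpha>, \<beta>)\<in>decomps \<gamma>. f (lookup \<alpha>) * g (lookup \<beta>))"
    by (intro sum.cong) (auto simp: lookup_add)
  finally show "mps_nth (of_ps (ps_mult f g)) \<gamma> = mps_nth (of_ps f * of_ps g) \<gamma>"
    by (simp add: mps_nth_mult mps_nth_of_ps)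
qed

lemma ideal_gen_mpow:
  fixes S :: "'a::comm_ring_1 ps set"
  assumes S: "\<And>g. g \<in> S \<Longrightarrow> g \<in> PS s \<and> of_ps g \<in> mpow s n" and f: "f \<in> ideal_gen s S"
  shows "f \<in> PS s \<and> of_ps f \<in> mpow s n"
proof -
  obtain F :: "nat set" and r g where f: "f = (\<lambda>\<alpha>. \<Sum>x\<in>F. ps_mult (r x) (g x) \<alpha>)"
    and rg: "\<And>x. x \<in> F \<Longrightarrow> r x \<in> PS s" "\<And>x. x \<in> F \<Longrightarrow> g x \<in> S"
    using f unfolding ideal_gen_def by blast
  have "of_ps f \<in> mpow s n"
    unfolding f of_ps_sum of_ps_mult using S rg by (intro mpow.sum mpow.mult_left) auto
  moreover have "f \<in> PS s" unfolding f using S rg by (intro PS_sum PS_mult) auto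
  ultimately show ?thesis by blast
qed

lemma ideal_genI:
  fixes f :: "'a::comm_ring_1 ps" and n :: nat
  assumes "f \<in> PS s" "S \<subseteq> PS s" "\<And>i. i < n \<Longrightarrow> r i \<in> PS s" "\<And>i. i < n \<Longrightarrow> g i \<in> S"
    and "of_ps f = (\<Sum>i<n. of_ps (r i) * of_ps (g i))"
  shows "f \<in> ideal_gen s S"
proof -
  have "g i \<in> PS s" if "i < n" for i using assms(2,4) that by blast
  then have "f = (\<lambda>\<alpha>. \<Sum>i<n. ps_mult (r i) (g i) \<alpha>)"
    using assms(3,5) by (intro of_ps_inj[OF assms(1)] PS_sum PS_mult) simp_all
  then show ?thesis unfolding ideal_gen_def using assms(3,4)
    by (intro CollectI exI[of _ "{..<n}"] exI[of _ r] exI[of _ g]) simp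
qed

lemma mideal_iff: "f \<in> mideal s \<longleftrightarrow> f \<in> PS s \<and> of_ps f \<in> mpow s (Suc 0)" for f :: "'a::comm_ring_1 ps"
proof
  assume "f \<in> mideal s"
  then show "f \<in> PS s \<and> of_ps f \<in> mpow s (Suc 0)"
    unfolding mideal_def by (rule ideal_gen_mpow[rotated]) auto
next
  assume f: "f \<in> PS s \<and> of_ps f \<in> mpow s (Suc 0)"
  then obtain g where g: "\<And>i. g i \<in> Pser s" "of_ps f = (\<Sum>i<s. mps_X i * g i)"
    using mpow_Suc_eq_sum_X_mult by blast
  then show "f \<in> mideal s"
    unfolding mideal_def using f
    by (intro ideal_genI[where r = "\<lambda>i. to_ps (g i)" and g = ps_X and n = s]) (auto simp: mult.commute)
qed

lemma ideal_pow_mideal_iff: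
  "f \<in> ideal_pow s (mideal s) n \<longleftrightarrow> f \<in> PS s \<and> of_ps f \<in> mpow s n" for f :: "'a::comm_ring_1 ps"
proof (induction n arbitrary: f)
  case (Suc n)
  let ?S = "{ps_mult a b | a b. a \<in> mideal s \<and> b \<in> ideal_pow s (mideal s) n}"
  have S: "g \<in> PS s \<and> of_ps g \<in> mpow s (Suc n)" if "g \<in> ?S" for g :: "'a ps"
    using that mpow.mult[of _ s "Suc 0" _ n] by (auto simp: Suc.IH mideal_iff)
  show ?case
  proof
    assume "f \<in> ideal_pow s (mideal s) (Suc n)"
    then show "f \<in> PS s \<and> of_ps f \<in> mpow s (Suc n)"
      unfolding ideal_pow.simps ideal_mult_def using S by (rule ideal_gen_mpow[rotated])
  next
    assume f: "f \<in> PS s \<and> of_ps f \<in> mpow s (Suc n)"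
    then obtain g where g: "\<And>i. g i \<in> mpow s n" "of_ps f = (\<Sum>i<s. mps_X i * g i)"
      using mpow_Suc_eq_sum_X_mult by blast
    have "(ps_X i :: 'a ps) \<in> mideal s" if "i < s" for i using that by (simp add: mideal_iff)
    moreover have "to_ps (g i) \<in> ideal_pow s (mideal s) n" for i
      using g(1) Pser_of_mpow[OF g(1)] by (simp add: Suc.IH)
    ultimately have gens: "ps_mult (ps_X i) (to_ps (g i)) \<in> ?S" if "i < s" for i using that by blast
    show "f \<in> ideal_pow s (mideal s) (Suc n)"
      unfolding ideal_pow.simps ideal_mult_def
      by (rule ideal_genI[where r = "\<lambda>_. ps_one" and g = "\<lambda>i. ps_mult (ps_X i) (to_ps (g i))" and n = s])
         (use f g S gens in auto)
  qed
qed auto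

section \<open>Translation of matrices\<close>

definition to_m2 :: "'a mat2 \<Rightarrow> 'a mps m2" where
  "to_m2 A = M2 (of_ps (A 0 0)) (of_ps (A 0 1)) (of_ps (A 1 0)) (of_ps (A 1 1))"

definition of_m2 :: "'a::zero mps m2 \<Rightarrow> 'a mat2" where
  "of_m2 A = (\<lambda>i j. if i < 2 \<and> j < 2
     then to_ps (if i = 0 then (if j = 0 then e00 A else e01 A) else (if j = 0 then e10 A else e11 A)) else ps_zero)"

lemma to_m2_of_m2 [simp]: "to_m2 (of_m2 A) = A"
  by (cases A) (simp add: to_m2_def of_m2_def)

lemma M22_eqI:
  assumes "A \<in> M22 s" "B \<in> M22 s" "to_m2 A = to_m2 B"
  shows "A = B"
proof (rule ext, rule ext)
  fix i j
  show "A i j = B i j"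
  proof (cases "i < 2 \<and> j < 2")
    case True
    then have "A i j \<in> PS s" "B i j \<in> PS s" using assms by (auto simp: M22_def)
    moreover have "of_ps (A i j) = of_ps (B i j)"
      using True assms(3) by (auto simp: to_m2_def less_2_cases_iff)
    ultimately show ?thesis by (rule of_ps_inj)
  qed (use assms in \<open>auto simp: M22_def\<close>)
qed

lemma of_m2_M22 [simp]: "A \<in> mats (Pser s) \<Longrightarrow> of_m2 A \<in> M22 s" for A :: "'a::comm_ring_1 mps m2"
  by (auto simp: of_m2_def M22_def mats_def)

lemma to_m2_mats [simp]: "A \<in> M22 s \<Longrightarrow> to_m2 A \<in> mats (Pser s)" for A :: "'a::comm_ring_1 mat2"
  by (auto simp: to_m2_def M22_def mats_def)

lemma ps_zero_arith:
  fixes f :: "'a::comm_ring_1 ps"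
  shows "ps_add ps_zero ps_zero = (ps_zero :: 'a ps)" "ps_sub ps_zero ps_zero = (ps_zero :: 'a ps)"
    "ps_mult f ps_zero = ps_zero" "ps_deriv \<nu> ps_zero = (ps_zero :: 'a ps)"
  by (simp_all add: fun_eq_iff ps_add_def ps_sub_def ps_mult_def ps_zero_def ps_deriv_def)

context
  fixes A B :: "'a::comm_ring_1 mat2" and s :: nat
  assumes A: "A \<in> M22 s"
begin

lemma M22_add: "B \<in> M22 s \<Longrightarrow> mat_add A B \<in> M22 s"
  using A by (auto simp: M22_def mat_add_def ps_zero_arith)

lemma M22_sub: "B \<in> M22 s \<Longrightarrow> mat_sub A B \<in> M22 s"
  using A by (auto simp: M22_def mat_sub_def ps_zero_arith)

lemma M22_mult: "B \<in> M22 s \<Longrightarrow> mat_mult A B \<in> M22 s"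
  using A by (auto simp: M22_def mat_mult_def)

lemma M22_scale: "r \<in> PS s \<Longrightarrow> mat_scale r A \<in> M22 s"
  using A by (auto simp: M22_def mat_scale_def ps_zero_arith)

lemma M22_deriv: "mat_deriv \<nu> A \<in> M22 s"
  using A by (auto simp: M22_def mat_deriv_def ps_zero_arith)

lemma M22_map: "(\<And>f. f \<in> PS s \<Longrightarrow> \<phi> f \<in> PS s) \<Longrightarrow> mat_map \<phi> A \<in> M22 s"
  using A by (auto simp: M22_def mat_map_def)

end

lemma M22_E: "p < 2 \<Longrightarrow> q < 2 \<Longrightarrow> mat_E p q \<in> M22 s"
  by (auto simp: M22_def mat_E_def)

lemma M22_id: "mat_id \<in> M22 s"
  by (auto simp: M22_def mat_id_def)

lemma M22_sum:
  fixes f :: "'i \<Rightarrow> 'a::comm_ring_1 mat2"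
  assumes "\<And>x. x \<in> F \<Longrightarrow> f x \<in> M22 s"
  shows "(\<lambda>i j \<alpha>. \<Sum>x\<in>F. f x i j \<alpha>) \<in> M22 s"
  unfolding M22_def
proof (intro CollectI conjI allI impI)
  fix i j :: nat assume "i < 2 \<and> j < 2"
  then show "(\<lambda>\<alpha>. \<Sum>x\<in>F. f x i j \<alpha>) \<in> PS s" using assms by (intro PS_sum) (auto simp: M22_def)
next
  fix i j :: nat assume "\<not> (i < 2 \<and> j < 2)"
  then have "f x i j = ps_zero" if "x \<in> F" for x using assms[OF that] by (simp add: M22_def)
  then show "(\<lambda>\<alpha>. \<Sum>x\<in>F. f x i j \<alpha>) = ps_zero" by (simp add: ps_zero_def fun_eq_iff)
qed

lemma to_m2_simps [simp]:
  fixes A B :: "'a::comm_ring_1 mat2"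
  shows "to_m2 (mat_add A B) = to_m2 A + to_m2 B" "to_m2 (mat_sub A B) = to_m2 A - to_m2 B"
    "to_m2 (mat_mult A B) = to_m2 A * to_m2 B" "to_m2 (mat_scale r A) = smul (of_ps r) (to_m2 A)"
    "to_m2 (mat_deriv \<nu> A) = map_m2 (mps_deriv \<nu>) (to_m2 A)" "to_m2 mat_id = (1 :: 'a mps m2)"
    "to_m2 (\<lambda>i j \<alpha>. \<Sum>x\<in>F. f x i j \<alpha>) = (\<Sum>x\<in>F. to_m2 (f x))"
  by (simp_all add: m2_eq_iff to_m2_def mat_add_def mat_sub_def mat_mult_def mat_scale_def mat_deriv_def mat_id_def)

lemma to_m2_map:
  "A \<in> M22 s \<Longrightarrow> to_m2 (mat_map \<phi> A) = map_m2 (\<lambda>f. of_ps (\<phi> (to_ps f))) (to_m2 A)" for A :: "'a::comm_ring_1 mat2"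
  using to_ps_of_ps[of "A 0 0" s] to_ps_of_ps[of "A 0 1" s] to_ps_of_ps[of "A 1 0" s] to_ps_of_ps[of "A 1 1" s]
  by (simp add: m2_eq_iff to_m2_def mat_map_def M22_def)

lemma to_m2_eq_sum_E:
  fixes A :: "'a::comm_ring_1 mat2"
  shows "to_m2 A = (\<Sum>(p, q)\<in>{..<2} \<times> {..<2}. smul (of_ps (A p q)) (to_m2 (mat_E p q)))"
  by (simp add: sum.cartesian_product[symmetric] numeral_2_eq_2 to_m2_def mat_E_def m2_eq_iff)

lemma ideal_mat_iff:
  "A \<in> ideal_mat (ideal_pow s (mideal s) n) \<longleftrightarrow> A \<in> M22 s \<and> to_m2 A \<in> mats (mpow s n)" for A :: "'a::comm_ring_1 mat2"
  by (auto simp: ideal_mat_def M22_def ideal_pow_mideal_iff to_m2_def mats_def less_2_cases_iff)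

subsection \<open>Linear combinations\<close>

lemma (in submodule) lin_comb_mem:
  assumes I: "I \<subseteq> PS s" and S: "S \<subseteq> M22 s"
    and gen: "\<And>r B. r \<in> I \<Longrightarrow> B \<in> S \<Longrightarrow> smul (of_ps r) (to_m2 B) \<in> N" and C: "C \<in> lin_comb I S"
  shows "C \<in> M22 s \<and> to_m2 C \<in> N"
proof -
  obtain F :: "nat set" and r B where C: "C = (\<lambda>i j \<alpha>. \<Sum>x\<in>F. mat_scale (r x) (B x) i j \<alpha>)"
    and rB: "\<And>x. x \<in> F \<Longrightarrow> r x \<in> I" "\<And>x. x \<in> F \<Longrightarrow> B x \<in> S"
    using C unfolding lin_comb_def by blast
  have "C \<in> M22 s" unfolding C using rB I S by (intro M22_sum M22_scale) auto
  moreover have "to_m2 C = (\<Sum>x\<in>F. smul (of_ps (r x)) (to_m2 (B x)))"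
    unfolding C by simp
  then have "to_m2 C \<in> N" using rB gen by (auto intro!: sum)
  ultimately show ?thesis by blast
qed

lemma (in submodule) submodule_colon: "submodule s {W. \<forall>r\<in>I. smul r W \<in> N}"
proof
  fix r :: "'a mps" and W assume "r \<in> Pser s" "W \<in> {W. \<forall>r\<in>I. smul r W \<in> N}"
  then show "smul r W \<in> {W. \<forall>r\<in>I. smul r W \<in> N}"
    using smul by (auto simp: smul.scale_left_commute[of _ r] simp del: smul.scale_scale)
qed (simp_all add: zero add smul.scale_right_distrib)

lemma lin_combI:
  fixes C :: "'a::comm_ring_1 mat2"
  assumes J: "finite J" and rB: "\<And>j. j \<in> J \<Longrightarrow> r j \<in> I" "\<And>j. j \<in> J \<Longrightarrow> B j \<in> S"
    and I: "I \<subseteq> PS s" and S: "S \<subseteq> M22 s"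
    and C: "C \<in> M22 s" "to_m2 C = (\<Sum>j\<in>J. smul (of_ps (r j)) (to_m2 (B j)))"
  shows "C \<in> lin_comb I S"
proof -
  obtain h where h: "bij_betw h {0..<card J} J" using ex_bij_betw_nat_finite[OF J] by blast
  then have "h x \<in> J" if "x < card J" for x using that by (auto simp: bij_betw_def)
  with rB have rB_h: "r (h x) \<in> I" "B (h x) \<in> S" if "x < card J" for x using that by blast+
  have "to_m2 C = (\<Sum>x\<in>{0..<card J}. smul (of_ps (r (h x))) (to_m2 (B (h x))))"
    unfolding C(2) by (rule sum.reindex_bij_betw[OF h, symmetric])
  then have "C = (\<lambda>i j \<alpha>. \<Sum>x\<in>{0..<card J}. mat_scale (r (h x)) (B (h x)) i j \<alpha>)"
    using rB_h I S by (intro M22_eqI[OF C(1)] M22_sum M22_scale) auto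
  then show ?thesis unfolding lin_comb_def using rB_h
    by (intro CollectI exI[of _ "{0..<card J}"] exI[of _ "\<lambda>x. r (h x)"] exI[of _ "\<lambda>x. B (h x)"]) simp
qed

lemma lin_comb_superset: "S \<subseteq> M22 s \<Longrightarrow> S \<subseteq> lin_comb (PS s) S" for S :: "'a::comm_ring_1 mat2 set"
  by (auto intro!: lin_combI[where J = "{()}" and r = "\<lambda>_. ps_one" and s = s])

lemma lin_comb_M22:
  fixes S :: "'a::comm_ring_1 mat2 set"
  assumes "I \<subseteq> PS s" "S \<subseteq> M22 s"
  shows "lin_comb I S \<subseteq> M22 s"
proof -
  interpret submodule s UNIV by standard auto
  show ?thesis using lin_comb_mem[OF assms] by blast
qed

subsection \<open>The tangent image\<close>

context
  fixes s :: nat and A :: "'a::comm_ring_1 mat2"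
  assumes A: "A \<in> M22 s"
begin

lemma tangent_image_gens_M22:
  "{mat_mult (mat_E p q) A | p q. p < 2 \<and> q < 2} \<subseteq> M22 s" "{mat_mult A (mat_E h l) | h l. h < 2 \<and> l < 2} \<subseteq> M22 s"
  "{mat_deriv \<nu> A | \<nu>. \<nu> < s} \<subseteq> M22 s"
  using A by (auto intro!: M22_mult M22_E M22_deriv)

lemma left_multiple_lin_comb:
  assumes u: "u \<in> mats (Pser s)"
  shows "of_m2 (u * to_m2 A) \<in> lin_comb (PS s) {mat_mult (mat_E p q) A | p q. p < 2 \<and> q < 2}"
proof (rule lin_combI)
  have "u * to_m2 A = to_m2 (of_m2 u) * to_m2 A" by simp
  also have "\<dots> = (\<Sum>(p, q)\<in>{..<2} \<times> {..<2}. smul (of_ps (of_m2 u p q)) (to_m2 (mat_mult (mat_E p q) A)))"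
    by (subst to_m2_eq_sum_E) (simp add: sum_distrib_right case_prod_unfold)
  finally show "to_m2 (of_m2 (u * to_m2 A))
      = (\<Sum>j\<in>{..<2} \<times> {..<2}. smul (of_ps (of_m2 u (fst j) (snd j))) (to_m2 (mat_mult (mat_E (fst j) (snd j)) A)))"
    by (simp add: case_prod_unfold)
  show "of_m2 u (fst j) (snd j) \<in> PS s" if "j \<in> {..<2} \<times> {..<2}" for j
    using of_m2_M22[OF u] that by (auto simp: M22_def)
  show "mat_mult (mat_E (fst j) (snd j)) A \<in> {mat_mult (mat_E p q) A | p q. p < 2 \<and> q < 2}"
    if "j \<in> {..<2} \<times> {..<2}" for j
    using that by (intro CollectI exI conjI refl) auto
qed (use u A tangent_image_gens_M22(1) in auto)

lemma right_multiple_lin_comb: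
  assumes v: "v \<in> mats (Pser s)"
  shows "of_m2 (to_m2 A * v) \<in> lin_comb (PS s) {mat_mult A (mat_E h l) | h l. h < 2 \<and> l < 2}"
proof (rule lin_combI)
  have "to_m2 A * v = to_m2 A * to_m2 (of_m2 v)" by simp
  also have "\<dots> = (\<Sum>(p, q)\<in>{..<2} \<times> {..<2}. smul (of_ps (of_m2 v p q)) (to_m2 (mat_mult A (mat_E p q))))"
    by (subst (2) to_m2_eq_sum_E) (simp add: sum_distrib_left case_prod_unfold)
  finally show "to_m2 (of_m2 (to_m2 A * v))
      = (\<Sum>j\<in>{..<2} \<times> {..<2}. smul (of_ps (of_m2 v (fst j) (snd j))) (to_m2 (mat_mult A (mat_E (fst j) (snd j)))))"
    by (simp add: case_prod_unfold)
  show "of_m2 v (fst j) (snd j) \<in> PS s" if "j \<in> {..<2} \<times> {..<2}" for j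
    using of_m2_M22[OF v] that by (auto simp: M22_def)
  show "mat_mult A (mat_E (fst j) (snd j)) \<in> {mat_mult A (mat_E h l) | h l. h < 2 \<and> l < 2}"
    if "j \<in> {..<2} \<times> {..<2}" for j
    using that by (intro CollectI exI conjI refl) auto
qed (use v A tangent_image_gens_M22(2) in auto)

lemma vector_field_lin_comb:
  assumes d: "\<And>\<nu>. d \<nu> \<in> mpow s (Suc 0)"
  shows "of_m2 (\<Sum>\<nu><s. smul (d \<nu>) (map_m2 (mps_deriv \<nu>) (to_m2 A)))
    \<in> lin_comb (mideal s) (lin_comb (PS s) {mat_deriv \<nu> A | \<nu>. \<nu> < s})"
proof (rule lin_combI)
  show "to_m2 (of_m2 (\<Sum>\<nu><s. smul (d \<nu>) (map_m2 (mps_deriv \<nu>) (to_m2 A))))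
    = (\<Sum>\<nu><s. smul (of_ps (to_ps (d \<nu>))) (to_m2 (mat_deriv \<nu> A)))"
    by simp
  show "to_ps (d \<nu>) \<in> mideal s" for \<nu> using d Pser_of_mpow[OF d] by (simp add: mideal_iff)
  show "mat_deriv \<nu> A \<in> lin_comb (PS s) {mat_deriv \<nu> A | \<nu>. \<nu> < s}" if "\<nu> \<in> {..<s}" for \<nu>
    using lin_comb_superset[OF tangent_image_gens_M22(3)] that by blast
  show "lin_comb (PS s) {mat_deriv \<nu> A | \<nu>. \<nu> < s} \<subseteq> M22 s" by (intro lin_comb_M22 tangent_image_gens_M22) simp
  show "of_m2 (\<Sum>\<nu><s. smul (d \<nu>) (map_m2 (mps_deriv \<nu>) (to_m2 A))) \<in> M22 s"
    using A Pser_of_mpow[OF d] by (intro of_m2_M22 mats.sum) simp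
qed (auto simp: mideal_iff)

lemma tangent_module_subset_tangent_image:
  assumes C: "C \<in> M22 s" "to_m2 C \<in> tangent_module s (to_m2 A)"
  shows "C \<in> tangent_image s A"
proof -
  obtain u v d where z: "(u, v, d) \<in> displacements s 0" and C_eq: "to_m2 C = inf_act s (to_m2 A) (u, v, d)"
    using C(2) by (elim tangent_moduleE) auto
  then have uvd: "u \<in> mats (Pser s)" "v \<in> mats (Pser s)" "\<And>\<nu>. d \<nu> \<in> mpow s (Suc 0)"
    by (auto simp: displacements_iff)
  let ?X = "of_m2 (u * to_m2 A)" and ?Y = "of_m2 (to_m2 A * v)"
    and ?Z = "of_m2 (\<Sum>\<nu><s. smul (d \<nu>) (map_m2 (mps_deriv \<nu>) (to_m2 A)))"
  have "(\<Sum>\<nu><s. smul (d \<nu>) (map_m2 (mps_deriv \<nu>) (to_m2 A))) \<in> mats (Pser s)"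
    using A Pser_of_mpow[OF uvd(3)] by (intro mats.sum) simp
  then have "C = mat_add (mat_add ?X ?Y) ?Z"
    using A uvd by (intro M22_eqI[OF C(1)] M22_add of_m2_M22) (simp_all add: C_eq inf_act_Pair)
  then show ?thesis
    unfolding tangent_image_def mod_sum_def
    using left_multiple_lin_comb[OF uvd(1)] right_multiple_lin_comb[OF uvd(2)] vector_field_lin_comb[of d, OF uvd(3)]
    by blast
qed

lemma tangent_image_subset_tangent_module:
  assumes C: "C \<in> tangent_image s A"
  shows "C \<in> M22 s \<and> to_m2 C \<in> tangent_module s (to_m2 A)"
proof -
  let ?T = "tangent_module s (to_m2 A)"
  let ?L = "{mat_mult (mat_E p q) A | p q. p < 2 \<and> q < 2}" and ?R = "{mat_mult A (mat_E h l) | h l. h < 2 \<and> l < 2}"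
    and ?D = "{mat_deriv \<nu> A | \<nu>. \<nu> < s}"
  obtain X Y Z where C_eq: "C = mat_add (mat_add X Y) Z" and X: "X \<in> lin_comb (PS s) ?L"
    and Y: "Y \<in> lin_comb (PS s) ?R" and Z: "Z \<in> lin_comb (mideal s) (lin_comb (PS s) ?D)"
    using C unfolding tangent_image_def mod_sum_def by blast
  have "X \<in> M22 s \<and> to_m2 X \<in> ?T"
    by (rule tangent_module.lin_comb_mem[OF _ tangent_image_gens_M22(1) _ X])
       (auto intro!: tangent_module.smul tangent_module_mult to_m2_mats M22_E)
  moreover have "Y \<in> M22 s \<and> to_m2 Y \<in> ?T"
    by (rule tangent_module.lin_comb_mem[OF _ tangent_image_gens_M22(2) _ Y])
       (auto intro!: tangent_module.smul tangent_module_mult to_m2_mats M22_E)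
  moreover have "Z \<in> M22 s \<and> to_m2 Z \<in> ?T"
  proof (rule tangent_module.lin_comb_mem[OF _ _ _ Z])
    show "lin_comb (PS s) ?D \<subseteq> M22 s" by (intro lin_comb_M22 tangent_image_gens_M22) simp
    fix r :: "'a ps" and W assume r: "r \<in> mideal s" and W: "W \<in> lin_comb (PS s) ?D"
    have "W \<in> M22 s \<and> to_m2 W \<in> {W. \<forall>r\<in>mpow s (Suc 0). smul r W \<in> ?T}"
      by (rule submodule.lin_comb_mem[OF tangent_module.submodule_colon _ tangent_image_gens_M22(3) _ W])
         (auto intro!: tangent_module_deriv)
    with r show "smul (of_ps r) (to_m2 W) \<in> ?T" by (simp add: mideal_iff)
  qed (auto simp: mideal_iff)
  ultimately show ?thesis
    unfolding C_eq by (auto intro!: M22_add tangent_module.add)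
qed

lemma tangent_image_eq: "tangent_image s A = {C \<in> M22 s. to_m2 C \<in> tangent_module s (to_m2 A)}"
  using tangent_module_subset_tangent_image tangent_image_subset_tangent_module by blast

end

lemma (in field_submodule) finite_colength_of_finite_codim:
  assumes "finite_codim s {C \<in> M22 s. to_m2 C \<in> N}"
  shows "finite_colength s N"
proof -
  let ?K = "{ps_const c | c :: 'a. True}"
  obtain F :: "nat set" and C where F: "finite F"
    and cover: "M22 s \<subseteq> mod_sum (lin_comb ?K (C ` F)) {C \<in> M22 s. to_m2 C \<in> N}"
    using assms unfolding finite_codim_def by blast
  let ?G = "to_m2 ` C ` F"
  have span: "to_m2 X \<in> mat_space.span ?G" if X: "X \<in> lin_comb ?K (C ` F)" for X
  proof -
    obtain J :: "nat set" and r B where "X = (\<lambda>i j \<alpha>. \<Sum>x\<in>J. mat_scale (r x) (B x) i j \<alpha>)"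
      and rB: "\<forall>x\<in>J. r x \<in> ?K \<and> B x \<in> C ` F"
      using X unfolding lin_comb_def by blast
    then have "to_m2 X = (\<Sum>x\<in>J. smul (of_ps (r x)) (to_m2 (B x)))" by simp
    also have "\<dots> \<in> mat_space.span ?G"
    proof (rule mat_space.span_sum)
      fix x assume "x \<in> J"
      with rB obtain c where "r x = ps_const c" "B x \<in> C ` F" by blast
      then show "smul (of_ps (r x)) (to_m2 (B x)) \<in> mat_space.span ?G"
        by (simp add: mat_space.span_scale mat_space.span_base)
    qed
    finally show ?thesis .
  qed
  show ?thesis
  proof (rule finite_colength_of_span)
    fix i j and E :: "'a mps m2" assume "i < s" "E \<in> unit_mats"
    then have "smul (mps_X i ^ j) E \<in> mats (Pser s)" using unit_mats_Pser[of s] by auto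
    then have "of_m2 (smul (mps_X i ^ j) E) \<in> M22 s" by simp
    then obtain X T where XT: "of_m2 (smul (mps_X i ^ j) E) = mat_add X T" "X \<in> lin_comb ?K (C ` F)" "to_m2 T \<in> N"
      using cover unfolding mod_sum_def by blast
    have "smul (mps_X i ^ j) E = to_m2 X + to_m2 T" using arg_cong[OF XT(1), of to_m2] by simp
    then show "\<exists>r\<in>mat_space.span ?G. smul (mps_X i ^ j) E - r \<in> N"
      using span[OF XT(2)] XT(3) by (intro bexI[of _ "to_m2 X"]) simp_all
  qed (use F in simp)
qed

lemma finite_codimI:
  assumes H: "finite H" "H \<subseteq> M22 s" and cover: "M22 s \<subseteq> mod_sum (lin_comb {ps_const c | c. True} H) N"
  shows "finite_codim s N"
proof -
  obtain h :: "nat \<Rightarrow> _" where h: "bij_betw h {0..<card H} H" using ex_bij_betw_nat_finite[OF H(1)] by blast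
  then have "h ` {0..<card H} = H" by (simp add: bij_betw_def)
  then show ?thesis unfolding finite_codim_def using H cover
    by (intro exI[of _ "{0..<card H}"] exI[of _ h]) auto
qed

lemma (in field_submodule) finite_codim_of_finite_colength:
  assumes "finite_colength s N"
  shows "finite_codim s {C \<in> M22 s. to_m2 C \<in> N}"
proof -
  obtain n where n: "mats (mpow s n) \<subseteq> N" using assms unfolding finite_colength_def ..
  let ?G = "monomial_mats s n :: 'a mps m2 set" and ?K = "{ps_const c | c :: 'a. True}"
  have G_M22: "of_m2 ` ?G \<subseteq> M22 s" using monomial_mats_Pser[of s n] by auto
  show ?thesis
  proof (rule finite_codimI[OF _ G_M22], simp add: finite_monomial_mats, rule subsetI)
    fix X :: "'a mat2" assume X: "X \<in> M22 s"
    define R where "R = map_m2 (trunc s n) (to_m2 X)"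
    have R: "R \<in> mats (Pser s)" by (simp add: R_def mats_def)
    obtain c where c: "R = (\<Sum>g\<in>?G. smul (mps_const (c g)) g)"
      using trunc_in_span_monomial_mats[of s n "to_m2 X"]
      unfolding R_def mat_space.span_finite[OF finite_monomial_mats] by blast
    have "of_m2 R \<in> lin_comb ?K (of_m2 ` ?G)"
    proof (rule lin_combI[OF finite_monomial_mats])
      show "to_m2 (of_m2 R) = (\<Sum>g\<in>?G. smul (of_ps (ps_const (c g))) (to_m2 (of_m2 g)))"
        by (simp add: c)
    qed (use G_M22 R in auto)
    moreover have "to_m2 X - R \<in> mats (mpow s n)"
      using to_m2_mats[OF X] mpow.antimono[OF diff_trunc_mpow, of _ s n n] by (auto simp: R_def mats_def)
    then have "to_m2 X - R \<in> N" using n by blast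
    then have "of_m2 (to_m2 X - R) \<in> {C \<in> M22 s. to_m2 C \<in> N}" using X R by simp
    moreover have "X = mat_add (of_m2 R) (of_m2 (to_m2 X - R))"
      using X R by (intro M22_eqI[OF X] M22_add) simp_all
    ultimately show "X \<in> mod_sum (lin_comb ?K (of_m2 ` ?G)) {C \<in> M22 s. to_m2 C \<in> N}"
      unfolding mod_sum_def by blast
  qed
qed

lemma finite_codim_tangent_image_iff:
  fixes A :: "'a::field mat2"
  assumes "A \<in> M22 s"
  shows "finite_codim s (tangent_image s A) \<longleftrightarrow> finite_colength s (tangent_module s (to_m2 A))"
  unfolding tangent_image_eq[OF assms]
  using tangent_module.finite_colength_of_finite_codim tangent_module.finite_codim_of_finite_colength by blast

section \<open>The equivalence\<close>

lemma power_series_automorphism_of_Kalg_aut: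
  fixes \<phi> :: "'a::field ps \<Rightarrow> 'a ps"
  assumes \<phi>: "Kalg_aut s \<phi>"
  shows "power_series_automorphism s (\<lambda>f. of_ps (\<phi> (to_ps f)))"
proof
  have "bij_betw (of_ps \<circ> (\<phi> \<circ> to_ps)) (Pser s) (Pser s :: 'a mps set)"
    using \<phi> by (intro bij_betw_trans[OF bij_betw_trans[OF bij_betw_to_ps] bij_betw_of_ps]) (simp add: Kalg_aut_def)
  then show "bij_betw (\<lambda>f. of_ps (\<phi> (to_ps f))) (Pser s) (Pser s)" by (simp add: comp_def)
next
  fix f g :: "'a mps" assume fg: "f \<in> Pser s" "g \<in> Pser s"
  have "to_ps (f + g) = ps_add (to_ps f) (to_ps g)" "to_ps (f * g) = ps_mult (to_ps f) (to_ps g)"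
    by (rule of_ps_inj[where s = s]; use fg in simp)+
  then show "of_ps (\<phi> (to_ps (f + g))) = of_ps (\<phi> (to_ps f)) + of_ps (\<phi> (to_ps g))"
    "of_ps (\<phi> (to_ps (f * g))) = of_ps (\<phi> (to_ps f)) * of_ps (\<phi> (to_ps g))"
    using \<phi> fg by (simp_all add: Kalg_aut_def)
next
  fix c show "of_ps (\<phi> (to_ps (mps_const c))) = mps_const c"
    using \<phi> by (simp add: to_ps_const Kalg_aut_def)
qed

lemma Kalg_aut_subst:
  fixes d :: "nat \<Rightarrow> 'a::field mps"
  assumes d: "\<And>i. i < s \<Longrightarrow> d i \<in> mpow s 2"
  shows "Kalg_aut s (\<lambda>f. to_ps (mps_subst s (\<lambda>i. mps_X i + d i) (of_ps f)))"
proof -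
  let ?\<phi> = "mps_subst s (\<lambda>i. mps_X i + d i)"
  have X_d: "mps_X i + d i \<in> mpow s 1" if "i < s" for i using mpow.antimono[OF d, of i 1] that by simp
  have Pser: "?\<phi> f \<in> Pser s" if "f \<in> Pser s" for f
    using that X_d[THEN Pser_of_mpow] by (rule mpow_subst)
  have "bij_betw (to_ps \<circ> (?\<phi> \<circ> of_ps)) (PS s) (PS s :: 'a ps set)"
    using d by (intro bij_betw_trans[OF bij_betw_trans[OF bij_betw_of_ps bij_betw_subst] bij_betw_to_ps])
  then have "bij_betw (\<lambda>f. to_ps (?\<phi> (of_ps f))) (PS s) (PS s)" by (simp add: comp_def)
  moreover have "to_ps (?\<phi> (of_ps (ps_add f g))) = ps_add (to_ps (?\<phi> (of_ps f))) (to_ps (?\<phi> (of_ps g)))"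
    if "f \<in> PS s" "g \<in> PS s" for f g
    by (rule of_ps_inj[where s = s]) (use Pser that in \<open>simp_all add: mps_subst.add\<close>)
  moreover have "to_ps (?\<phi> (of_ps (ps_mult f g))) = ps_mult (to_ps (?\<phi> (of_ps f))) (to_ps (?\<phi> (of_ps g)))"
    if "f \<in> PS s" "g \<in> PS s" for f g
    by (rule of_ps_inj[where s = s])
       (use Pser X_d that in \<open>simp_all add: mps_subst_mult[where g = "\<lambda>i. mps_X i + d i"] del: One_nat_def\<close>)
  moreover have "to_ps (?\<phi> (of_ps (ps_const c))) = ps_const c" for c
    using X_d by (simp add: mps_subst_const to_ps_const)
  ultimately show ?thesis unfolding Kalg_aut_def by blast
qed

lemma GL2_unipotent:
  fixes u :: "'a::field mps m2"
  assumes u: "u \<in> mats (mpow s 1)"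
  shows "of_m2 (1 + u) \<in> GL2 s"
proof -
  have one_u: "1 + u \<in> mats (Pser s)" using mats.antimono[OF u, of 0] by simp
  have "mps_nth (det (1 + u)) 0 = 1"
    using u by (simp add: det_def mats_def mpow_Suc_0_iff mps_nth_one)
  then obtain W where W: "W \<in> mats (Pser s)" "(1 + u) * W = 1" "W * (1 + u) = 1"
    using mats_inverse[OF one_u] by auto
  have "mat_mult (of_m2 (1 + u)) (of_m2 W) = mat_id" "mat_mult (of_m2 W) (of_m2 (1 + u)) = mat_id"
    by (rule M22_eqI[where s = s]; use W one_u in \<open>simp add: M22_mult M22_id\<close>)+
  then show ?thesis unfolding GL2_def using W(1) one_u by (intro CollectI conjI bexI[of _ "of_m2 W"]) auto
qed

lemma G_equiv_of_group_act:
  fixes A B :: "'a::field mat2"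
  assumes A: "A \<in> M22 s" and B: "B \<in> M22 s" and z: "z \<in> displacements s 1"
    and act: "group_act s (to_m2 A) z = to_m2 B"
  shows "G_equiv s A B"
proof -
  obtain u v d where z_eq: "z = (u, v, d)" by (cases z)
  with z have uvd: "u \<in> mats (mpow s 1)" "v \<in> mats (mpow s 1)" "\<And>i. d i \<in> mpow s 2"
    by (simp_all add: displacements_iff numeral_2_eq_2)
  let ?\<phi> = "\<lambda>f. to_ps (mps_subst s (\<lambda>i. mps_X i + d i) (of_ps f))"
  have aut: "Kalg_aut s ?\<phi>" by (intro Kalg_aut_subst uvd)
  then have \<phi>_PS: "?\<phi> f \<in> PS s" if "f \<in> PS s" for f using that by (auto simp: Kalg_aut_def bij_betw_def)
  have GL2: "of_m2 (1 + u) \<in> GL2 s" "of_m2 (1 + v) \<in> GL2 s" using uvd by (simp_all only: GL2_unipotent)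
  then have "mat_mult (mat_mult (of_m2 (1 + u)) (mat_map ?\<phi> A)) (of_m2 (1 + v)) \<in> M22 s"
    by (intro M22_mult M22_map A \<phi>_PS) (simp_all add: GL2_def)
  then have "B = mat_mult (mat_mult (of_m2 (1 + u)) (mat_map ?\<phi> A)) (of_m2 (1 + v))"
    by (rule M22_eqI[OF B]) (simp add: to_m2_map[OF A] group_act_def z_eq flip: act)
  then show ?thesis unfolding G_equiv_def G_orbit_def using GL2 aut by blast
qed

lemma finite_colength_of_G_equiv:
  fixes A B :: "'a::field mat2"
  assumes A: "A \<in> M22 s" and equiv: "G_equiv s A B"
    and colength: "finite_colength s (tangent_module s (to_m2 B))"
  shows "finite_colength s (tangent_module s (to_m2 A))"
proof -
  obtain U V \<phi> where B: "B = mat_mult (mat_mult U (mat_map \<phi> A)) V" and U: "U \<in> GL2 s" and V: "V \<in> GL2 s"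
    and \<phi>: "Kalg_aut s \<phi>"
    using equiv unfolding G_equiv_def G_orbit_def by blast
  interpret power_series_automorphism s "\<lambda>f. of_ps (\<phi> (to_ps f))"
    by (rule power_series_automorphism_of_Kalg_aut[OF \<phi>])
  obtain U' where U': "U \<in> M22 s" "U' \<in> M22 s" "mat_mult U' U = mat_id" using U unfolding GL2_def by blast
  obtain V' where V': "V \<in> M22 s" "V' \<in> M22 s" "mat_mult V V' = mat_id" using V unfolding GL2_def by blast
  have "to_m2 U' * to_m2 U = 1" "to_m2 V * to_m2 V' = 1"
    using arg_cong[OF U'(3), of to_m2] arg_cong[OF V'(3), of to_m2] by simp_all
  moreover have "to_m2 B = to_m2 U * mmap (to_m2 A) * to_m2 V"
    by (simp add: B to_m2_map[OF A])
  ultimately show ?thesis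
    using finite_colength_tangent_module_pullback[of "to_m2 A" "to_m2 U" "to_m2 U'" "to_m2 V" "to_m2 V'"]
      A U' V' colength by simp
qed

lemma finitely_G_determined_of_finite_colength:
  fixes A :: "'a::field mat2"
  assumes A: "A \<in> M22 s" and colength: "finite_colength s (tangent_module s (to_m2 A))"
  shows "finitely_G_determined s A"
proof -
  obtain n where n: "mats (mpow s n) \<subseteq> tangent_module s (to_m2 A)"
    using colength unfolding finite_colength_def ..
  define c where "c = Suc n"
  have c: "mats (mpow s c) \<subseteq> tangent_module s (to_m2 A)"
    using n mats.antimono[of _ s c n] by (auto simp: c_def)
  have "G_equiv s A B" if B: "B \<in> M22 s" "mat_sub B A \<in> ideal_mat (ideal_pow s (mideal s) (2 * c + 1))" for B
  proof -
    have "to_m2 B - to_m2 A \<in> mats (mpow s (2 * c + 1))" using B(2) unfolding ideal_mat_iff by simp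
    then obtain z where "z \<in> displacements s 1" "group_act s (to_m2 A) z = to_m2 B"
      using group_act_transitive[OF to_m2_mats[OF A] c] by blast
    then show ?thesis by (rule G_equiv_of_group_act[OF A B(1)])
  qed
  then have "G_k_determined s (2 * c) A" unfolding G_k_determined_def by simp
  moreover have "0 < 2 * c" by (simp add: c_def)
  ultimately show ?thesis unfolding finitely_G_determined_def by blast
qed

lemma finite_colength_of_finitely_G_determined:
  fixes A :: "'a::field mat2"
  assumes infinite: "infinite (UNIV :: 'a set)" and A: "A \<in> M22 s" and det: "finitely_G_determined s A"
  shows "finite_colength s (tangent_module s (to_m2 A))"
proof -
  obtain k where k: "G_k_determined s k A" using det unfolding finitely_G_determined_def by blast
  obtain B where B: "B - to_m2 A \<in> mats (mpow s (Suc k))" and colength: "finite_colength s (tangent_module s B)"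
    using ex_finite_colength_perturbation[OF infinite to_m2_mats[OF A]] by blast
  have "(B - to_m2 A) + to_m2 A \<in> mats (Pser s)" using mats.antimono[OF B, of 0] A by (intro mats.add) simp_all
  then have "of_m2 B \<in> M22 s" by simp
  moreover from this have "mat_sub (of_m2 B) A \<in> ideal_mat (ideal_pow s (mideal s) (k + 1))"
    unfolding ideal_mat_iff using B A by (simp add: M22_sub)
  ultimately have "G_equiv s A (of_m2 B)" using k by (simp add: G_k_determined_def)
  then show ?thesis by (rule finite_colength_of_G_equiv[OF A]) (simp add: colength)
qed

theorem theorem1p2:
  fixes s :: nat and A :: "'a::field mat2"
  assumes "infinite (UNIV :: 'a set)"
    and "A \<in> M22 s" and "A \<in> ideal_mat (mideal s)"
  shows "finitely_G_determined s A \<longleftrightarrow> finite_codim s (tangent_image s A)"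
proof
  assume "finitely_G_determined s A"
  then show "finite_codim s (tangent_image s A)"
    unfolding finite_codim_tangent_image_iff[OF assms(2)]
    by (rule finite_colength_of_finitely_G_determined[OF assms(1,2)])
next
  assume "finite_codim s (tangent_image s A)"
  then show "finitely_G_determined s A"
    unfolding finite_codim_tangent_image_iff[OF assms(2)]
    by (rule finitely_G_determined_of_finite_colength[OF assms(2)])
qed

end
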